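(* Let $k$ be a field. Let $P(X,Z)\in k[X,Z]$ be monic in $Z$ with $\deg_Z P=r\ge 2$ and $Q(X,Y,Z)\in k[X,Y,Z]$ be monic in $Y$ with $\deg_Y Q=s\ge 2$. For positive integers $d,e$ let $$B_{d,e}=\frac{k[X,Y,Z,T]}{(X^{d}Y-P(X,Z),\;X^{e}T-Q(X,Y,Z))}.$$ Let $P'(X,Z)=\partial P/\partial Z$ and $Q'(X,Y,Z)=\partial Q/\partial Y$ be the formal partial derivatives, and suppose that $$(P(0,Z),P'(0,Z))k[Z]=k[Z]\quad\text{and}\quad (P(0,Z),Q(0,Y,Z),Q'(0,Y,Z))k[Y,Z]=k[Y,Z].$$ Then for all positive integers $d,e$, $$B_{d,e}\ncong B_{d,e+1}\quad\text{but}\quad B_{d,e}^{[1]}\cong B_{d,e+1}^{[1]}$$ as $k$-algebras. Thus the rings $B_{d,e}$ provide counter-examples to the Cancellation Problem.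
   Context: For a ring $C$, $C^{[1]}$ denotes the polynomial ring in one variable over $C$. For a ring $S$, $(a,b,\dots)S$ denotes the ideal of $S$ generated by $a,b,\dots$. The Cancellation Problem asks: if $A$ and $B$ are finitely generated $k$-algebras with $A^{[1]}\cong_k B^{[1]}$, does it follow that $A\cong_k B$? *)

theory Defs
  imports "HOL-Algebra.Algebra" "HOL-Algebra.Algebraic_Closure_Type"
begin

text \<open>
  An algebra over the field \<open>'k\<close> is a commutative ring together with its structure map.
\<close>

record ('k, 'a) alg = "'a ring" +
  scal :: "'k \<Rightarrow> 'a"

definition k_algebra :: "('k::field, 'a) alg \<Rightarrow> bool" where
  "k_algebra A \<longleftrightarrow> cring A \<and> scal A \<in> ring_hom (ring_of_type_algebra :: 'k ring) A"

definition fg_algebra :: "('k::field, 'a) alg \<Rightarrow> bool" where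
  "fg_algebra A \<longleftrightarrow> k_algebra A \<and>
     (\<exists>S. finite S \<and> S \<subseteq> carrier A \<and> generate_ring A (range (scal A) \<union> S) = carrier A)"

definition alg_iso :: "('k, 'a) alg \<Rightarrow> ('k, 'b) alg \<Rightarrow> bool"  (infix \<open>\<cong>\<^sub>k\<close> 50) where
  "A \<cong>\<^sub>k B \<longleftrightarrow> (\<exists>h \<in> ring_iso A B. \<forall>c. h (scal A c) = scal B c)"

definition poly_alg :: "('k, 'a) alg \<Rightarrow> ('k, nat \<Rightarrow> 'a) alg"  (\<open>(_\<^sup>[\<^sup>1\<^sup>])\<close> [1000] 1000) where
  "A\<^sup>[\<^sup>1\<^sup>] =
     \<lparr>carrier = carrier (UP A), monoid.mult = monoid.mult (UP A), one = one (UP A),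
      ring.zero = ring.zero (UP A), add = add (UP A),
      scal = (\<lambda>c. up_ring.monom (UP A) (scal A c) 0)\<rparr>"

definition cancellation_counterexample ::
    "('k::field, 'a) alg \<Rightarrow> ('k, 'b) alg \<Rightarrow> bool" where
  "cancellation_counterexample A B \<longleftrightarrow>
     fg_algebra A \<and> fg_algebra B \<and> A\<^sup>[\<^sup>1\<^sup>] \<cong>\<^sub>k B\<^sup>[\<^sup>1\<^sup>] \<and> \<not> A \<cong>\<^sub>k B"

text \<open>
  Polynomial rings are iterated in the order \<open>k[X][Z][Y][T]\<close>, the variable added last being
  the outermost. Thus \<open>P(X,Z)\<close> has type \<open>'k poly poly\<close> with main variable \<open>Z\<close>, and
  \<open>Q(X,Y,Z)\<close> has type \<open>'k poly poly poly\<close> with main variable \<open>Y\<close>: degree, leading coefficient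
  and \<open>pderiv\<close> are taken with respect to these.
\<close>

definition ideal_of :: "'a::comm_ring_1 set \<Rightarrow> 'a set" where
  "ideal_of S = genideal (ring_of_type_algebra :: 'a ring) S"

definition X4 :: "'k::field poly poly poly poly" where "X4 = [:[:[:[:0, 1:]:]:]:]"
definition Y4 :: "'k::field poly poly poly poly" where "Y4 = [:[:0, 1:]:]"
definition T4 :: "'k::field poly poly poly poly" where "T4 = [:0, 1:]"

definition B_ideal :: "'k::field poly poly \<Rightarrow> 'k poly poly poly \<Rightarrow> nat \<Rightarrow> nat
    \<Rightarrow> 'k poly poly poly poly set" where
  "B_ideal P Q d e = ideal_of {X4 ^ d * Y4 - [:[:P:]:], X4 ^ e * T4 - [:Q:]}"

definition B_alg :: "'k::field poly poly \<Rightarrow> 'k poly poly poly \<Rightarrow> nat \<Rightarrow> nat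
    \<Rightarrow> ('k, 'k poly poly poly poly set) alg" where
  "B_alg P Q d e =
     (let R = (ring_of_type_algebra :: 'k poly poly poly poly ring);
          I = B_ideal P Q d e;
          B = R Quot I
      in \<lparr>carrier = carrier B, monoid.mult = monoid.mult B, one = one B,
          ring.zero = ring.zero B, add = add B,
          scal = (\<lambda>c. I +>\<^bsub>R\<^esub> [:[:[:[:c:]:]:]:])\<rparr>)"

definition P_at_0 :: "'k::field poly poly \<Rightarrow> 'k poly" where
  "P_at_0 P = map_poly (\<lambda>p. poly p 0) P"

definition Q_at_0 :: "'k::field poly poly poly \<Rightarrow> 'k poly poly" where
  "Q_at_0 Q = map_poly P_at_0 Q"

end

theory Submission
  imports Defs "HOL-Computational_Algebra.Formal_Laurent_Series"
begin

text \<open>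
  Write \<open>B\<^bsub>d,e\<^esub>\<close> as the subring of \<open>k((x))[z]\<close> generated by \<open>k\<close>, \<open>x\<close>, \<open>z\<close>, \<open>y = P/x\<^sup>d\<close> and
  \<open>t = Q/x\<^sup>e\<close>, and put \<open>n = d + e\<close>.

  Stable isomorphism (Danielewski's trick): modulo \<open>x\<close> the element \<open>P' Q'\<close> is a unit, so there is
  \<open>\<alpha>\<close> in \<open>B\<^bsub>d,e\<^esub>\<close> with \<open>t + \<alpha> P' Q'\<close> divisible by \<open>x\<close>, and \<open>a = z + x\<^sup>n \<alpha>\<close> solves the equations of
  \<open>B\<^bsub>d,e+1\<^esub>\<close>. Then \<open>z \<mapsto> z + x\<^sup>n w\<close> extends to an automorphism of \<open>k((x))[z, w]\<close> whose inverse maps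
  \<open>z\<close> to \<open>a + x\<^bsup>n+1\<^esup> w\<close>, and it maps \<open>B\<^bsub>d,e\<^esub>[w]\<close> onto \<open>B\<^bsub>d,e+1\<^esub>[w]\<close>.

  Non-isomorphism: the main step is that an iterative locally finite higher derivation \<open>D\<close> of
  \<open>B\<^bsub>d,e\<^esub>\<close> with a nonconstant invariant kills \<open>x\<close>. The ring is weighted lexicographically by the
  pole order in \<open>x\<close> and then the degree in \<open>z\<close>; its leading monomials are those of
  \<open>x, z, z\<^sup>r/x\<^sup>d, z\<^bsup>rs\<^esup>/x\<^bsup>ds+e\<^esup>\<close>. If \<open>x\<close> is not killed, the leading part of \<open>D\<close> kills \<open>t\<close> only, and
  comparing top coefficients shows that \<open>rs\<close> and \<open>ds + e\<close> are coprime and that some element has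
  degree one in the grading with \<open>x, z, y, t\<close> of degrees \<open>rs, ds + e, re, 0\<close>, which is absurd.
  Hence an isomorphism maps the standard higher derivation, whose first term is \<open>x\<^sup>n \<partial>/\<partial>z\<close>, to one
  over \<open>k[x]\<close>, while a derivation of \<open>B\<^bsub>d,e+1\<^esub>\<close> over \<open>k[x]\<close> maps \<open>z\<close> to a multiple of \<open>x\<^bsup>n+1\<^esup>\<close>.
\<close>

hide_const (open) up_ring.coeff up_ring.monom Polynomials.degree Polynomials.lead_coeff
  Divisibility.prime Divisibility.irreducible

section \<open>Iterative higher derivations on weighted rings\<close>

text \<open>Higher derivations take the place of locally nilpotent derivations because the
  characteristic is arbitrary: in characteristic p the operator \<open>D 1\<close> does not
  determine the others, and the descent to an element of small degree has to go through a power of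
  p. The weight refines the pole order by the degree in z because the leading coefficient of y at x
  = 0 is the polynomial P(0,Z) and not a monomial; its top term z^r gives a graded ring spanned by
  monomials, in which the degree of every element is a combination of the degrees of x, z, y, t. The
  numbers rs and ds + e are the two components of the weight of t, and rs wt(z) - (ds + e) wt(x) =
  wt(t) is the identity behind coprimality. No element has degree one since rs, ds + e and re are
  all at least 2. The final comparison needs both directions of a supposed isomorphism \<theta>: the
  inverse shows that \<theta>(x) is free of z, and both together that its order in x is at most 1.
  So \<theta>(x)^n has order at most n, yet it is the image of the standard derivative of z, which
  forces order at least n + 1.\<close>

locale unital_subring =
  fixes S :: "'a::comm_ring_1 set"
  assumes one_mem [simp]: "1 \<in> S"
    and add_mem [simp]: "a \<in> S \<Longrightarrow> b \<in> S \<Longrightarrow> a + b \<in> S"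
    and mult_mem [simp]: "a \<in> S \<Longrightarrow> b \<in> S \<Longrightarrow> a * b \<in> S"
    and uminus_mem [simp]: "a \<in> S \<Longrightarrow> - a \<in> S"
begin

lemma zero_mem [simp]: "0 \<in> S"
  using add_mem[OF one_mem uminus_mem[OF one_mem]] by simp

lemma diff_mem [simp]: "a \<in> S \<Longrightarrow> b \<in> S \<Longrightarrow> a - b \<in> S"
  using add_mem[of a "- b"] by simp

lemma power_mem [simp]: "a \<in> S \<Longrightarrow> a ^ n \<in> S"
  by (induction n) simp_all

lemma sum_mem: "(\<And>i. i \<in> I \<Longrightarrow> f i \<in> S) \<Longrightarrow> sum f I \<in> S"
  by (induction I rule: infinite_finite_induct) simp_all

lemma of_nat_mem [simp]: "of_nat n \<in> S"
  by (induction n) simp_all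

end

text \<open>The order of \<open>rat poly\<close> compares leading coefficients first, so \<open>[:j, N:]\<close> encodes the pair
  \<open>(N, j)\<close> in lexicographic order; coefficients are rational because slopes are.\<close>

locale weighted_ring = unital_subring C for C :: "'a::idom set" +
  fixes cs :: "'a set" and x z y t :: 'a and wt :: "'a \<Rightarrow> rat poly" and d e r s :: nat
  assumes cs_mem [simp]: "c \<in> cs \<Longrightarrow> c \<in> C"
    and gens_mem [simp]: "x \<in> C" "z \<in> C" "y \<in> C" "t \<in> C"
    and gens_nz [simp]: "x \<noteq> 0" "z \<noteq> 0" "y \<noteq> 0" "t \<noteq> 0"
    and wt_mult: "a \<noteq> 0 \<Longrightarrow> b \<noteq> 0 \<Longrightarrow> wt (a * b) = wt a + wt b"
    and wt_add: "a \<noteq> 0 \<Longrightarrow> b \<noteq> 0 \<Longrightarrow> a + b \<noteq> 0 \<Longrightarrow> wt (a + b) \<le> max (wt a) (wt b)"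
    and wt_const: "c \<in> cs \<Longrightarrow> c \<noteq> 0 \<Longrightarrow> wt c = 0"
    and of_nat_cs: "of_nat n \<in> cs"
    and wt_gens: "wt x = [:0, -1:]" "wt z = 1" "wt y = [:of_nat r, of_nat d:]"
       "wt t = [:of_nat (r * s), of_nat (d * s + e):]"
    and pos: "d > 0" "e > 0" "r \<ge> 2" "s \<ge> 2"
    and rel_y: "\<exists>u. x ^ d * y = z ^ r + u \<and> u \<in> C \<and> (u = 0 \<or> wt u < wt (z ^ r))"
    and rel_t: "\<exists>u. x ^ e * t = y ^ s + u \<and> u \<in> C \<and> (u = 0 \<or> wt u < wt (y ^ s))"
    and leading_monomial: "h \<in> C \<Longrightarrow> h \<noteq> 0 \<Longrightarrow>
       \<exists>c a b k m. c \<in> cs \<and> c \<noteq> 0 \<and> wt (x ^ a * z ^ b * y ^ k * t ^ m) = wt h \<and>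
         (h = c * (x ^ a * z ^ b * y ^ k * t ^ m) \<or> wt (h - c * (x ^ a * z ^ b * y ^ k * t ^ m)) < wt h)"
    and monomial_sum: "h \<in> C \<Longrightarrow> h \<noteq> 0 \<Longrightarrow>
       \<exists>I c \<mu>. finite (I :: nat set) \<and> h = (\<Sum>i\<in>I. c i * \<mu> i) \<and>
         (\<forall>i\<in>I. c i \<in> cs \<and> (\<exists>a b k m. \<mu> i = x ^ a * z ^ b * y ^ k * t ^ m) \<and> wt (\<mu> i) \<le> wt h)"
    and wt_nonpos: "h \<in> C \<Longrightarrow> h \<noteq> 0 \<Longrightarrow> wt h \<le> 0 \<Longrightarrow> \<exists>c h'. c \<in> cs \<and> h' \<in> C \<and> h = c + x * h'"
begin

lemma one_cs: "1 \<in> cs" and zero_cs: "0 \<in> cs"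
  using of_nat_cs[of 1] of_nat_cs[of 0] by simp_all

text \<open>The value of \<open>wt\<close> at 0 is unspecified; in both relations 0 counts as having
  weight minus infinity, which makes them stable under sums.\<close>

definition wle :: "'a \<Rightarrow> rat poly \<Rightarrow> bool" where "wle a v \<longleftrightarrow> a = 0 \<or> wt a \<le> v"
definition wlt :: "'a \<Rightarrow> rat poly \<Rightarrow> bool" where "wlt a v \<longleftrightarrow> a = 0 \<or> wt a < v"

lemma wle_0 [simp]: "wle 0 v" by (simp add: wle_def)
lemma wlt_0 [simp]: "wlt 0 v" by (simp add: wlt_def)
lemma wle_refl [simp]: "wle a (wt a)" by (simp add: wle_def)

lemma wle_add: "wle a v \<Longrightarrow> wle b v \<Longrightarrow> wle (a + b) v"
  using wt_add[of a b] by (cases "a = 0"; cases "b = 0"; cases "a + b = 0") (auto simp: wle_def max_def split: if_splits)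

lemma wlt_add: "wlt a v \<Longrightarrow> wlt b v \<Longrightarrow> wlt (a + b) v"
  using wt_add[of a b] by (cases "a = 0"; cases "b = 0"; cases "a + b = 0") (auto simp: wlt_def max_def split: if_splits)

lemma wle_sum: "(\<And>i. i \<in> I \<Longrightarrow> wle (f i) v) \<Longrightarrow> wle (sum f I) v"
  by (induction I rule: infinite_finite_induct) (auto intro: wle_add)

lemma wlt_sum: "(\<And>i. i \<in> I \<Longrightarrow> wlt (f i) v) \<Longrightarrow> wlt (sum f I) v"
  by (induction I rule: infinite_finite_induct) (auto intro: wlt_add)

lemma wle_mult: "wle a v \<Longrightarrow> wle b w \<Longrightarrow> wle (a * b) (v + w)"
  using wt_mult[of a b] by (cases "a = 0"; cases "b = 0") (auto simp: wle_def intro: add_mono)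

lemma wlt_mult_left: "wlt a v \<Longrightarrow> wle b w \<Longrightarrow> wlt (a * b) (v + w)"
  using wt_mult[of a b] by (cases "a = 0"; cases "b = 0") (auto simp: wlt_def wle_def intro: add_less_le_mono)

lemma wlt_mult_right: "wle a v \<Longrightarrow> wlt b w \<Longrightarrow> wlt (a * b) (v + w)"
  using wt_mult[of a b] by (cases "a = 0"; cases "b = 0") (auto simp: wlt_def wle_def intro: add_le_less_mono)

lemma wle_trans: "wle a v \<Longrightarrow> v \<le> w \<Longrightarrow> wle a w"
  by (auto simp: wle_def)

lemma wt_uminus: "wt (- a) = wt a"
proof (cases "a = 0")
  case False
  have "wt (1 :: 'a) = 0" using wt_const[OF one_cs] by simp
  moreover have "wt ((-1) * (-1) :: 'a) = wt (-1) + wt (-1)" by (rule wt_mult) auto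
  ultimately have "wt (-1) = 0" by simp
  then show ?thesis using wt_mult[of "-1" a] False by simp
qed simp

text \<open>The inequality is applied a second time, to a = (a + b) - b; this excludes a drop of the
  weight.\<close>

lemma wt_add_eq: "a \<noteq> 0 \<Longrightarrow> wlt b (wt a) \<Longrightarrow> a + b \<noteq> 0 \<and> wt (a + b) = wt a"
proof -
  assume a: "a \<noteq> 0" and b: "wlt b (wt a)"
  show ?thesis
  proof (cases "b = 0")
    case False
    with b have lt: "wt b < wt a" by (simp add: wlt_def)
    have nz: "a + b \<noteq> 0"
      using lt wt_uminus[of b] by (metis add_eq_0_iff2 less_irrefl)
    have "wt (a + b) \<le> wt a" using wt_add[OF a False nz] lt by (simp add: max_def)
    moreover have "wt a \<le> max (wt (a + b)) (wt b)"
      using wt_add[of "a + b" "- b"] a nz False wt_uminus[of b] by simp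
    ultimately show ?thesis using lt nz by (auto simp: max_def split: if_splits)
  qed (use a in simp)
qed

lemma of_nat_wle: "wle (of_nat n) 0"
  using wt_const[OF of_nat_cs[of n]] by (cases "of_nat n = (0 :: 'a)") (simp_all add: wle_def)

lemma wt_power: "a \<noteq> 0 \<Longrightarrow> wt (a ^ n) = of_nat n * wt a"
proof (induction n)
  case 0
  then show ?case using wt_const[OF one_cs] by simp
next
  case (Suc n)
  then show ?case using wt_mult[of a "a ^ n"] by (simp add: algebra_simps)
qed

end

text \<open>These are the coefficients of an action of the additive group, a \<mapsto> \<Sum>i. D i
  a U^i: \<open>D_mult\<close> makes this map multiplicative, \<open>D_comp\<close> makes the
  parameters U add up, and \<open>D_fin\<close> makes it polynomial in U.\<close>

locale higher_derivation = weighted_ring +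
  fixes D :: "nat \<Rightarrow> 'a \<Rightarrow> 'a"
  assumes D_mem [simp]: "a \<in> C \<Longrightarrow> D i a \<in> C"
    and D_add: "a \<in> C \<Longrightarrow> b \<in> C \<Longrightarrow> D i (a + b) = D i a + D i b"
    and D_0 [simp]: "a \<in> C \<Longrightarrow> D 0 a = a"
    and D_mult: "a \<in> C \<Longrightarrow> b \<in> C \<Longrightarrow> D i (a * b) = (\<Sum>j\<le>i. D j a * D (i - j) b)"
    and D_comp: "a \<in> C \<Longrightarrow> D i (D j a) = of_nat ((i + j) choose i) * D (i + j) a"
    and D_fin: "a \<in> C \<Longrightarrow> \<exists>m. \<forall>i>m. D i a = 0"
    and D_const: "c \<in> cs \<Longrightarrow> i > 0 \<Longrightarrow> D i c = 0"
begin

lemma D_zero [simp]: "D i 0 = 0"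
  using D_add[of 0 0 i] by (metis add_0_right add_left_cancel zero_mem)

lemma D_sum: "(\<And>i. i \<in> I \<Longrightarrow> f i \<in> C) \<Longrightarrow> D j (sum f I) = (\<Sum>i\<in>I. D j (f i))"
  by (induction I rule: infinite_finite_induct) (auto simp: D_add sum_mem)

lemma D_cmult: "c \<in> cs \<Longrightarrow> a \<in> C \<Longrightarrow> D i (c * a) = c * D i a"
proof -
  assume c: "c \<in> cs" and a: "a \<in> C"
  have "D i (c * a) = (\<Sum>j\<le>i. D j c * D (i - j) a)" using c a by (simp add: D_mult)
  also have "\<dots> = (\<Sum>j\<in>{0}. D j c * D (i - j) a)"
    by (rule sum.mono_neutral_right) (use c in \<open>auto simp: D_const\<close>)
  finally show ?thesis using c by simp
qed

text \<open>View \<Sum>i. D i a U^i as a polynomial in U. Over a domain the two top coefficients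
  multiply to a nonzero top coefficient of the product, so degrees in U add; degree 0 of the product
  forces degree 0 of each factor.\<close>

lemma factor_of_constant:
  assumes "a \<in> C" "b \<in> C" "a * b \<noteq> 0" "\<And>i. i > 0 \<Longrightarrow> D i (a * b) = 0" "i > 0"
  shows "D i a = 0"
proof (rule ccontr)
  assume i: "D i a \<noteq> 0"
  define A where "A = {i. D i a \<noteq> 0}"
  define B where "B = {i. D i b \<noteq> 0}"
  have fA: "finite A" and fB: "finite B"
    using D_fin[OF assms(1)] D_fin[OF assms(2)]
    by (auto simp: A_def B_def finite_nat_set_iff_bounded_le not_less intro: leI)
  have "i \<in> A" "0 \<in> A" "0 \<in> B" using i assms by (auto simp: A_def B_def)
  then have mA: "Max A \<in> A" "i \<le> Max A" and mB: "Max B \<in> B" using fA fB by (auto intro: Max_in)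
  define M where "M = Max A + Max B"
  have "D M (a * b) = (\<Sum>j\<le>M. D j a * D (M - j) b)" using assms by (simp add: D_mult)
  also have "\<dots> = (\<Sum>j\<in>{Max A}. D j a * D (M - j) b)"
  proof (rule sum.mono_neutral_right)
    show "\<forall>j\<in>{..M} - {Max A}. D j a * D (M - j) b = 0"
    proof
      fix j assume j: "j \<in> {..M} - {Max A}"
      show "D j a * D (M - j) b = 0"
      proof (cases "j > Max A")
        case True
        then have "j \<notin> A" using fA by (meson Max_ge leD)
        then show ?thesis by (simp add: A_def)
      next
        case False
        then have "M - j > Max B" using j by (auto simp: M_def)
        then have "M - j \<notin> B" using fB by (meson Max_ge leD)
        then show ?thesis by (simp add: B_def)
      qed
    qed
  qed (auto simp: M_def)
  also have "\<dots> \<noteq> 0" using mA mB by (simp add: M_def A_def B_def)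
  finally show False using assms(4)[of M] assms(5) mA(2) by (simp add: M_def)
qed

end


section \<open>Higher derivations of bounded slope and the degree of their leading parts\<close>

locale sloped_derivation = higher_derivation +
  fixes \<tau> :: "rat poly"
  assumes slope_gen: "h \<in> {x, z, y, t} \<Longrightarrow> wle (D i h) (wt h + of_nat i * \<tau>)"
begin

abbreviation mon :: "nat \<Rightarrow> nat \<Rightarrow> nat \<Rightarrow> nat \<Rightarrow> 'a" where
  "mon a b k m \<equiv> x ^ a * z ^ b * y ^ k * t ^ m"

definition bounded_slope :: "'a \<Rightarrow> bool" where
  "bounded_slope h \<longleftrightarrow> h \<in> C \<and> h \<noteq> 0 \<and> (\<forall>i. wle (D i h) (wt h + of_nat i * \<tau>))"

lemma bounded_slope_const: "c \<in> cs \<Longrightarrow> c \<noteq> 0 \<Longrightarrow> bounded_slope c"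
  unfolding bounded_slope_def
proof (intro conjI allI)
  fix i
  assume c: "c \<in> cs"
  show "wle (D i c) (wt c + of_nat i * \<tau>)"
    by (cases "i = 0") (use c in \<open>auto simp: D_const\<close>)
qed auto

lemma bounded_slope_mult:
  assumes "bounded_slope a" "bounded_slope b"
  shows "bounded_slope (a * b)"
  unfolding bounded_slope_def
proof (intro conjI allI)
  fix i
  have ab: "a \<in> C" "b \<in> C" "a \<noteq> 0" "b \<noteq> 0" using assms by (auto simp: bounded_slope_def)
  have "wle (\<Sum>j\<le>i. D j a * D (i - j) b) (wt (a * b) + of_nat i * \<tau>)"
  proof (rule wle_sum)
    fix j assume j: "j \<in> {..i}"
    have eq: "(wt a + of_nat j * \<tau>) + (wt b + of_nat (i - j) * \<tau>) = wt (a * b) + of_nat i * \<tau>"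
      using j ab wt_mult[of a b] by (simp add: algebra_simps of_nat_diff)
    show "wle (D j a * D (i - j) b) (wt (a * b) + of_nat i * \<tau>)"
      unfolding eq[symmetric] by (rule wle_mult) (use assms in \<open>auto simp: bounded_slope_def\<close>)
  qed
  then show "wle (D i (a * b)) (wt (a * b) + of_nat i * \<tau>)" using ab by (simp add: D_mult)
qed (use assms in \<open>auto simp: bounded_slope_def\<close>)

lemma bounded_slope_power: "bounded_slope a \<Longrightarrow> bounded_slope (a ^ n)"
  by (induction n) (auto intro: bounded_slope_mult bounded_slope_const one_cs)

lemma bounded_slope_mon: "bounded_slope (mon a b k m)"
  by (intro bounded_slope_mult bounded_slope_power) (auto simp: bounded_slope_def slope_gen)

text \<open>The Leibniz rule carries the bound from the generators to monomials, but not to sums,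
  whose weight may be smaller than that of their terms. \<open>monomial_sum\<close> supplies a
  presentation in which no term exceeds the weight of h.\<close>

lemma slope:
  assumes "h \<in> C" "wle h v"
  shows "wle (D i h) (v + of_nat i * \<tau>)"
proof (cases "h = 0")
  case False
  obtain I :: "nat set" and c \<mu> where I: "h = (\<Sum>i\<in>I. c i * \<mu> i)"
    "\<And>i. i \<in> I \<Longrightarrow> c i \<in> cs \<and> (\<exists>a b k m. \<mu> i = mon a b k m) \<and> wt (\<mu> i) \<le> wt h"
    using monomial_sum[OF assms(1) False] by blast
  have mem: "\<mu> j \<in> C" if "j \<in> I" for j
    using I(2)[OF that] by auto
  have "D i h = (\<Sum>j\<in>I. D i (c j * \<mu> j))"
    unfolding I(1) by (rule D_sum) (use I(2) mem in \<open>auto\<close>)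
  also have "wle \<dots> (v + of_nat i * \<tau>)"
  proof (rule wle_sum)
    fix j assume j: "j \<in> I"
    obtain a b k m where m: "\<mu> j = mon a b k m" using I(2)[OF j] by blast
    have "wle (D i (\<mu> j)) (wt (\<mu> j) + of_nat i * \<tau>)"
      using bounded_slope_mon[of a b k m] unfolding m bounded_slope_def by blast
    moreover have "wt (\<mu> j) \<le> v" using I(2)[OF j] assms False by (auto simp: wle_def)
    ultimately have "wle (D i (\<mu> j)) (v + of_nat i * \<tau>)"
      by (elim wle_trans) simp
    moreover have "wle (c j) 0" using I(2)[OF j] wt_const[of "c j"] by (cases "c j = 0") (auto simp: wle_def)
    ultimately have "wle (c j * D i (\<mu> j)) (0 + (v + of_nat i * \<tau>))"
      by (intro wle_mult)
    then show "wle (D i (c j * \<mu> j)) (v + of_nat i * \<tau>)"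
      using I(2)[OF j] mem[OF j] by (simp add: D_cmult)
  qed
  finally show ?thesis .
qed simp

lemma slope_wt: "h \<in> C \<Longrightarrow> wle (D i h) (wt h + of_nat i * \<tau>)"
  by (rule slope) auto

lemma slope_lt:
  assumes "h \<in> C" "wlt h v"
  shows "wlt (D i h) (v + of_nat i * \<tau>)"
  using slope_wt[OF assms(1), of i] assms(2)
  by (cases "h = 0"; cases "D i h = 0") (auto simp: wlt_def wle_def)

definition tied :: "'a \<Rightarrow> nat \<Rightarrow> bool" where
  "tied h i \<longleftrightarrow> D i h \<noteq> 0 \<and> wt (D i h) = wt h + of_nat i * \<tau>"

lemma not_tied: "h \<in> C \<Longrightarrow> \<not> tied h i \<Longrightarrow> wlt (D i h) (wt h + of_nat i * \<tau>)"
  using slope_wt[of h i] by (auto simp: tied_def wlt_def wle_def)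

text \<open>The degree in \<open>U\<close> of the leading form of \<open>\<Sum>i. D i h * U\<^sup>i\<close>, where \<open>U\<close> has weight \<open>- \<tau>\<close>.\<close>

definition tdeg :: "'a \<Rightarrow> nat" where "tdeg h = Max {i. tied h i}"

lemma finite_tied: "h \<in> C \<Longrightarrow> finite {i. tied h i}"
  using D_fin[of h]
  by (auto simp: tied_def finite_nat_set_iff_bounded_le not_less intro: leI)

lemma tied_0: "h \<in> C \<Longrightarrow> h \<noteq> 0 \<Longrightarrow> tied h 0"
  by (simp add: tied_def)

lemma tied_tdeg: "h \<in> C \<Longrightarrow> h \<noteq> 0 \<Longrightarrow> tied h (tdeg h)"
  using Max_in[of "{i. tied h i}"] finite_tied[of h] tied_0[of h] unfolding tdeg_def by blast

lemma tied_le_tdeg: "h \<in> C \<Longrightarrow> tied h i \<Longrightarrow> i \<le> tdeg h"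
  unfolding tdeg_def using finite_tied by (intro Max_ge) auto

lemma beyond_tdeg: "h \<in> C \<Longrightarrow> i > tdeg h \<Longrightarrow> wlt (D i h) (wt h + of_nat i * \<tau>)"
  using not_tied[of h i] tied_le_tdeg[of h i] by fastforce

lemma tdeg_eqI:
  assumes "h \<in> C" "tied h n" "\<And>i. i > n \<Longrightarrow> \<not> tied h i"
  shows "tdeg h = n"
  unfolding tdeg_def by (rule Max_eqI) (use assms finite_tied[of h] in \<open>auto intro: leI\<close>)

text \<open>Leading forms multiply: in index \<open>tdeg a + tdeg b\<close> exactly one summand of
  the Leibniz rule attains the full weight, and in every higher index none does.\<close>

lemma tdeg_mult:
  assumes "a \<in> C" "b \<in> C" "a \<noteq> 0" "b \<noteq> 0"
  shows "tdeg (a * b) = tdeg a + tdeg b"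
proof (rule tdeg_eqI)
  define M where "M = tdeg a + tdeg b"
  have eq: "(wt a + of_nat j * \<tau>) + (wt b + of_nat (i - j) * \<tau>) = wt (a * b) + of_nat i * \<tau>" if "j \<le> i" for i j
      using that assms wt_mult[of a b] by (simp add: algebra_simps of_nat_diff)
  have off: "wlt (D j a * D (i - j) b) (wt (a * b) + of_nat i * \<tau>)"
    if "j \<le> i" "j > tdeg a \<or> i - j > tdeg b" for i j
    using that(2)
  proof
    assume "j > tdeg a"
    from beyond_tdeg[OF assms(1) this] show ?thesis unfolding eq[OF that(1), symmetric]
      by (rule wlt_mult_left) (rule slope_wt[OF assms(2)])
  next
    assume "i - j > tdeg b"
    from beyond_tdeg[OF assms(2) this] show ?thesis unfolding eq[OF that(1), symmetric]
      by (rule wlt_mult_right[rotated]) (rule slope_wt[OF assms(1)])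
  qed
  show "\<not> tied (a * b) i" if "i > tdeg a + tdeg b" for i
  proof -
    have "wlt (\<Sum>j\<le>i. D j a * D (i - j) b) (wt (a * b) + of_nat i * \<tau>)"
      by (rule wlt_sum, rule off) (use that in auto)
    then show ?thesis using assms by (auto simp: tied_def D_mult wlt_def)
  qed
  have tt: "tied a (tdeg a)" "tied b (tdeg b)" using assms tied_tdeg by auto
  define top where "top = D (tdeg a) a * D (tdeg b) b"
  have top: "top \<noteq> 0" "wt top = wt (a * b) + of_nat M * \<tau>"
    using tt wt_mult[of "D (tdeg a) a" "D (tdeg b) b"] eq[of "tdeg a" M]
    by (auto simp: top_def tied_def M_def)
  have "D M (a * b) = (\<Sum>j\<le>M. D j a * D (M - j) b)" using assms by (simp add: D_mult)
  also have "\<dots> = top + (\<Sum>j\<in>{..M} - {tdeg a}. D j a * D (M - j) b)"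
    by (subst sum.remove[of _ "tdeg a"]) (auto simp: M_def top_def)
  finally have DM: "D M (a * b) = top + (\<Sum>j\<in>{..M} - {tdeg a}. D j a * D (M - j) b)" .
  have "wlt (\<Sum>j\<in>{..M} - {tdeg a}. D j a * D (M - j) b) (wt top)"
    unfolding top by (rule wlt_sum, rule off) (auto simp: M_def)
  from wt_add_eq[OF top(1) this] show "tied (a * b) (tdeg a + tdeg b)"
    unfolding tied_def M_def[symmetric] DM top(2) by simp
qed (use assms in auto)

lemma tdeg_leading:
  assumes "a \<in> C" "b \<in> C" "a \<noteq> 0" "wlt b (wt a)"
  shows "tdeg (a + b) = tdeg a" "a + b \<noteq> 0" "wt (a + b) = wt a"
proof -
  show ab: "a + b \<noteq> 0" and w: "wt (a + b) = wt a"
    using wt_add_eq[OF assms(3,4)] by auto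
  show "tdeg (a + b) = tdeg a"
  proof (rule tdeg_eqI)
    have lt: "wlt (D i b) (wt a + of_nat i * \<tau>)" for i
      using slope_lt[OF assms(2,4)] .
    show "tied (a + b) (tdeg a)"
      using tied_tdeg[OF assms(1,3)] lt[of "tdeg a"] wt_add_eq[of "D (tdeg a) a" "D (tdeg a) b"]
      by (auto simp: tied_def D_add assms w)
    show "\<not> tied (a + b) i" if "i > tdeg a" for i
    proof -
      from beyond_tdeg[OF assms(1) that] have "wlt (D i (a + b)) (wt a + of_nat i * \<tau>)" using lt by (simp add: D_add assms wlt_add)
      then show ?thesis by (auto simp: tied_def w wlt_def)
    qed
  qed (use assms in auto)
qed

lemma tdeg_const: "c \<in> cs \<Longrightarrow> c \<noteq> 0 \<Longrightarrow> tdeg c = 0"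
  by (rule tdeg_eqI) (auto simp: tied_def D_const)

lemma tdeg_power: "a \<in> C \<Longrightarrow> a \<noteq> 0 \<Longrightarrow> tdeg (a ^ n) = n * tdeg a"
  by (induction n) (auto simp: tdeg_mult tdeg_const one_cs)

lemma tdeg_mon: "tdeg (mon a b k m) = a * tdeg x + b * tdeg z + k * tdeg y + m * tdeg t"
  by (simp add: tdeg_mult tdeg_power)

lemma wt_mon: "wt (mon a b k m) = of_nat a * wt x + of_nat b * wt z + of_nat k * wt y + of_nat m * wt t"
  by (simp add: wt_mult wt_power)

text \<open>An element differs from its leading monomial by something of smaller weight, which
  leaves the leading form unchanged. Hence all degrees lie in the numerical semigroup generated by
  the degrees of x, z, y and t.\<close>

lemma leading_tdeg:
  assumes "h \<in> C" "h \<noteq> 0"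
  obtains a b k m where "wt h = wt (mon a b k m)"
    "tdeg h = a * tdeg x + b * tdeg z + k * tdeg y + m * tdeg t"
proof -
  obtain c a b k m where c: "c \<in> cs" "c \<noteq> 0" and w: "wt (mon a b k m) = wt h"
    and l: "h = c * mon a b k m \<or> wt (h - c * mon a b k m) < wt h"
    using leading_monomial[OF assms] by blast
  define g where "g = c * mon a b k m"
  have g: "g \<in> C" "g \<noteq> 0" "wt g = wt h" "tdeg g = tdeg (mon a b k m)"
    using c w by (auto simp: g_def wt_mult[of c] wt_const tdeg_mult[of c] tdeg_const)
  have "tdeg (g + (h - g)) = tdeg g"
    using l g assms by (intro tdeg_leading) (auto simp: wlt_def g_def)
  then show ?thesis using that[OF w[symmetric]] g(4) by (simp add: tdeg_mon)
qed

text \<open>The leading parts of the defining equations are the monomial relations x^d y = z^r and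
  x^e t = y^s.\<close>

lemma tdeg_relations:
  "d * tdeg x + tdeg y = r * tdeg z" "e * tdeg x + tdeg t = s * tdeg y"
proof -
  obtain u where u: "x ^ d * y = z ^ r + u" "u \<in> C" "u = 0 \<or> wt u < wt (z ^ r)" using rel_y by blast
  have "tdeg (z ^ r + u) = tdeg (z ^ r)" by (rule tdeg_leading) (use u in \<open>auto simp: wlt_def\<close>)
  then show "d * tdeg x + tdeg y = r * tdeg z" by (simp add: u(1)[symmetric] tdeg_mult tdeg_power)
  obtain v where v: "x ^ e * t = y ^ s + v" "v \<in> C" "v = 0 \<or> wt v < wt (y ^ s)" using rel_t by blast
  have "tdeg (y ^ s + v) = tdeg (y ^ s)" by (rule tdeg_leading) (use v in \<open>auto simp: wlt_def\<close>)
  then show "e * tdeg x + tdeg t = s * tdeg y" by (simp add: v(1)[symmetric] tdeg_mult tdeg_power)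
qed

text \<open>By iterativity, \<open>D i\<close> of the top coefficient is an integer multiple of
  \<open>D (i + tdeg h) h\<close>, and beyond index \<open>tdeg h\<close> the weight bound is no
  longer attained.\<close>

lemma tdeg_top: "h \<in> C \<Longrightarrow> h \<noteq> 0 \<Longrightarrow> tdeg (D (tdeg h) h) = 0"
proof (rule tdeg_eqI)
  assume h: "h \<in> C" "h \<noteq> 0"
  have t: "tied h (tdeg h)" using h by (rule tied_tdeg)
  show "tied (D (tdeg h) h) 0" using t h by (simp add: tied_def)
  fix i :: nat assume i: "i > 0"
  show "\<not> tied (D (tdeg h) h) i"
  proof
    assume ti: "tied (D (tdeg h) h) i"
    let ?n = "i + tdeg h"
    have "\<not> tied h ?n" using tied_le_tdeg[OF h(1), of ?n] i by auto
    then have "wlt (D ?n h) (wt h + of_nat ?n * \<tau>)" using h not_tied by blast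
    moreover have "wle (of_nat (?n choose i)) 0"
      by (rule of_nat_wle)
    ultimately have "wlt (of_nat (?n choose i) * D ?n h) (0 + (wt h + of_nat ?n * \<tau>))"
      by (intro wlt_mult_right)
    then have "wlt (D i (D (tdeg h) h)) (wt h + of_nat ?n * \<tau>)" using D_comp[OF h(1)] by simp
    moreover have "wt (D i (D (tdeg h) h)) = wt h + of_nat ?n * \<tau>"
      using ti t by (simp add: tied_def algebra_simps)
    ultimately show False using ti by (simp add: wlt_def tied_def)
  qed
qed auto

end

text \<open>A case of Lucas' theorem: in characteristic p with q = p^k one has (X + 1)^(q u) = (X^q
  + 1)^u, whose coefficient at X^q is u. So the binomial coefficient is congruent to u, which p does
  not divide.\<close>

lemma of_nat_binomial_nonzero:
  assumes "u > 0" "q > 0"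
    and "CHAR('a::idom) = 0 \<or> (\<exists>k. q = CHAR('a) ^ k) \<and> \<not> CHAR('a) dvd u"
  shows "(of_nat ((q * u) choose q) :: 'a) \<noteq> 0"
proof (cases "CHAR('a) = 0")
  case True
  have "(q * u) choose q \<noteq> 0" using assms by (simp add: binomial_eq_0_iff)
  then show ?thesis using True by (simp add: of_nat_eq_0_iff_char_dvd)
next
  case False
  then obtain k where k: "q = CHAR('a) ^ k" and ndvd: "\<not> CHAR('a) dvd u" using assms(3) by auto
  have p: "prime (CHAR('a))" using False prime_CHAR_semidom by blast
  have ch: "CHAR('a poly) = CHAR('a)" by simp
  let ?X = "[:0, 1:] :: 'a poly"
  have "(?X + 1) ^ (q * u) = (?X ^ q + 1) ^ u"
    unfolding power_mult k using freshmans_dream'[where ?'a = "'a poly" and x = ?X and y = 1 and n = k] p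
    by simp
  also have "\<dots> = (\<Sum>j\<le>u. of_nat (u choose j) * (?X ^ q) ^ j * 1 ^ (u - j))"
    by (rule binomial_ring)
  also have "\<dots> = (\<Sum>j\<le>u. monom (of_nat (u choose j)) (q * j))"
    by (intro sum.cong refl) (simp add: monom_altdef power_mult of_nat_poly)
  finally have 1: "coeff ((?X + 1) ^ (q * u)) q = (\<Sum>j\<le>u. if q * j = q then of_nat (u choose j) else 0)"
    by (simp add: coeff_sum coeff_monom)
  have "(\<Sum>j\<le>u. if q * j = q then of_nat (u choose j) else 0) = (\<Sum>j\<in>{1}. of_nat (u choose j) :: 'a)"
    by (rule sum.mono_neutral_cong_right) (use assms in auto)
  with 1 have 1: "coeff ((?X + 1) ^ (q * u)) q = of_nat u" by simp
  have "(?X + 1) ^ (q * u) = (\<Sum>j\<le>q * u. of_nat ((q * u) choose j) * ?X ^ j * 1 ^ (q * u - j))"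
    by (rule binomial_ring)
  also have "\<dots> = (\<Sum>j\<le>q * u. monom (of_nat ((q * u) choose j)) j)"
    by (intro sum.cong refl) (simp add: monom_altdef power_mult of_nat_poly)
  finally have "coeff ((?X + 1) ^ (q * u)) q = of_nat ((q * u) choose q)"
    using assms by (simp add: coeff_sum coeff_monom)
  with 1 ndvd show ?thesis by (simp add: of_nat_eq_0_iff_char_dvd)
qed

context sloped_derivation
begin

text \<open>The leading monomial of an invariant of positive weight involves z, y or t, and each
  generator occurring in it has degree 0. By the relations, degree 0 of z or of y would give degree
  0 for all four, against the choice of g; so t is the one of degree 0, and the relations make the
  other three positive.\<close>

lemma tdeg_gens:
  assumes "f \<in> C" "f \<noteq> 0" "wt f > 0" "\<And>i. i > 0 \<Longrightarrow> D i f = 0"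
    and g: "g \<in> {x, z, y, t}" "tied g i" "i > 0"
  shows "tdeg t = 0" "tdeg x > 0" "tdeg y > 0" "tdeg z > 0"
proof -
  have "tdeg f = 0" by (rule tdeg_eqI) (use assms in \<open>auto simp: tied_def\<close>)
  obtain a b k m where w: "wt f = wt (mon a b k m)"
    and td: "tdeg f = a * tdeg x + b * tdeg z + k * tdeg y + m * tdeg t"
    using leading_tdeg[OF assms(1,2)] .
  have "b > 0 \<or> k > 0 \<or> m > 0"
  proof (rule ccontr)
    assume "\<not> ?thesis"
    then have "wt f = of_nat a * [:0, -1:]" using w unfolding wt_mon by (simp add: wt_gens)
    then have "wt f = - (of_nat a * [:0, 1:])" by (simp add: of_nat_poly)
    moreover have "of_nat a * [:0, 1:] \<ge> (0 :: rat poly)"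
      by (intro mult_nonneg_nonneg of_nat_0_le_iff) (simp add: less_eq_poly_def pos_poly_def)
    ultimately show False using assms(3) by linarith
  qed
  moreover have "tdeg g > 0" using g tied_le_tdeg[of g i] by fastforce
  moreover note tdeg_relations td \<open>tdeg f = 0\<close> pos g(1)
  ultimately have t0: "tdeg t = 0" and "tdeg g > 0" by auto
  then have eqs: "d * tdeg x + tdeg y = r * tdeg z" "e * tdeg x = s * tdeg y"
    using tdeg_relations by auto
  have x0: "tdeg x \<noteq> 0"
  proof
    assume "tdeg x = 0"
    then have "tdeg y = 0" "tdeg z = 0" using eqs pos by auto
    then show False using \<open>tdeg g > 0\<close> \<open>tdeg x = 0\<close> t0 g(1) by auto
  qed
  have y0: "tdeg y \<noteq> 0" using eqs(2) x0 pos by (metis mult_eq_0_iff mult_0_right less_irrefl)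
  have z0: "tdeg z \<noteq> 0" using eqs(1) y0 by (metis mult_0_right add_is_0)
  show "tdeg t = 0" "tdeg x > 0" "tdeg y > 0" "tdeg z > 0" using t0 x0 y0 z0 by auto
qed


text \<open>The top coefficient of h has degree 0, and t is the only generator of degree 0; so its
  leading monomial is a power of t.\<close>

lemma tdeg_top_wt:
  assumes "tdeg t = 0" "tdeg x > 0" "tdeg y > 0" "tdeg z > 0" "h \<in> C" "h \<noteq> 0"
  obtains \<alpha> where "wt h + of_nat (tdeg h) * \<tau> = of_nat \<alpha> * wt t"
proof -
  let ?g = "D (tdeg h) h"
  have g: "?g \<in> C" "?g \<noteq> 0" "wt ?g = wt h + of_nat (tdeg h) * \<tau>"
    using tied_tdeg[OF assms(5,6)] assms by (auto simp: tied_def)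
  obtain a b k m where "wt ?g = wt (mon a b k m)"
    "tdeg ?g = a * tdeg x + b * tdeg z + k * tdeg y + m * tdeg t"
    using leading_tdeg[OF g(1,2)] .
  moreover have "tdeg ?g = 0" using tdeg_top assms by blast
  ultimately show ?thesis using that[of m] g(3) assms(1-4) unfolding wt_mon by auto
qed

text \<open>Eliminating \<tau> from the weights of the top coefficients of x and z gives R \<gamma>
  - L \<alpha> = 1. Consequently x, z, y have degrees \<rho> R, \<rho> L, \<rho> r e for some \<rho>
  > 0, and every degree is a sum of these. An element whose degree q is a positive divisor of \<rho>
  contradicts this, since R, L and r e exceed 1.\<close>

lemma slope_contradiction:
  assumes td: "tdeg t = 0" "tdeg x > 0" "tdeg y > 0" "tdeg z > 0"
  shows False
proof -
  define R where "R = r * s"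
  define L where "L = d * s + e"
  have RL: "R \<ge> 2" "L \<ge> 2" "r * e \<ge> 2"
  proof -
    have "2 * 1 \<le> r * s" "2 * 1 \<le> r * e" "1 * 1 \<le> d * s"
      by (intro mult_le_mono; use pos in linarith)+
    then show "R \<ge> 2" "L \<ge> 2" "r * e \<ge> 2" using pos unfolding R_def L_def by linarith+
  qed
  have Y: "e * tdeg x = s * tdeg y" and Z: "d * tdeg x + tdeg y = r * tdeg z"
    using tdeg_relations td by auto
  have "s * (d * tdeg x + tdeg y) = s * (r * tdeg z)" unfolding Z ..
  then have XZ: "L * tdeg x = R * tdeg z" using Y by (simp add: R_def L_def algebra_simps)
  obtain \<alpha> where \<alpha>: "wt x + of_nat (tdeg x) * \<tau> = of_nat \<alpha> * wt t"
    using tdeg_top_wt[OF td, of x] by auto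
  obtain \<gamma> where \<gamma>: "wt z + of_nat (tdeg z) * \<tau> = of_nat \<gamma> * wt t"
    using tdeg_top_wt[OF td, of z] by auto
  have "of_nat R * (wt z + of_nat (tdeg z) * \<tau>) - of_nat L * (wt x + of_nat (tdeg x) * \<tau>)
      = of_nat R * wt z - of_nat L * wt x + (of_nat (R * tdeg z) - of_nat (L * tdeg x)) * \<tau>"
    by (simp add: algebra_simps)
  then have "of_nat R * wt z - of_nat L * wt x = (of_nat (R * \<gamma>) - of_nat (L * \<alpha>)) * wt t"
    unfolding \<alpha> \<gamma> XZ by (simp add: algebra_simps)
  \<comment> \<open>The constant coefficient is the z-degree component; in it x has weight 0, z has
    weight 1 and t has weight R, so R can be cancelled.\<close>
  then have "coeff (of_nat R * wt z - of_nat L * wt x) 0 = coeff ((of_nat (R * \<gamma>) - of_nat (L * \<alpha>)) * wt t) 0"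
    by simp
  then have "rat_of_nat R = (rat_of_nat (R * \<gamma>) - rat_of_nat (L * \<alpha>)) * rat_of_nat R"
    by (simp add: wt_gens R_def coeff_mult_0 of_nat_poly)
  then have "1 = rat_of_nat (R * \<gamma>) - rat_of_nat (L * \<alpha>)" using RL(1) by simp
  then have "rat_of_nat (R * \<gamma>) = rat_of_nat (L * \<alpha> + 1)" by simp
  then have bez: "R * \<gamma> = L * \<alpha> + 1" by (simp only: of_nat_eq_iff)
  have dvd1: "p = 1" if "p dvd R" "p dvd L" for p
  proof -
    have "p dvd L * \<alpha> + 1" unfolding bez[symmetric] using that(1) by simp
    then show "p = 1" using that(2) by (metis dvd_add_right_iff dvd_mult2 nat_dvd_1_iff_1)
  qed
  have cop: "coprime R L" by (rule coprimeI) (use dvd1 in auto)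
  have "R dvd L * tdeg x" using XZ by simp
  then have "R dvd tdeg x" using cop by (simp add: coprime_dvd_mult_right_iff)
  then obtain \<rho> where \<rho>: "tdeg x = R * \<rho>" by blast
  have \<rho>0: "\<rho> > 0" using td(2) \<rho> by (cases \<rho>) auto
  have Z\<rho>: "tdeg z = L * \<rho>" using XZ \<rho> RL by simp
  have "s * tdeg y = s * (r * e * \<rho>)"
    unfolding Y[symmetric] \<rho> R_def by (simp only: ac_simps)
  then have Y\<rho>: "tdeg y = r * e * \<rho>" using pos by simp
  \<comment> \<open>As R and L are coprime, the characteristic, if positive, fails to divide one of
    them; h is the generator with that multiplier.\<close>
  obtain h l where h: "h \<in> {x, z}" "tdeg h = l * \<rho>" "CHAR('a) = 0 \<or> \<not> CHAR('a) dvd l" "l > 0"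
  proof (cases "CHAR('a) = 0 \<or> \<not> CHAR('a) dvd R")
    case True
    then show ?thesis using that[of x R] \<rho> RL by auto
  next
    case False
    then have "\<not> CHAR('a) dvd L" using dvd1[of "CHAR('a)"] by auto
    then show ?thesis using that[of z L] Z\<rho> RL by auto
  qed
  \<comment> \<open>In positive characteristic q is the full power of the characteristic in \<rho>;
    in characteristic 0 it is 1.\<close>
  obtain q u where qu: "\<rho> = q * u" "q > 0" "u > 0"
    "CHAR('a) = 0 \<or> (\<exists>k. q = CHAR('a) ^ k) \<and> \<not> CHAR('a) dvd u"
  proof (cases "CHAR('a) = 0")
    case True
    then show ?thesis using that[of 1 \<rho>] \<rho>0 by auto
  next
    case False
    then have p: "prime (CHAR('a))" using prime_CHAR_semidom by blast
    obtain u where u: "\<rho> = CHAR('a) ^ multiplicity (CHAR('a)) \<rho> * u" "\<not> CHAR('a) dvd u"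
      using multiplicity_decompose'[of \<rho> "CHAR('a)"] \<rho>0 p by (metis not_prime_unit not_less_zero)
    show ?thesis
      by (rule that[OF u(1)]) (use u \<rho>0 p in \<open>auto intro: gr0I prime_gt_0_nat\<close>)
  qed
  have hC: "h \<in> C" "h \<noteq> 0" using h by auto
  define n where "n = q * (u * l)"
  have tdh: "tdeg h = n" using h qu by (simp add: n_def algebra_simps)
  have qn: "q \<le> n" using qu h(4) by (simp add: n_def)
  have "(of_nat (n choose q) :: 'a) \<noteq> 0"
    unfolding n_def
  proof (rule of_nat_binomial_nonzero)
    show "CHAR('a) = 0 \<or> (\<exists>k. q = CHAR('a) ^ k) \<and> \<not> CHAR('a) dvd u * l"
      using qu(4) h(3) prime_dvd_mult_nat[of "CHAR('a)" u l] prime_CHAR_semidom[where ?'a = 'a] by auto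
  qed (use qu h in auto)
  then have bn: "(of_nat (n choose q) :: 'a) \<noteq> 0" "wt (of_nat (n choose q) :: 'a) = 0"
    using wt_const[OF of_nat_cs] by auto
  \<comment> \<open>Applying \<open>D (n - q)\<close> lowers the degree n of h to q:
    \<open>D q g\<close> is \<open>n choose q\<close> times the top coefficient of h, and this
    binomial coefficient does not vanish because q is a power of the characteristic and the cofactor
    u l is prime to it (in characteristic 0 nothing vanishes).\<close>
  define g where "g = D (n - q) h"
  have gC: "g \<in> C" using hC by (simp add: g_def)
  have Dg: "D i g = of_nat ((i + (n - q)) choose i) * D (i + (n - q)) h" for i
    unfolding g_def using D_comp hC by simp
  have th: "D n h \<noteq> 0" "wt (D n h) = wt h + of_nat n * \<tau>"
    using tied_tdeg[OF hC] by (auto simp: tied_def tdh)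
  have Dqg: "D q g = of_nat (n choose q) * D n h" using Dg[of q] qn by simp
  have Dq: "D q g \<noteq> 0" "wt (D q g) = wt h + of_nat n * \<tau>"
    unfolding Dqg using bn th by (auto simp: wt_mult)
  have nq: "of_nat n * \<tau> = of_nat (n - q) * \<tau> + of_nat q * \<tau>"
    using qn by (simp add: algebra_simps of_nat_diff)
  have g0: "g \<noteq> 0" using Dq(1) by auto
  have "wt g \<le> wt h + of_nat (n - q) * \<tau>" using slope_wt[OF hC(1), of "n - q"] g0
    by (simp add: wle_def g_def)
  moreover have "wt (D q g) \<le> wt g + of_nat q * \<tau>" using slope_wt[OF gC, of q] Dq(1)
    by (simp add: wle_def)
  ultimately have wg: "wt g = wt h + of_nat (n - q) * \<tau>" using Dq(2) nq by simp
  have "tdeg g = q"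
  proof (rule tdeg_eqI[OF gC])
    show "tied g q" using Dq unfolding tied_def wg nq by (simp add: add.assoc)
    fix i assume i: "i > q"
    have "wlt (D (i + (n - q)) h) (wt h + of_nat (i + (n - q)) * \<tau>)"
      by (rule beyond_tdeg) (use hC tdh i qn in auto)
    from wlt_mult_right[OF of_nat_wle this]
    have "wlt (D i g) (0 + (wt h + of_nat (i + (n - q)) * \<tau>))" unfolding Dg .
    then have "wlt (D i g) (wt g + of_nat i * \<tau>)" by (simp add: wg algebra_simps)
    then show "\<not> tied g i" by (auto simp: tied_def wlt_def)
  qed
  moreover obtain a b k m where "tdeg g = a * tdeg x + b * tdeg z + k * tdeg y + m * tdeg t"
    using leading_tdeg[OF gC g0] .
  \<comment> \<open>All degrees are multiples of \<rho> = q u, so degree q leaves u (a R + b L + k r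
    e) = 1.\<close>
  ultimately have "q = \<rho> * (a * R + b * L + k * (r * e))"
    by (simp add: td(1) \<rho> Z\<rho> Y\<rho> algebra_simps)
  then have "q * 1 = q * (u * (a * R + b * L + k * (r * e)))" using qu(1) by simp
  then have "u * (a * R + b * L + k * (r * e)) = 1" using qu(2) by (metis mult_cancel1 less_irrefl)
  then have one: "a * R + b * L + k * (r * e) = 1" by simp
  have "a = 0" using one RL(1) by (cases a) auto
  moreover have "b = 0" using one RL(2) by (cases b) auto
  moreover have "k = 0" using one RL(3) by (cases k) auto
  ultimately show False using one by simp
qed

end

text \<open>An invariant of nonpositive weight has the form c + x h; then x divides the invariant x
  h and is itself invariant. Otherwise take for \<tau> the largest slope (wt (D i g) - wt g) / i
  over the generators g: as a maximum it is attained, which is the nontriviality that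
  \<open>tdeg_gens\<close> asks for.\<close>

theorem (in higher_derivation) constants_force_x:
  assumes "f \<in> C" "f \<notin> cs" "\<And>i. i > 0 \<Longrightarrow> D i f = 0" "n > 0"
  shows "D n x = 0"
proof (rule ccontr)
  assume nx: "D n x \<noteq> 0"
  have f0: "f \<noteq> 0" using assms(2) zero_cs by blast
  have wf: "wt f > 0"
  proof (rule ccontr)
    assume "\<not> wt f > 0"
    then obtain c h where ch: "c \<in> cs" "h \<in> C" "f = c + x * h"
      using wt_nonpos[OF assms(1) f0] by auto
    have "D i (x * h) = 0" if "i > 0" for i
      using D_add[of c "x * h" i] ch assms(3)[OF that] D_const[OF ch(1) that] by simp
    moreover have "x * h \<noteq> 0" using ch assms(2) by auto
    ultimately show False using factor_of_constant[of x h n] ch nx assms(4) by auto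
  qed
  define T where "T = {(g, i). g \<in> {x, z, y, t} \<and> i > 0 \<and> D i g \<noteq> 0}"
  define sl where "sl = (\<lambda>(g, i). smult (1 / of_nat i) (wt (D i g) - wt g))"
  have "finite {i. D i g \<noteq> 0}" if "g \<in> C" for g
    using D_fin[OF that] by (auto simp: finite_nat_set_iff_bounded_le not_less intro: leI)
  then have "finite (SIGMA g : {x, z, y, t}. {i. D i g \<noteq> 0})" by (intro finite_SigmaI) auto
  then have fT: "finite T" by (rule finite_subset[rotated]) (auto simp: T_def)
  have neT: "(x, n) \<in> T" using nx assms(4) by (auto simp: T_def)
  define \<tau> where "\<tau> = Max (sl ` T)"
  have mult_sl: "of_nat i * sl (g, i) = wt (D i g) - wt g" if "i > 0" for g i
    using that by (simp add: sl_def of_nat_poly)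
  interpret sloped_derivation C cs x z y t wt d e r s D \<tau>
  proof
    fix h i assume h: "h \<in> {x, z, y, t}"
    show "wle (D i h) (wt h + of_nat i * \<tau>)"
    proof (cases "i = 0 \<or> D i h = 0")
      case True
      then show ?thesis using h by auto
    next
      case False
      then have "(h, i) \<in> T" using h by (auto simp: T_def)
      then have "sl (h, i) \<le> \<tau>" unfolding \<tau>_def using fT by (intro Max_ge) auto
      then have "of_nat i * sl (h, i) \<le> of_nat i * \<tau>" by (intro mult_left_mono) auto
      then have "wt (D i h) \<le> wt h + of_nat i * \<tau>" using mult_sl[of i h] False by simp
      then show ?thesis by (simp add: wle_def)
    qed
  qed
  have "\<tau> \<in> sl ` T" unfolding \<tau>_def using fT neT by (intro Max_in) auto
  then obtain g i where g: "(g, i) \<in> T" "\<tau> = sl (g, i)" by auto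
  then have gi: "g \<in> {x, z, y, t}" "i > 0" "D i g \<noteq> 0" by (auto simp: T_def)
  have "of_nat i * \<tau> = wt (D i g) - wt g" using mult_sl[OF gi(2)] unfolding g(2) .
  then have "tied g i" using gi(3) by (simp add: tied_def)
  from slope_contradiction[OF tdeg_gens[OF assms(1) f0 wf assms(3) gi(1) this gi(2)]]
  show False .
qed

section \<open>Ideals of polynomial rings and evaluation\<close>

definition ring_morphism :: "('a::comm_ring_1 \<Rightarrow> 'b::comm_ring_1) \<Rightarrow> bool" where
  "ring_morphism f \<longleftrightarrow> f 1 = 1 \<and> (\<forall>a b. f (a + b) = f a + f b) \<and> (\<forall>a b. f (a * b) = f a * f b)"

lemma ring_morphismI:
  "f 1 = 1 \<Longrightarrow> (\<And>a b. f (a + b) = f a + f b) \<Longrightarrow> (\<And>a b. f (a * b) = f a * f b) \<Longrightarrow> ring_morphism f"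
  by (simp add: ring_morphism_def)

context
  fixes f :: "'a::comm_ring_1 \<Rightarrow> 'b::comm_ring_1"
  assumes f: "ring_morphism f"
begin

lemma ring_morphism_1: "f 1 = 1"
  and ring_morphism_add: "f (a + b) = f a + f b"
  and ring_morphism_mult: "f (a * b) = f a * f b"
  using f by (simp_all add: ring_morphism_def)

lemma ring_morphism_0: "f 0 = 0"
  using ring_morphism_add[of 0 0] by simp

lemma ring_morphism_uminus: "f (- a) = - f a"
  using ring_morphism_add[of a "- a"] ring_morphism_0 by (simp add: add_eq_0_iff)

lemma ring_morphism_diff: "f (a - b) = f a - f b"
  using ring_morphism_add[of a "- b"] ring_morphism_uminus by simp

lemma ring_morphism_power: "f (a ^ n) = f a ^ n"
  by (induction n) (simp_all add: ring_morphism_1 ring_morphism_mult)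

lemma ring_morphism_sum: "f (sum g I) = (\<Sum>i\<in>I. f (g i))"
  by (induction I rule: infinite_finite_induct) (simp_all add: ring_morphism_0 ring_morphism_add)

lemmas ring_morphism_simps = ring_morphism_0 ring_morphism_1 ring_morphism_add ring_morphism_mult
  ring_morphism_uminus ring_morphism_diff ring_morphism_power

lemma ring_morphism_map_poly: "ring_morphism (map_poly f)"
  by (intro ring_morphismI poly_eqI)
    (simp_all add: coeff_map_poly ring_morphism_simps ring_morphism_sum coeff_mult coeff_1)

lemma unital_subring_range: "unital_subring (range f)"
  by standard (auto simp flip: ring_morphism_simps)

end

lemma ring_morphism_comp: "ring_morphism f \<Longrightarrow> ring_morphism g \<Longrightarrow> ring_morphism (\<lambda>a. g (f a))"
  by (simp add: ring_morphism_def)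

lemma ring_morphism_poly: "ring_morphism (\<lambda>p. poly p a)"
  by (intro ring_morphismI) simp_all

lemma ring_morphism_const: "ring_morphism (\<lambda>c. [:c:])"
  by (intro ring_morphismI) (simp_all add: one_pCons)

definition peval :: "('a::comm_ring_1 \<Rightarrow> 'b::comm_ring_1) \<Rightarrow> 'a poly \<Rightarrow> 'b \<Rightarrow> 'b" where
  "peval f p a = poly (map_poly f p) a"

lemma ring_morphism_peval: "ring_morphism f \<Longrightarrow> ring_morphism (\<lambda>p. peval f p a)"
  unfolding peval_def by (rule ring_morphism_comp[OF ring_morphism_map_poly ring_morphism_poly])

lemma peval_pCons: "ring_morphism f \<Longrightarrow> peval f (pCons c p) a = f c + a * peval f p a"
  by (simp add: peval_def map_poly_pCons ring_morphism_0)

lemma peval_0 [simp]: "peval f 0 a = 0"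
  by (simp add: peval_def)

lemma peval_const: "ring_morphism f \<Longrightarrow> peval f [:c:] a = f c"
  by (simp add: peval_pCons)

lemma peval_X: "ring_morphism f \<Longrightarrow> peval f [:0, 1:] a = a"
  by (simp add: peval_pCons ring_morphism_0 ring_morphism_1)

lemma peval_morphism:
  assumes "ring_morphism f" "ring_morphism g"
  shows "g (peval f p a) = peval (\<lambda>c. g (f c)) p (g a)"
  using ring_morphism_comp[OF assms]
  by (induction p) (simp_all add: peval_pCons assms ring_morphism_simps[OF assms(2)])

lemma peval_mem:
  assumes "unital_subring S" "ring_morphism f" "\<And>c. f c \<in> S" "a \<in> S"
  shows "peval f p a \<in> S"
proof -
  interpret unital_subring S by fact
  show ?thesis by (induction p) (simp_all add: peval_pCons assms)
qed

definition eval1 where "eval1 \<kappa> x p = peval \<kappa> p x"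
definition eval2 where "eval2 \<kappa> x z p = peval (eval1 \<kappa> x) p z"
definition eval3 where "eval3 \<kappa> x z y p = peval (eval2 \<kappa> x z) p y"
definition eval4 where "eval4 \<kappa> x z y t p = peval (eval3 \<kappa> x z y) p t"

context
  fixes \<kappa> :: "'k::comm_ring_1 \<Rightarrow> 'a::comm_ring_1"
  assumes \<kappa>: "ring_morphism \<kappa>"
begin

lemma eval_morphism:
  "ring_morphism (eval1 \<kappa> x)" "ring_morphism (eval2 \<kappa> x z)" "ring_morphism (eval3 \<kappa> x z y)"
  "ring_morphism (eval4 \<kappa> x z y t)"
proof -
  show 1: "ring_morphism (eval1 \<kappa> x)" unfolding eval1_def by (rule ring_morphism_peval[OF \<kappa>])
  show 2: "ring_morphism (eval2 \<kappa> x z)" unfolding eval2_def by (rule ring_morphism_peval[OF 1])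
  show 3: "ring_morphism (eval3 \<kappa> x z y)" unfolding eval3_def by (rule ring_morphism_peval[OF 2])
  show "ring_morphism (eval4 \<kappa> x z y t)" unfolding eval4_def by (rule ring_morphism_peval[OF 3])
qed

lemma eval_pCons:
  "eval1 \<kappa> x (pCons c p) = \<kappa> c + x * eval1 \<kappa> x p"
  "eval2 \<kappa> x z (pCons c1 p1) = eval1 \<kappa> x c1 + z * eval2 \<kappa> x z p1"
  "eval3 \<kappa> x z y (pCons c2 p2) = eval2 \<kappa> x z c2 + y * eval3 \<kappa> x z y p2"
  "eval4 \<kappa> x z y t (pCons c3 p3) = eval3 \<kappa> x z y c3 + t * eval4 \<kappa> x z y t p3"
  by (simp_all add: eval1_def[abs_def] eval2_def[abs_def] eval3_def[abs_def] eval4_def[abs_def]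
     peval_pCons \<kappa> ring_morphism_peval)

lemma eval_0: "eval1 \<kappa> x 0 = 0" "eval2 \<kappa> x z 0 = 0" "eval3 \<kappa> x z y 0 = 0" "eval4 \<kappa> x z y t 0 = 0"
  using eval_morphism by (auto intro: ring_morphism_0)

lemma eval_1: "eval1 \<kappa> x 1 = 1" "eval2 \<kappa> x z 1 = 1" "eval3 \<kappa> x z y 1 = 1" "eval4 \<kappa> x z y t 1 = 1"
  using eval_morphism by (auto intro: ring_morphism_1)

lemma eval_compose:
  assumes "ring_morphism g"
  shows "g (eval1 \<kappa> x p1) = eval1 (\<lambda>c. g (\<kappa> c)) (g x) p1"
   "g (eval2 \<kappa> x z p2) = eval2 (\<lambda>c. g (\<kappa> c)) (g x) (g z) p2"
   "g (eval3 \<kappa> x z y p3) = eval3 (\<lambda>c. g (\<kappa> c)) (g x) (g z) (g y) p3"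
   "g (eval4 \<kappa> x z y t p4) = eval4 (\<lambda>c. g (\<kappa> c)) (g x) (g z) (g y) (g t) p4"
  by (simp_all add: eval1_def[abs_def] eval2_def[abs_def] eval3_def[abs_def] eval4_def[abs_def]
     peval_morphism[OF _ assms] \<kappa> ring_morphism_peval)

lemma eval_mem:
  assumes "unital_subring S" "\<And>c. \<kappa> c \<in> S" "x \<in> S"
  shows "eval1 \<kappa> x p1 \<in> S" "z \<in> S \<Longrightarrow> eval2 \<kappa> x z p2 \<in> S"
    "z \<in> S \<Longrightarrow> y \<in> S \<Longrightarrow> eval3 \<kappa> x z y p3 \<in> S"
    "z \<in> S \<Longrightarrow> y \<in> S \<Longrightarrow> t \<in> S \<Longrightarrow> eval4 \<kappa> x z y t p4 \<in> S"
  unfolding eval1_def[abs_def] eval2_def[abs_def] eval3_def[abs_def] eval4_def[abs_def]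
  by (intro peval_mem assms \<kappa> ring_morphism_peval; simp)+

end

section \<open>Explicit membership in ideals and the kernel of the evaluation\<close>

lemma ideal_of_mem_iff:
  fixes S :: "'a::comm_ring_1 set"
  assumes I: "\<And>a b. a \<in> I \<Longrightarrow> b \<in> I \<Longrightarrow> a + b \<in> I" "\<And>a c. a \<in> I \<Longrightarrow> c * a \<in> I" "0 \<in> I" "S \<subseteq> I"
  and min: "\<And>J. S \<subseteq> J \<Longrightarrow> (\<And>a b. a \<in> J \<Longrightarrow> b \<in> J \<Longrightarrow> a + b \<in> J) \<Longrightarrow> (\<And>a c. a \<in> J \<Longrightarrow> c * a \<in> J) \<Longrightarrow> I \<subseteq> J"
  shows "ideal_of S = I"
proof -
  let ?R = "ring_of_type_algebra :: 'a ring"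
  have simps: "carrier ?R = UNIV" "monoid.mult ?R = (*)" "add ?R = (+)" "ring.zero ?R = 0" "one ?R = 1"
    by (auto simp: ring_of_type_algebra_def)
  interpret R: cring ?R by (rule cring_from_type_algebra)
  have "ideal I ?R"
  proof (rule idealI)
    show "subgroup I (add_monoid ?R)"
    proof (rule R.add.subgroupI)
      fix a assume a: "a \<in> I"
      have "(-1) * a \<in> I" using a I(2) by blast
      moreover have "\<ominus>\<^bsub>?R\<^esub> a = - a"
        by (rule R.minus_equality) (simp_all add: simps)
      ultimately show "\<ominus>\<^bsub>?R\<^esub> a \<in> I" by simp
    qed (use I in \<open>auto simp: simps\<close>)
  qed (use I in \<open>auto simp: simps R.ring_axioms mult.commute\<close>)
  then have "ideal_of S \<subseteq> I" unfolding ideal_of_def genideal_def using I(4) by blast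
  moreover have "I \<subseteq> ideal_of S"
  proof (rule min)
    have id: "ideal (ideal_of S) ?R" unfolding ideal_of_def by (rule R.genideal_ideal) (simp add: simps)
    then interpret ideal "ideal_of S" ?R .
    show "S \<subseteq> ideal_of S" unfolding ideal_of_def by (rule R.genideal_self) (simp add: simps)
    show "a + b \<in> ideal_of S" if "a \<in> ideal_of S" "b \<in> ideal_of S" for a b
      using a_closed[OF that] by (simp add: simps)
    show "c * a \<in> ideal_of S" if "a \<in> ideal_of S" for a c
      using I_l_closed[OF that, of c] by (simp add: simps)
  qed
  ultimately show ?thesis by blast
qed

lemma ideal_of_pair: "ideal_of {a, b :: 'a::comm_ring_1} = {u * a + v * b | u v. True}"
proof (rule ideal_of_mem_iff)
  fix p q assume "p \<in> {u * a + v * b | u v. True}" "q \<in> {u * a + v * b | u v. True}"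
  then obtain u v u' v' where "p = u * a + v * b" "q = u' * a + v' * b" by blast
  then have "p + q = (u + u') * a + (v + v') * b" by (simp add: algebra_simps)
  then show "p + q \<in> {u * a + v * b | u v. True}" by blast
next
  fix p c assume "p \<in> {u * a + v * b | u v. True}"
  then obtain u v where "p = u * a + v * b" by blast
  then have "c * p = (c * u) * a + (c * v) * b" by (simp add: algebra_simps)
  then show "c * p \<in> {u * a + v * b | u v. True}" by blast
next
  have "0 = 0 * a + 0 * b" by simp
  then show "0 \<in> {u * a + v * b | u v. True}" by blast
  have "a = 1 * a + 0 * b" "b = 0 * a + 1 * b" by simp_all
  then show "{a, b} \<subseteq> {u * a + v * b | u v. True}" by blast
qed auto

lemma ideal_of_triple: "ideal_of {a, b, c :: 'a::comm_ring_1} = {u * a + v * b + w * c | u v w. True}"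
proof (rule ideal_of_mem_iff)
  fix p q assume "p \<in> {u * a + v * b + w * c | u v w. True}" "q \<in> {u * a + v * b + w * c | u v w. True}"
  then obtain u v w u' v' w' where "p = u * a + v * b + w * c" "q = u' * a + v' * b + w' * c" by blast
  then have "p + q = (u + u') * a + (v + v') * b + (w + w') * c" by (simp add: algebra_simps)
  then show "p + q \<in> {u * a + v * b + w * c | u v w. True}" by blast
next
  fix p m assume "p \<in> {u * a + v * b + w * c | u v w. True}"
  then obtain u v w where "p = u * a + v * b + w * c" by blast
  then have "m * p = (m * u) * a + (m * v) * b + (m * w) * c" by (simp add: algebra_simps)
  then show "m * p \<in> {u * a + v * b + w * c | u v w. True}" by blast
next
  have "0 = 0 * a + 0 * b + 0 * c" by simp
  then show "0 \<in> {u * a + v * b + w * c | u v w. True}" by blast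
  have "a = 1 * a + 0 * b + 0 * c" "b = 0 * a + 1 * b + 0 * c" "c = 0 * a + 0 * b + 1 * c" by simp_all
  then show "{a, b, c} \<subseteq> {u * a + v * b + w * c | u v w. True}" by blast
qed auto

text \<open>Modulo a Y - b each product a Y becomes b, so a sufficiently high power of a absorbs all
  occurrences of Y.\<close>

lemma eliminate_variable:
  fixes a b :: "'a::comm_ring_1" and h :: "'a poly"
  shows "\<exists>M g \<alpha>. [:a:] ^ M * h = [:g:] + \<alpha> * ([:a:] * [:0, 1:] - [:b:])"
proof (induction h)
  case 0
  show ?case by (intro exI[of _ 0]) simp
next
  case (pCons c h)
  then obtain M g \<alpha> where IH: "[:a:] ^ M * h = [:g:] + \<alpha> * ([:a:] * [:0, 1:] - [:b:])" by blast
  let ?Y = "[:0, 1:] :: 'a poly" and ?B = "[:a:] * [:0, 1:] - [:b:]"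
  have pc: "pCons c h = [:c:] + ?Y * h" by simp
  have aM: "[:a:] ^ n = [:a ^ n:]" for n by (induction n) (simp_all add: one_pCons)
  have "[:a:] ^ Suc M * pCons c h = [:a ^ Suc M * c:] + [:a:] * ?Y * ([:a:] ^ M * h)"
    unfolding pc by (simp only: aM distrib_left power_Suc) (simp add: mult_ac)
  also have "\<dots> = [:a ^ Suc M * c:] + [:b:] * [:g:] + ([:g:] + [:a:] * ?Y * \<alpha>) * ?B"
    unfolding IH by (simp only: algebra_simps)
  also have "\<dots> = [:a ^ Suc M * c + b * g:] + ([:g:] + [:a:] * ?Y * \<alpha>) * ?B" by simp
  finally show ?case by blast
qed

text \<open>Let m be the largest index at which c fails to divide p. In degree m + degree q the
  product has coefficient \<open>coeff p m\<close>, up to multiples of c. Monicity of q does the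
  work that primality of c does in Gauss' lemma.\<close>

lemma const_dvd_mult_monic:
  fixes c :: "'a::idom" and p q :: "'a poly"
  assumes "[:c:] dvd p * q" "lead_coeff q = 1"
  shows "[:c:] dvd p"
proof (rule ccontr)
  assume "\<not> [:c:] dvd p"
  then obtain i where i: "\<not> c dvd coeff p i" by (auto simp: const_poly_dvd_iff)
  define I where "I = {i. \<not> c dvd coeff p i}"
  have "I \<subseteq> {..degree p}" unfolding I_def by (auto intro: le_degree)
  then have fin: "finite I" by (rule finite_subset) simp
  define m where "m = Max I"
  have "m \<in> I" using Max_in[OF fin] i by (auto simp: m_def I_def)
  moreover have "c dvd coeff p j" if "j > m" for j
    using Max_ge[OF fin, of j] that by (auto simp: m_def I_def)
  ultimately have m: "m \<in> I" "\<And>j. j > m \<Longrightarrow> c dvd coeff p j" .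
  have "coeff (p * q) (m + degree q) = (\<Sum>j\<le>m + degree q. coeff p j * coeff q (m + degree q - j))"
    by (rule coeff_mult)
  also have "\<dots> = coeff p m * coeff q (m + degree q - m) +
      (\<Sum>j\<in>{..m + degree q} - {m}. coeff p j * coeff q (m + degree q - j))"
    by (rule sum.remove) auto
  finally have eq: "coeff (p * q) (m + degree q) = coeff p m +
      (\<Sum>j\<in>{..m + degree q} - {m}. coeff p j * coeff q (m + degree q - j))"
    using assms(2) by simp
  have "c dvd (\<Sum>j\<in>{..m + degree q} - {m}. coeff p j * coeff q (m + degree q - j))"
  proof (rule dvd_sum)
    fix j assume j: "j \<in> {..m + degree q} - {m}"
    show "c dvd coeff p j * coeff q (m + degree q - j)"
    proof (cases "j > m")
      case True
      then show ?thesis using m(2) by (intro dvd_mult2)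
    next
      case False
      then have "coeff q (m + degree q - j) = 0" using j by (intro coeff_eq_0) auto
      then show ?thesis by simp
    qed
  qed
  moreover have "c dvd coeff (p * q) (m + degree q)" using assms(1) by (simp add: const_poly_dvd_iff)
  ultimately have "c dvd coeff p m" unfolding eq by (simp add: dvd_add_left_iff)
  then show False using m(1) by (simp add: I_def)
qed

lemma map_poly_eq_0_dvd:
  fixes f :: "'a::idom \<Rightarrow> 'b::comm_ring_1"
  assumes "ring_morphism f" "\<And>a. f a = 0 \<Longrightarrow> c dvd a" "map_poly f p = 0"
  shows "[:c:] dvd p"
proof -
  have "f (coeff p i) = 0" for i
    using assms(3) coeff_map_poly[of f p i] by (simp add: ring_morphism_0[OF assms(1)])
  then show ?thesis using assms(2) by (simp add: const_poly_dvd_iff)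
qed

lemma surj_map_poly:
  assumes "ring_morphism f" "surj f"
  shows "surj (map_poly f)"
proof (rule surjI)
  fix p
  \<comment> \<open>A section of f that is made to fix 0, because \<open>map_poly g\<close> acts on
    each coefficient only if g 0 = 0.\<close>
  define g where "g = (\<lambda>a. if a = 0 then 0 else inv_into UNIV f a)"
  have "f (g a) = a" for a using assms by (simp add: g_def ring_morphism_0 surj_f_inv_f)
  moreover have "g 0 = 0" by (simp add: g_def)
  ultimately show "map_poly f (map_poly g p) = p"
    using ring_morphism_0[OF assms(1)] by (intro poly_eqI) (simp add: coeff_map_poly)
qed

lemma ring_morphism_at_0: "ring_morphism P_at_0" "ring_morphism Q_at_0" "ring_morphism (map_poly Q_at_0)"
proof -
  show 1: "ring_morphism P_at_0" unfolding P_at_0_def[abs_def]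
    by (rule ring_morphism_map_poly[OF ring_morphism_poly])
  show 2: "ring_morphism Q_at_0" unfolding Q_at_0_def[abs_def] by (rule ring_morphism_map_poly[OF 1])
  show "ring_morphism (map_poly Q_at_0)" by (rule ring_morphism_map_poly[OF 2])
qed

lemma surj_at_0:
  "surj (P_at_0 :: 'a::field poly poly \<Rightarrow> _)" "surj (Q_at_0 :: 'a poly poly poly \<Rightarrow> _)"
  "surj (map_poly Q_at_0 :: 'a poly poly poly poly \<Rightarrow> _)"
proof -
  have "surj (\<lambda>p :: 'a poly. poly p 0)" by (rule surjI[of _ "\<lambda>c. [:c:]"]) simp
  then show 1: "surj (P_at_0 :: 'a poly poly \<Rightarrow> _)" unfolding P_at_0_def[abs_def]
    by (intro surj_map_poly ring_morphism_poly)
  show 2: "surj (Q_at_0 :: 'a poly poly poly \<Rightarrow> _)" unfolding Q_at_0_def[abs_def]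
    by (rule surj_map_poly[OF ring_morphism_at_0(1) 1])
  show "surj (map_poly Q_at_0 :: 'a poly poly poly poly \<Rightarrow> _)"
    by (rule surj_map_poly[OF ring_morphism_at_0(2) 2])
qed

lemma at_0_eq_0:
  fixes p2 :: "'a::field poly poly" and p3 :: "'a poly poly poly" and p4 :: "'a poly poly poly poly"
  shows "P_at_0 p2 = 0 \<Longrightarrow> [:[:0, 1:]:] dvd p2"
  "Q_at_0 p3 = 0 \<Longrightarrow> [:[:[:0, 1:]:]:] dvd p3"
  "map_poly Q_at_0 p4 = 0 \<Longrightarrow> X4 dvd p4"
proof -
  have 1: "[:0, 1:] dvd p" if "poly p 0 = 0" for p :: "'a poly"
    using that by (simp add: poly_eq_0_iff_dvd)
  show 2: "P_at_0 p2 = 0 \<Longrightarrow> [:[:0, 1:]:] dvd p2" for p2 :: "'a poly poly" unfolding P_at_0_def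
    by (rule map_poly_eq_0_dvd[OF ring_morphism_poly 1])
  show 3: "Q_at_0 p3 = 0 \<Longrightarrow> [:[:[:0, 1:]:]:] dvd p3" for p3 :: "'a poly poly poly" unfolding Q_at_0_def
    by (rule map_poly_eq_0_dvd[OF ring_morphism_at_0(1) 2])
  show "map_poly Q_at_0 p4 = 0 \<Longrightarrow> X4 dvd p4" for p4 :: "'a poly poly poly poly" unfolding X4_def
    by (rule map_poly_eq_0_dvd[OF ring_morphism_at_0(2) 3])
qed

lemma P_at_0_monic:
  assumes "lead_coeff P = 1" shows "lead_coeff (P_at_0 P) = 1" "degree (P_at_0 P) = degree P"
proof -
  have c: "coeff (P_at_0 P) i = poly (coeff P i) 0" for i by (simp add: P_at_0_def coeff_map_poly)
  show "degree (P_at_0 P) = degree P"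
  proof (rule antisym)
    show "degree (P_at_0 P) \<le> degree P" by (rule degree_le) (simp add: c coeff_eq_0)
    show "degree P \<le> degree (P_at_0 P)" by (rule le_degree) (simp add: c assms)
  qed
  then show "lead_coeff (P_at_0 P) = 1" using assms by (simp add: c)
qed

lemma Q_at_0_monic:
  assumes "lead_coeff Q = 1" shows "lead_coeff (Q_at_0 Q) = 1" "degree (Q_at_0 Q) = degree Q"
proof -
  have c: "coeff (Q_at_0 Q) i = P_at_0 (coeff Q i)" for i
    by (simp add: Q_at_0_def coeff_map_poly ring_morphism_0[OF ring_morphism_at_0(1)])
  have P: "P_at_0 0 = 0" "P_at_0 1 = 1" using ring_morphism_at_0(1) by (auto intro: ring_morphism_0 ring_morphism_1)
  show "degree (Q_at_0 Q) = degree Q"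
  proof (rule antisym)
    show "degree (Q_at_0 Q) \<le> degree Q" by (rule degree_le) (simp add: c coeff_eq_0 P)
    show "degree Q \<le> degree (Q_at_0 Q)" by (rule le_degree) (simp add: c assms P)
  qed
  then show "lead_coeff (Q_at_0 Q) = 1" using assms P by (simp add: c)
qed

lemma B_ideal_eq:
  "B_ideal P Q d e = {u * (X4 ^ d * Y4 - [:[:P:]:]) + v * (X4 ^ e * T4 - [:Q:]) | u v. True}"
  unfolding B_ideal_def by (rule ideal_of_pair)

text \<open>X is a nonzerodivisor modulo the two relations: at X = 0 these become -P(0,Z) and
  -Q(0,Y,Z), a regular sequence since the first is nonzero and the second is monic in Y. A relation
  between them is therefore a Koszul relation, and subtracting a lift of it makes both coefficients
  divisible by X.\<close>

lemma B_ideal_cancel_X: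
  fixes P :: "'k::field poly poly"
  assumes P: "P_at_0 P \<noteq> 0" and Q: "lead_coeff (Q_at_0 Q) = 1" and de: "d > 0" "e > 0"
    and H: "X4 * H \<in> B_ideal P Q d e"
  shows "H \<in> B_ideal P Q d e"
proof -
  define A where "A = X4 ^ d * Y4 - [:[:P:]:]"
  define B where "B = X4 ^ e * T4 - [:Q:]"
  obtain u v where uv: "X4 * H = u * A + v * B" using H unfolding B_ideal_eq A_def B_def by blast
  let ?f = "map_poly Q_at_0 :: 'k poly poly poly poly \<Rightarrow> _"
  note f = ring_morphism_simps[OF ring_morphism_at_0(3)]
  define p where "p = [:[:P_at_0 P:]:]"
  define q where "q = [:Q_at_0 Q:]"
  have P0: "P_at_0 0 = 0" "Q_at_0 0 = 0" using ring_morphism_at_0 by (auto intro: ring_morphism_0)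
  have fX: "?f X4 = 0"
    by (simp add: X4_def map_poly_pCons P0 Q_at_0_def P_at_0_def)
  have fA: "?f A = - p" unfolding A_def using de(1)
    by (simp add: f fX p_def map_poly_pCons P0 Q_at_0_def power_0_left)
  have fB: "?f B = - q" unfolding B_def using de(2)
    by (simp add: f fX q_def map_poly_pCons P0 power_0_left)
  have p0: "p \<noteq> 0" using P by (simp add: p_def)
  have "?f u * p + ?f v * q = - ?f (X4 * H)" unfolding uv by (simp add: f fA fB)
  then have eq: "?f u * p = - ?f v * q" by (simp add: f fX add_eq_0_iff2)
  have "[:P_at_0 P:] dvd coeff (?f v) i" for i
  proof (rule const_dvd_mult_monic[OF _ Q])
    have "p dvd ?f v * q" by (rule dvdI[of _ _ "- ?f u"]) (use eq in \<open>simp add: algebra_simps\<close>)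
    then have "[:P_at_0 P:] dvd coeff (?f v * q) i" unfolding p_def const_poly_dvd_iff by blast
    then show "[:P_at_0 P:] dvd coeff (?f v) i * Q_at_0 Q" by (simp add: q_def mult.commute)
  qed
  then have "p dvd ?f v" unfolding p_def by (simp add: const_poly_dvd_iff)
  then obtain \<sigma> where \<sigma>: "?f v = p * \<sigma>" by (rule dvdE)
  have "p * ?f u = p * (- \<sigma> * q)" using eq unfolding \<sigma> by (simp add: algebra_simps)
  then have u: "?f u = - \<sigma> * q" using p0 by (simp only: mult_cancel_left) simp
  \<comment> \<open>The lift to X of the Koszul multiplier; replacing (u, v) by (u - \<tau> B, v +
    \<tau> A) does not change u A + v B.\<close>
  obtain \<tau> where \<tau>: "?f \<tau> = \<sigma>" using surj_at_0(3) by (metis surj_def)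
  have "?f (v + \<tau> * A) = 0" by (simp add: f fA \<tau> \<sigma>)
  then obtain v' where v': "v + \<tau> * A = X4 * v'" using at_0_eq_0(3) by (blast elim: dvdE)
  have "?f (u - \<tau> * B) = 0" by (simp add: f fB \<tau> u)
  then obtain u' where u': "u - \<tau> * B = X4 * u'" using at_0_eq_0(3) by (blast elim: dvdE)
  have "X4 * H = (u - \<tau> * B) * A + (v + \<tau> * A) * B" unfolding uv by (simp add: algebra_simps)
  then have "X4 * H = X4 * (u' * A + v' * B)" unfolding u' v' by (simp add: algebra_simps)
  moreover have "X4 \<noteq> (0 :: 'k poly poly poly poly)" by (simp add: X4_def)
  ultimately have "H = u' * A + v' * B" by (simp only: mult_cancel_left) simp
  then show ?thesis unfolding B_ideal_eq A_def B_def by blast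
qed

lemma eval_X4_Y4_T4:
  assumes "ring_morphism \<kappa>"
  shows "eval4 \<kappa> x z y t X4 = x" "eval4 \<kappa> x z y t Y4 = y" "eval4 \<kappa> x z y t T4 = t"
    "eval4 \<kappa> x z y t [:[:[:0, 1:]:]:] = z"
    "eval4 \<kappa> x z y t [:q:] = eval3 \<kappa> x z y q" "eval3 \<kappa> x z y [:p:] = eval2 \<kappa> x z p"
  by (simp_all add: X4_def Y4_def T4_def eval_pCons assms eval_0 eval_1 one_pCons
      ring_morphism_0[OF assms] ring_morphism_1[OF assms])

text \<open>Eliminating T and then Y turns some X^n H, modulo the ideal, into a polynomial in X and
  Z alone. If H evaluates to 0 so does this polynomial, which then vanishes by injectivity; the
  factors X are cancelled one at a time.\<close>

lemma kernel_eval4: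
  fixes \<kappa> :: "'k::field \<Rightarrow> 'a::idom"
  assumes \<kappa>: "ring_morphism \<kappa>" and x: "x \<noteq> 0" and inj: "\<And>p. eval2 \<kappa> x z p = 0 \<Longrightarrow> p = 0"
    and y: "x ^ d * y = eval2 \<kappa> x z P" and t: "x ^ e * t = eval3 \<kappa> x z y Q"
    and P: "P_at_0 P \<noteq> 0" and Q: "lead_coeff (Q_at_0 Q) = 1" and de: "d > 0" "e > 0"
  shows "eval4 \<kappa> x z y t H = 0 \<longleftrightarrow> H \<in> B_ideal P Q d e"
proof
  note ev = ring_morphism_simps[OF eval_morphism(4)[OF \<kappa>]] eval_X4_Y4_T4[OF \<kappa>]
  define A where "A = X4 ^ d * Y4 - [:[:P:]:]"
  define B where "B = X4 ^ e * T4 - [:Q:]"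
  have AB: "eval4 \<kappa> x z y t A = 0" "eval4 \<kappa> x z y t B = 0"
    by (simp_all add: A_def B_def ev y t)
  show "eval4 \<kappa> x z y t H = 0" if "H \<in> B_ideal P Q d e"
    using that unfolding B_ideal_eq A_def[symmetric] B_def[symmetric] by (auto simp: ev AB)
  assume H0: "eval4 \<kappa> x z y t H = 0"
  define X3 :: "'k poly poly poly" where "X3 = [:[:[:0, 1:]:]:]"
  define X2 :: "'k poly poly" where "X2 = [:[:0, 1:]:]"
  have pw: "[:a:] ^ n = [:a ^ n:]" for a :: "'c::comm_ring_1" and n
    by (induction n) (simp_all add: one_pCons)
  have B': "[:X3 ^ e:] * [:0, 1:] - [:Q:] = B" by (simp add: B_def X4_def T4_def X3_def flip: pw)
  have A': "[:[:X2 ^ d:] * [:0, 1:] - [:P:]:] = A"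
    by (simp add: A_def X4_def Y4_def X2_def pw)
  obtain M g \<beta> where 1: "[:X3 ^ e:] ^ M * H = [:g:] + \<beta> * ([:X3 ^ e:] * [:0, 1:] - [:Q:])"
    using eliminate_variable by blast
  obtain N h \<alpha> where 2: "[:X2 ^ d:] ^ N * g = [:h:] + \<alpha> * ([:X2 ^ d:] * [:0, 1:] - [:P:])"
    using eliminate_variable by blast
  have "X4 ^ (d * N) * (X4 ^ (e * M) * H) = [:[:X2 ^ d:] ^ N:] * ([:X3 ^ e:] ^ M * H)"
    by (simp add: X4_def X3_def X2_def pw power_mult)
  also have "\<dots> = [:[:X2 ^ d:] ^ N * g:] + [:[:X2 ^ d:] ^ N:] * \<beta> * B"
    unfolding 1 B' by (simp add: smult_add_right mult.commute)
  also have "\<dots> = [:[:h:]:] + [:\<alpha>:] * A + [:[:X2 ^ d:] ^ N:] * \<beta> * B"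
    unfolding 2 A'[symmetric] by simp
  finally have "X4 ^ (d * N + e * M) * H = [:[:h:]:] + ([:\<alpha>:] * A + [:[:X2 ^ d:] ^ N:] * \<beta> * B)"
    by (simp add: power_add mult.assoc add.assoc)
  then obtain n u v where n: "X4 ^ n * H = [:[:h:]:] + (u * A + v * B)" by blast
  have "eval4 \<kappa> x z y t (X4 ^ n * H) = eval2 \<kappa> x z h" unfolding n by (simp add: ev AB)
  then have "h = 0" using inj by (simp add: ev H0)
  then have "X4 ^ n * H \<in> B_ideal P Q d e" using n unfolding B_ideal_eq A_def B_def by auto
  then show "H \<in> B_ideal P Q d e"
  proof (induction n)
    case (Suc n)
    then show ?case using B_ideal_cancel_X[OF P Q de, of "X4 ^ n * H"] by (simp add: mult.assoc)
  qed simp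
qed

section \<open>Transport of isomorphisms of algebras\<close>

definition subalg :: "('k::field \<Rightarrow> 'a::comm_ring_1) \<Rightarrow> 'a set \<Rightarrow> ('k, 'a) alg" where
  "subalg \<kappa> S = \<lparr>carrier = S, monoid.mult = (*), one = 1, ring.zero = 0, add = (+), scal = \<kappa>\<rparr>"

lemma subalg_simps [simp]:
  "carrier (subalg \<kappa> S) = S" "monoid.mult (subalg \<kappa> S) = (*)" "one (subalg \<kappa> S) = 1"
  "ring.zero (subalg \<kappa> S) = 0" "add (subalg \<kappa> S) = (+)" "scal (subalg \<kappa> S) = \<kappa>"
  by (simp_all add: subalg_def)

lemma cring_subalg: "unital_subring S \<Longrightarrow> cring (subalg \<kappa> S)"
proof -
  assume "unital_subring S"
  then interpret unital_subring S .
  show ?thesis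
  proof (rule cringI)
    show "abelian_group (subalg \<kappa> S)"
      by (rule abelian_groupI) (auto intro: bexI[of _ "- x" for x] simp: algebra_simps)
    show "Group.comm_monoid (subalg \<kappa> S)" by (rule comm_monoidI) (auto simp: algebra_simps)
  qed (auto simp: algebra_simps)
qed

lemma alg_iso_sym: "ring A \<Longrightarrow> (\<And>c. scal A c \<in> carrier A) \<Longrightarrow> A \<cong>\<^sub>k B \<Longrightarrow> B \<cong>\<^sub>k A"
proof -
  assume A: "ring A" "\<And>c. scal A c \<in> carrier A" and "A \<cong>\<^sub>k B"
  then obtain h where h: "h \<in> ring_iso A B" "\<And>c. h (scal A c) = scal B c" unfolding alg_iso_def by blast
  have "inv_into (carrier A) h (scal B c) = scal A c" for c
    unfolding h(2)[symmetric] using h(1) A(2)[of c]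
    by (intro inv_into_f_f) (auto simp: ring_iso_def bij_betw_def)
  then show ?thesis unfolding alg_iso_def using ring_iso_set_sym[OF A(1) h(1)] by blast
qed

lemma alg_iso_trans: "A \<cong>\<^sub>k B \<Longrightarrow> B \<cong>\<^sub>k C \<Longrightarrow> A \<cong>\<^sub>k C"
proof -
  assume "A \<cong>\<^sub>k B" "B \<cong>\<^sub>k C"
  then obtain f g where "f \<in> ring_iso A B" "\<And>c. f (scal A c) = scal B c"
    "g \<in> ring_iso B C" "\<And>c. g (scal B c) = scal C c" unfolding alg_iso_def by blast
  then have "g \<circ> f \<in> ring_iso A C" "\<And>c. (g \<circ> f) (scal A c) = scal C c"
    using ring_iso_set_trans by auto
  then show ?thesis unfolding alg_iso_def by blast
qed

text \<open>The records of \<^const>\<open>B_alg\<close> and \<^const>\<open>poly_alg\<close> repeat the fields of a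
  ring, so the identity is a ring isomorphism.\<close>

lemma cring_same_fields:
  assumes "cring R" "carrier A = carrier R" "monoid.mult A = monoid.mult R" "one A = one R"
    "ring.zero A = ring.zero R" "add A = add R"
  shows "cring A"
proof -
  have "id \<in> ring_iso R A" by (rule ring_iso_memI) (auto simp: assms)
  then have "cring (A \<lparr> ring.zero := id \<zero>\<^bsub>R\<^esub> \<rparr>)" by (rule cring.ring_iso_imp_img_cring[OF assms(1)])
  moreover have "A \<lparr> ring.zero := id \<zero>\<^bsub>R\<^esub> \<rparr> = A" using assms(5) by simp
  ultimately show ?thesis by simp
qed

lemma poly_alg_simps:
  "carrier (A\<^sup>[\<^sup>1\<^sup>]) = carrier (UP A)" "monoid.mult (A\<^sup>[\<^sup>1\<^sup>]) = monoid.mult (UP A)"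
  "one (A\<^sup>[\<^sup>1\<^sup>]) = one (UP A)" "ring.zero (A\<^sup>[\<^sup>1\<^sup>]) = ring.zero (UP A)" "add (A\<^sup>[\<^sup>1\<^sup>]) = add (UP A)"
  "scal (A\<^sup>[\<^sup>1\<^sup>]) = (\<lambda>c. up_ring.monom (UP A) (scal A c) 0)"
  by (simp_all add: poly_alg_def)

lemma cring_poly_alg: "cring A \<Longrightarrow> cring (A\<^sup>[\<^sup>1\<^sup>])"
proof -
  assume "cring A"
  then interpret UP_cring A "UP A" by (simp add: UP_cring_def)
  show ?thesis by (rule cring_same_fields[OF UP_cring]) (simp_all add: poly_alg_simps)
qed

lemma poly_alg_scal: "cring A \<Longrightarrow> scal A c \<in> carrier A \<Longrightarrow> scal (A\<^sup>[\<^sup>1\<^sup>]) c \<in> carrier (A\<^sup>[\<^sup>1\<^sup>])"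
proof -
  assume A: "cring A" "scal A c \<in> carrier A"
  then interpret UP_cring A "UP A" by (simp add: UP_cring_def)
  show ?thesis using A by (simp add: poly_alg_simps)
qed

definition polys_over :: "'a::comm_ring_1 set \<Rightarrow> 'a poly set" where
  "polys_over S = {p. \<forall>i. coeff p i \<in> S}"

lemma UP_mult_apply:
  "p \<in> up A \<Longrightarrow> q \<in> up A \<Longrightarrow> (p \<otimes>\<^bsub>UP A\<^esub> q) n = (\<Oplus>\<^bsub>A\<^esub>i\<in>{..n}. p i \<otimes>\<^bsub>A\<^esub> q (n - i))"
  by (simp add: UP_def)

lemma UP_add_apply: "p \<in> up A \<Longrightarrow> q \<in> up A \<Longrightarrow> (p \<oplus>\<^bsub>UP A\<^esub> q) n = p n \<oplus>\<^bsub>A\<^esub> q n"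
  by (simp add: UP_def)

lemma UP_one_apply: "\<one>\<^bsub>UP A\<^esub> n = (if n = 0 then \<one>\<^bsub>A\<^esub> else \<zero>\<^bsub>A\<^esub>)"
  by (simp add: UP_def)

lemma UP_monom_apply: "a \<in> carrier A \<Longrightarrow> up_ring.monom (UP A) a 0 n = (if n = 0 then a else \<zero>\<^bsub>A\<^esub>)"
  by (simp add: UP_def)

text \<open>The isomorphism is applied to each coefficient of the finitely supported function. This
  replaces polynomials over a quotient record by elements of the type \<open>poly\<close>, where the
  remaining computations take place.\<close>

lemma poly_alg_iso_polys_over:
  fixes A :: "('k::field, 'b) alg" and S :: "'a::comm_ring_1 set"
  assumes A: "cring A" "\<And>c. scal A c \<in> carrier A" and S: "unital_subring S" and iso: "A \<cong>\<^sub>k subalg \<kappa> S"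
  shows "A\<^sup>[\<^sup>1\<^sup>] \<cong>\<^sub>k subalg (\<lambda>c. [:\<kappa> c:]) (polys_over S)"
proof -
  interpret A: cring A by fact
  interpret UP: UP_cring A "UP A" by (simp add: UP_cring_def A)
  interpret S: unital_subring S by fact
  obtain g where g: "g \<in> ring_iso A (subalg \<kappa> S)" and gs: "\<And>c. g (scal A c) = \<kappa> c"
    using iso unfolding alg_iso_def by auto
  have gc: "g a \<in> S" if "a \<in> carrier A" for a using ring_iso_memE(1)[OF g that] by simp
  have gm: "g (a \<otimes>\<^bsub>A\<^esub> b) = g a * g b" if "a \<in> carrier A" "b \<in> carrier A" for a b
    using ring_iso_memE(2)[OF g that] by simp
  have ga: "g (a \<oplus>\<^bsub>A\<^esub> b) = g a + g b" if "a \<in> carrier A" "b \<in> carrier A" for a b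
    using ring_iso_memE(3)[OF g that] by simp
  have g1: "g \<one>\<^bsub>A\<^esub> = 1" using ring_iso_memE(4)[OF g] by simp
  have gb: "bij_betw g (carrier A) S" using ring_iso_memE(5)[OF g] by simp
  have g0: "g \<zero>\<^bsub>A\<^esub> = 0" using ga[of "\<zero>\<^bsub>A\<^esub>" "\<zero>\<^bsub>A\<^esub>"] by simp
  have gsum: "g (\<Oplus>\<^bsub>A\<^esub>i\<in>I. f i) = (\<Sum>i\<in>I. g (f i))" if "finite I" "f \<in> I \<rightarrow> carrier A" for I :: "nat set" and f
    using that
  proof (induction I rule: finite_induct)
    case (insert i I)
    then have "f i \<in> carrier A" "f \<in> I \<rightarrow> carrier A" by auto
    with insert show ?case by (simp add: A.finsum_insert A.finsum_closed ga)
  qed (simp add: g0)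
  define h where "h = (\<lambda>p. Abs_poly (\<lambda>i. g (p i)))"
  have car: "p \<in> carrier (UP A) \<longleftrightarrow> p \<in> up A" for p by (simp add: UP_def)
  have hc: "coeff (h p) i = g (p i)" if pA: "p \<in> up A" for p i
  proof -
    obtain n where n: "bound \<zero>\<^bsub>A\<^esub> n p" using A.bound_upD[OF pA] by auto
    have "coeff (h p) = (\<lambda>i. g (p i))" unfolding h_def
      by (rule coeff_Abs_poly[of n]) (use n g0 in \<open>auto simp: bound_def\<close>)
    then show ?thesis by simp
  qed
  have "h \<in> ring_iso (A\<^sup>[\<^sup>1\<^sup>]) (subalg (\<lambda>c. [:\<kappa> c:]) (polys_over S))"
  proof (rule ring_iso_memI)
    fix p assume p: "p \<in> carrier (A\<^sup>[\<^sup>1\<^sup>])"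
    then have pu: "p \<in> up A" by (simp add: poly_alg_simps car)
    show "h p \<in> carrier (subalg (\<lambda>c. [:\<kappa> c:]) (polys_over S))"
      using pu by (auto simp: polys_over_def hc intro!: gc)
    fix q assume q: "q \<in> carrier (A\<^sup>[\<^sup>1\<^sup>])"
    then have qu: "q \<in> up A" by (simp add: poly_alg_simps car)
    have "p \<otimes>\<^bsub>UP A\<^esub> q \<in> up A" "p \<oplus>\<^bsub>UP A\<^esub> q \<in> up A"
      using p q by (auto simp: poly_alg_simps simp flip: car)
    note cl = this
    have "h (p \<otimes>\<^bsub>UP A\<^esub> q) = h p * h q"
    proof (rule poly_eqI)
      fix n
      have "coeff (h (p \<otimes>\<^bsub>UP A\<^esub> q)) n = g (\<Oplus>\<^bsub>A\<^esub>i\<in>{..n}. p i \<otimes>\<^bsub>A\<^esub> q (n - i))"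
        unfolding hc[OF cl(1)] UP_mult_apply[OF pu qu] ..
      also have "\<dots> = (\<Sum>i\<le>n. g (p i \<otimes>\<^bsub>A\<^esub> q (n - i)))"
        by (rule gsum) (use pu qu in auto)
      also have "\<dots> = (\<Sum>i\<le>n. g (p i) * g (q (n - i)))"
        by (intro sum.cong refl gm) (use pu qu in auto)
      finally show "coeff (h (p \<otimes>\<^bsub>UP A\<^esub> q)) n = coeff (h p * h q) n"
        by (simp add: coeff_mult hc pu qu)
    qed
    then show "h (p \<otimes>\<^bsub>A\<^sup>[\<^sup>1\<^sup>]\<^esub> q) = h p \<otimes>\<^bsub>subalg (\<lambda>c. [:\<kappa> c:]) (polys_over S)\<^esub> h q"
      by (simp add: poly_alg_simps)
    have "h (p \<oplus>\<^bsub>UP A\<^esub> q) = h p + h q"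
    proof (rule poly_eqI)
      fix n
      have "coeff (h (p \<oplus>\<^bsub>UP A\<^esub> q)) n = g (p n \<oplus>\<^bsub>A\<^esub> q n)"
        unfolding hc[OF cl(2)] UP_add_apply[OF pu qu] ..
      also have "\<dots> = g (p n) + g (q n)" by (rule ga) (use pu qu in auto)
      finally show "coeff (h (p \<oplus>\<^bsub>UP A\<^esub> q)) n = coeff (h p + h q) n" by (simp add: hc pu qu)
    qed
    then show "h (p \<oplus>\<^bsub>A\<^sup>[\<^sup>1\<^sup>]\<^esub> q) = h p \<oplus>\<^bsub>subalg (\<lambda>c. [:\<kappa> c:]) (polys_over S)\<^esub> h q"
      by (simp add: poly_alg_simps)
  next
    have 1: "\<one>\<^bsub>UP A\<^esub> \<in> up A" using UP.one_closed by (simp add: car)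
    have "h \<one>\<^bsub>UP A\<^esub> = 1" by (rule poly_eqI) (simp add: hc[OF 1] UP_one_apply g0 g1 coeff_1)
    then show "h \<one>\<^bsub>A\<^sup>[\<^sup>1\<^sup>]\<^esub> = \<one>\<^bsub>subalg (\<lambda>c. [:\<kappa> c:]) (polys_over S)\<^esub>" by (simp add: poly_alg_simps)
  next
    show "bij_betw h (carrier (A\<^sup>[\<^sup>1\<^sup>])) (carrier (subalg (\<lambda>c. [:\<kappa> c:]) (polys_over S)))"
      unfolding poly_alg_simps subalg_simps
    proof (rule bij_betwI')
      fix p q assume "p \<in> carrier (UP A)" "q \<in> carrier (UP A)"
      then have pq: "p \<in> up A" "q \<in> up A" by (simp_all add: car)
      show "(h p = h q) = (p = q)"
      proof
        assume "h p = h q"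
        then have "g (p i) = g (q i)" for i using hc[OF pq(1), of i] hc[OF pq(2), of i] by simp
        then have "p i = q i" for i
          using inj_onD[OF bij_betw_imp_inj_on[OF gb], of "p i" "q i"] pq by auto
        then show "p = q" by (rule ext)
      qed simp
    next
      fix p assume "p \<in> carrier (UP A)"
      then show "h p \<in> polys_over S" by (auto simp: polys_over_def hc car intro!: gc)
    next
      fix p assume p: "p \<in> polys_over S"
      define q where "q = (\<lambda>i. inv_into (carrier A) g (coeff p i))"
      have q: "q i \<in> carrier A" "g (q i) = coeff p i" for i
        using p gb unfolding q_def polys_over_def bij_betw_def
        by (auto intro!: inv_into_into f_inv_into_f)
      have z: "q i = \<zero>\<^bsub>A\<^esub>" if "i > degree p" for i
      proof -
        have "g (q i) = g \<zero>\<^bsub>A\<^esub>" using q(2)[of i] that by (simp add: coeff_eq_0 g0)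
        then show ?thesis using gb q(1)[of i] by (auto simp: bij_betw_def inj_on_def)
      qed
      have "q \<in> up A" using q(1) z by (intro mem_upI exI[of _ "degree p"]) (auto simp: bound_def)
      moreover have "p = h q" by (rule poly_eqI) (simp add: hc[OF calculation] q(2))
      ultimately show "\<exists>q\<in>carrier (UP A). p = h q" by (auto simp: car)
    qed
  qed
  moreover have "h (scal (A\<^sup>[\<^sup>1\<^sup>]) c) = [:\<kappa> c:]" for c
  proof -
    have m: "up_ring.monom (UP A) (scal A c) 0 \<in> up A"
      using UP.monom_closed[OF A(2)[of c]] by (simp add: car)
    have "h (up_ring.monom (UP A) (scal A c) 0) = [:\<kappa> c:]"
      by (rule poly_eqI) (simp add: hc[OF m] UP_monom_apply A(2) gs g0 coeff_pCons split: nat.splits)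
    then show ?thesis by (simp add: poly_alg_simps)
  qed
  ultimately show ?thesis unfolding alg_iso_def by auto
qed

lemma B_alg_simps:
  fixes P :: "'k::field poly poly"
  defines "R \<equiv> ring_of_type_algebra :: 'k poly poly poly poly ring"
  shows "carrier (B_alg P Q d e) = carrier (R Quot B_ideal P Q d e)"
    "monoid.mult (B_alg P Q d e) = monoid.mult (R Quot B_ideal P Q d e)"
    "one (B_alg P Q d e) = one (R Quot B_ideal P Q d e)"
    "ring.zero (B_alg P Q d e) = ring.zero (R Quot B_ideal P Q d e)"
    "add (B_alg P Q d e) = add (R Quot B_ideal P Q d e)"
    "scal (B_alg P Q d e) c = B_ideal P Q d e +>\<^bsub>R\<^esub> [:[:[:[:c:]:]:]:]"
  by (simp_all add: B_alg_def Let_def R_def)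

lemma poly4_ring_simps:
  "carrier (ring_of_type_algebra :: 'a::comm_ring_1 ring) = UNIV"
  "monoid.mult (ring_of_type_algebra :: 'a::comm_ring_1 ring) = (*)"
  "one (ring_of_type_algebra :: 'a::comm_ring_1 ring) = 1"
  "ring.zero (ring_of_type_algebra :: 'a::comm_ring_1 ring) = 0"
  "add (ring_of_type_algebra :: 'a::comm_ring_1 ring) = (+)"
  by (simp_all add: ring_of_type_algebra_def)

lemma ideal_B_ideal: "ideal (B_ideal P Q d e) ring_of_type_algebra"
proof -
  interpret ring "ring_of_type_algebra :: 'a poly poly poly poly ring" by (rule ring_from_type_algebra)
  show ?thesis unfolding B_ideal_def ideal_of_def by (rule genideal_ideal) (simp add: poly4_ring_simps)
qed

lemma cring_B_alg: "cring (B_alg P Q d e)"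
proof -
  interpret ideal "B_ideal P Q d e" "ring_of_type_algebra" by (rule ideal_B_ideal)
  have "cring (ring_of_type_algebra Quot B_ideal P Q d e)"
    by (rule quotient_is_cring) (rule cring_from_type_algebra)
  then show ?thesis by (rule cring_same_fields) (simp_all add: B_alg_simps)
qed

lemma B_alg_projection:
  fixes P :: "'k::field poly poly"
  defines "R \<equiv> ring_of_type_algebra :: 'k poly poly poly poly ring"
  shows "(\<lambda>p. B_ideal P Q d e +>\<^bsub>R\<^esub> p) \<in> ring_hom R (B_alg P Q d e)"
    "(\<lambda>p. B_ideal P Q d e +>\<^bsub>R\<^esub> p) ` UNIV = carrier (B_alg P Q d e)"
proof -
  interpret ideal "B_ideal P Q d e" R unfolding R_def by (rule ideal_B_ideal)
  have "(\<lambda>p. B_ideal P Q d e +>\<^bsub>R\<^esub> p) \<in> ring_hom R (R Quot B_ideal P Q d e)"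
    by (rule rcos_ring_hom)
  then show "(\<lambda>p. B_ideal P Q d e +>\<^bsub>R\<^esub> p) \<in> ring_hom R (B_alg P Q d e)"
    by (simp add: ring_hom_def B_alg_simps R_def)
  show "(\<lambda>p. B_ideal P Q d e +>\<^bsub>R\<^esub> p) ` UNIV = carrier (B_alg P Q d e)"
    unfolding B_alg_simps R_def by (auto simp: FactRing_def A_RCOSETS_def' poly4_ring_simps)
qed

lemma B_alg_scal_mem: "scal (B_alg P Q d e) c \<in> carrier (B_alg P Q d e)"
  unfolding B_alg_projection(2)[symmetric] B_alg_simps by blast

lemma const4_hom: "ring_morphism (\<lambda>c. [:[:[:[:c:]:]:]:])"
  by (intro ring_morphismI) (simp_all add: one_pCons)

lemma k_algebra_B_alg: "k_algebra (B_alg P Q d e)"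
proof -
  let ?R = "ring_of_type_algebra :: 'a poly poly poly poly ring"
  have "(\<lambda>c. [:[:[:[:c:]:]:]:]) \<in> ring_hom ring_of_type_algebra ?R"
    using const4_hom by (auto simp: ring_hom_def poly4_ring_simps ring_morphism_def)
  from ring_hom_trans[OF this B_alg_projection(1)[of P Q d e]]
  have "scal (B_alg P Q d e) \<in> ring_hom ring_of_type_algebra (B_alg P Q d e)"
    by (simp add: comp_def B_alg_simps(6)[abs_def])
  then show ?thesis by (simp add: k_algebra_def cring_B_alg)
qed

lemma fg_algebra_B_alg: "fg_algebra (B_alg P Q d e)"
  unfolding fg_algebra_def
proof (intro conjI exI k_algebra_B_alg)
  let ?B = "B_alg P Q d e"
  interpret B: cring ?B by (rule cring_B_alg)
  let ?R = "ring_of_type_algebra :: 'a poly poly poly poly ring"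
  let ?\<pi> = "\<lambda>p. B_ideal P Q d e +>\<^bsub>?R\<^esub> p"
  let ?S = "?\<pi> ` {X4, [:[:[:0, 1:]:]:], Y4, T4}"
  let ?G = "generate_ring ?B (range (scal ?B) \<union> ?S)"
  show "finite ?S" by simp
  show sub: "?S \<subseteq> carrier ?B" unfolding B_alg_projection(2)[symmetric] by blast
  have add: "?\<pi> (p + q) = ?\<pi> p \<oplus>\<^bsub>?B\<^esub> ?\<pi> q" and mult: "?\<pi> (p * q) = ?\<pi> p \<otimes>\<^bsub>?B\<^esub> ?\<pi> q" for p q
    using B_alg_projection(1)[of P Q d e] by (auto simp: ring_hom_def poly4_ring_simps)
  have cl: "?\<pi> (p + q) \<in> ?G" "?\<pi> (p * q) \<in> ?G" if "?\<pi> p \<in> ?G" "?\<pi> q \<in> ?G" for p q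
    unfolding add mult using that by (auto intro: generate_ring.intros)
  have gens: "?\<pi> X4 \<in> ?G" "?\<pi> [:[:[:0, 1:]:]:] \<in> ?G" "?\<pi> Y4 \<in> ?G" "?\<pi> T4 \<in> ?G"
    by (auto intro: generate_ring.incl)
  have const: "?\<pi> [:[:[:[:c:]:]:]:] \<in> ?G" for c
    unfolding B_alg_simps(6)[symmetric] by (rule generate_ring.incl) blast
  have 1: "?\<pi> [:[:[:p:]:]:] \<in> ?G" for p
  proof (induction p)
    case 0
    show ?case using const[of 0] by simp
  next
    case (pCons c p)
    have "[:[:[:pCons c p:]:]:] = [:[:[:[:c:]:]:]:] + X4 * [:[:[:p:]:]:]" by (simp add: X4_def)
    then show ?case using cl[OF const cl(2)[OF gens(1) pCons(2)]] by metis
  qed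
  have 2: "?\<pi> [:[:p:]:] \<in> ?G" for p
  proof (induction p)
    case 0
    show ?case using const[of 0] by simp
  next
    case (pCons c p)
    have "[:[:pCons c p:]:] = [:[:[:c:]:]:] + [:[:[:0, 1:]:]:] * [:[:p:]:]" by simp
    then show ?case using cl[OF 1 cl(2)[OF gens(2) pCons(2)]] by metis
  qed
  have 3: "?\<pi> [:p:] \<in> ?G" for p
  proof (induction p)
    case 0
    show ?case using const[of 0] by simp
  next
    case (pCons c p)
    have "[:pCons c p:] = [:[:c:]:] + Y4 * [:p:]" by (simp add: Y4_def)
    then show ?case using cl[OF 2 cl(2)[OF gens(3) pCons(2)]] by metis
  qed
  have 4: "?\<pi> p \<in> ?G" for p
  proof (induction p)
    case 0
    show ?case using const[of 0] by simp
  next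
    case (pCons c p)
    have "pCons c p = [:c:] + T4 * p" by (simp add: T4_def)
    then show ?case using cl[OF 3 cl(2)[OF gens(4) pCons(2)]] by metis
  qed
  show "?G = carrier ?B"
  proof
    show "?G \<subseteq> carrier ?B"
      by (rule B.generate_ring_incl) (use sub B_alg_scal_mem in blast)
    show "carrier ?B \<subseteq> ?G" unfolding B_alg_projection(2)[symmetric] using 4 by blast
  qed
qed

text \<open>First isomorphism theorem; on a coset of the kernel \<open>the_elem\<close> reads off
  the common value of h.\<close>

lemma B_alg_iso_range:
  fixes h :: "'k::field poly poly poly poly \<Rightarrow> 'a::comm_ring_1"
  assumes h: "ring_morphism h" and ker: "\<And>p. h p = 0 \<longleftrightarrow> p \<in> B_ideal P Q d e"
  shows "B_alg P Q d e \<cong>\<^sub>k subalg (\<lambda>c. h [:[:[:[:c:]:]:]:]) (range h)"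
proof -
  let ?R = "ring_of_type_algebra :: 'k poly poly poly poly ring"
  let ?A = "subalg (\<lambda>c. h [:[:[:[:c:]:]:]:]) (range h)"
  have "h \<in> ring_hom ?R ?A"
    by (rule ring_hom_memI) (simp_all add: poly4_ring_simps ring_morphism_simps[OF h])
  then have hr: "ring_hom_ring ?R ?A h"
    by (rule ring_hom_ringI2[OF cring.axioms(1)[OF cring_from_type_algebra]
        cring.axioms(1)[OF cring_subalg[OF unital_subring_range[OF h]]]])
  have k: "a_kernel ?R ?A h = B_ideal P Q d e"
    by (auto simp: a_kernel_def' poly4_ring_simps ker)
  have "(\<lambda>U. the_elem (h ` U)) \<in> ring_iso (?R Quot B_ideal P Q d e) ?A"
    using ring_hom_ring.FactRing_iso_set[OF hr] unfolding k by (simp add: poly4_ring_simps)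
  then have "(\<lambda>U. the_elem (h ` U)) \<in> ring_iso (B_alg P Q d e) ?A"
    by (simp add: ring_iso_def ring_hom_def B_alg_simps)
  moreover have "the_elem (h ` (B_ideal P Q d e +>\<^bsub>?R\<^esub> p)) = h p" for p
  proof -
    have "h ` (B_ideal P Q d e +>\<^bsub>?R\<^esub> p) = {h p}"
      unfolding a_r_coset_def' poly4_ring_simps
      using ker[of 0] ker by (auto simp: ring_morphism_simps[OF h] image_iff intro!: bexI[of _ 0])
    then show ?thesis by simp
  qed
  ultimately show ?thesis unfolding alg_iso_def
    by (intro bexI[of _ "\<lambda>U. the_elem (h ` U)"]) (simp_all add: B_alg_simps(6))
qed

section \<open>The stable isomorphism\<close>

text \<open>Taylor expansion to second order without dividing by 2. The remainder is required to lie
  in S because its use is divisibility inside S.\<close>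

lemma peval_taylor:
  assumes S: "unital_subring S" and f: "ring_morphism f" "\<And>c. f c \<in> S" and ab: "a \<in> S" "b \<in> S"
  shows "\<exists>c\<in>S. peval f p (a + b) = peval f p a + b * peval f (pderiv p) a + b ^ 2 * c"
proof (induction p)
  interpret unital_subring S by (rule S)
  case 0
  show ?case by (intro bexI[of _ 0]) simp_all
next
  interpret unital_subring S by (rule S)
  case (pCons c p)
  then obtain s where s: "s \<in> S" "peval f p (a + b) = peval f p a + b * peval f (pderiv p) a + b ^ 2 * s"
    by blast
  have mem: "peval f q a \<in> S" for q by (rule peval_mem[OF S f ab(1)])
  have dv: "peval f (pderiv (pCons c p)) a = peval f p a + a * peval f (pderiv p) a"
    by (simp add: pderiv_pCons ring_morphism_add[OF ring_morphism_peval[OF f(1)]] peval_pCons f(1)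
        ring_morphism_0[OF f(1)])
  show ?case
  proof (rule bexI)
    show "peval f (pCons c p) (a + b) = peval f (pCons c p) a + b * peval f (pderiv (pCons c p)) a
        + b ^ 2 * (peval f (pderiv p) a + (a + b) * s)"
      by (simp only: peval_pCons[OF f(1)] dv s(2)) (simp add: algebra_simps power2_eq_square)
    show "peval f (pderiv p) a + (a + b) * s \<in> S" using mem s(1) ab by simp
  qed
qed

locale evaluation = unital_subring S for S :: "'a::idom set" +
  fixes \<kappa> :: "'k::field \<Rightarrow> 'a" and x :: 'a
  assumes \<kappa>: "ring_morphism \<kappa>" and \<kappa>_mem [simp]: "\<kappa> c \<in> S" and x_mem [simp]: "x \<in> S" and x_nz: "x \<noteq> 0"
begin

lemma eval2_mem [simp]: "z \<in> S \<Longrightarrow> eval2 \<kappa> x z p \<in> S"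
  and eval3_mem [simp]: "z \<in> S \<Longrightarrow> y \<in> S \<Longrightarrow> eval3 \<kappa> x z y q \<in> S"
  using eval_mem(2,3)[OF \<kappa> unital_subring_axioms] by auto

lemma eval1_mem [simp]: "eval1 \<kappa> x p \<in> S"
  using eval_mem(1)[OF \<kappa> unital_subring_axioms] by auto

lemma eval2_taylor:
  "z \<in> S \<Longrightarrow> b \<in> S \<Longrightarrow>
    \<exists>c\<in>S. eval2 \<kappa> x (z + b) p = eval2 \<kappa> x z p + b * eval2 \<kappa> x z (pderiv p) + b ^ 2 * c"
  unfolding eval2_def
  by (rule peval_taylor[OF unital_subring_axioms eval_morphism(1)[OF \<kappa>]]) simp_all

lemma eval3_taylor:
  "z \<in> S \<Longrightarrow> y \<in> S \<Longrightarrow> b \<in> S \<Longrightarrow>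
    \<exists>c\<in>S. eval3 \<kappa> x z (y + b) q = eval3 \<kappa> x z y q + b * eval3 \<kappa> x z y (pderiv q) + b ^ 2 * c"
  unfolding eval3_def
  by (rule peval_taylor[OF unital_subring_axioms eval_morphism(2)[OF \<kappa>]]) simp_all

lemma eval3_shift_z:
  assumes "z \<in> S" "y \<in> S" "b \<in> S"
  shows "\<exists>c\<in>S. eval3 \<kappa> x (z + b) y q = eval3 \<kappa> x z y q + b * c"
proof (induction q)
  case 0
  show ?case by (intro bexI[of _ 0]) (simp_all add: eval_0 \<kappa>)
next
  case (pCons p q)
  then obtain s where s: "s \<in> S" "eval3 \<kappa> x (z + b) y q = eval3 \<kappa> x z y q + b * s" by blast
  obtain c where c: "c \<in> S"
    "eval2 \<kappa> x (z + b) p = eval2 \<kappa> x z p + b * eval2 \<kappa> x z (pderiv p) + b ^ 2 * c"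
    using eval2_taylor[of z b p] assms by blast
  show ?case
  proof (rule bexI)
    show "eval3 \<kappa> x (z + b) y (pCons p q) = eval3 \<kappa> x z y (pCons p q)
        + b * (eval2 \<kappa> x z (pderiv p) + b * c + y * s)"
      by (simp only: eval_pCons[OF \<kappa>] c(2) s(2)) (simp add: algebra_simps power2_eq_square)
  qed (use assms c s in simp)
qed

lemma eval3_shift:
  assumes "z \<in> S" "y \<in> S" "b \<in> S" "c \<in> S"
  shows "\<exists>v\<in>S. eval3 \<kappa> x (z + x * b) (y + x * c) q = eval3 \<kappa> x z y q + x * v"
proof -
  obtain v1 where v1: "v1 \<in> S"
    "eval3 \<kappa> x (z + x * b) (y + x * c) q = eval3 \<kappa> x z (y + x * c) q + (x * b) * v1"
    using eval3_shift_z[of z "y + x * c" "x * b" q] assms by auto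
  obtain v2 where v2: "v2 \<in> S"
    "eval3 \<kappa> x z (y + x * c) q = eval3 \<kappa> x z y q + (x * c) * eval3 \<kappa> x z y (pderiv q) + (x * c) ^ 2 * v2"
    using eval3_taylor[of z y "x * c" q] assms by auto
  show ?thesis
  proof (rule bexI)
    show "eval3 \<kappa> x (z + x * b) (y + x * c) q
        = eval3 \<kappa> x z y q + x * (b * v1 + c * eval3 \<kappa> x z y (pderiv q) + x * c ^ 2 * v2)"
      unfolding v1(2) v2(2) by (simp add: algebra_simps power2_eq_square)
  qed (use assms v1(1) v2(1) in simp)
qed

text \<open>Shifting z by x^(d+e) \<beta> changes P by x^(d+e) \<beta> P' up to higher order, hence
  y = P/x^d by x^e \<beta> P' and Q by x^e \<beta> P' Q', both modulo x^(e+1). The exponent d + e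
  thus lets t = Q/x^e move by \<beta> P' Q' modulo x.\<close>

lemma danielewski_shift:
  assumes mem: "z \<in> S" "y \<in> S" "\<beta> \<in> S" and de: "d > 0" "e > 0"
    and y: "x ^ d * y = eval2 \<kappa> x z P" and y': "x ^ d * y' = eval2 \<kappa> x (z + x ^ (d + e) * \<beta>) P"
  obtains \<eta> \<zeta> where "\<eta> \<in> S" "\<zeta> \<in> S" "y' = y + x ^ e * \<eta>"
    "eval3 \<kappa> x (z + x ^ (d + e) * \<beta>) y' Q = eval3 \<kappa> x z y Q
      + x ^ e * (\<beta> * eval2 \<kappa> x z (pderiv P) * eval3 \<kappa> x z y (pderiv Q) + x * \<zeta>)"
proof -
  let ?n = "d + e" and ?P' = "eval2 \<kappa> x z (pderiv P)" and ?Q' = "eval3 \<kappa> x z y (pderiv Q)"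
  obtain d' e' where de': "d = Suc d'" "e = Suc e'" using de by (metis gr0_implies_Suc)
  obtain c where c: "c \<in> S"
    "eval2 \<kappa> x (z + x ^ ?n * \<beta>) P = eval2 \<kappa> x z P + (x ^ ?n * \<beta>) * ?P' + (x ^ ?n * \<beta>) ^ 2 * c"
    using eval2_taylor[of z "x ^ ?n * \<beta>" P] mem by auto
  \<comment> \<open>The quadratic remainder has a factor x^(2(d+e)); dividing it by x^d for y, by
    x^e for the factor in front of \<eta> and by one more x leaves the exponent d + e - 1.\<close>
  define \<xi> where "\<xi> = x ^ (d' + e) * \<beta> ^ 2 * c"
  define \<eta> where "\<eta> = \<beta> * ?P' + x * \<xi>"
  have \<eta>: "\<xi> \<in> S" "\<eta> \<in> S" using mem c(1) by (simp_all add: \<xi>_def \<eta>_def)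
  have "x ^ d * y' = x ^ d * (y + x ^ e * \<eta>)"
    unfolding y' c(2) y[symmetric] \<eta>_def \<xi>_def
    by (simp add: algebra_simps power2_eq_square power_add de')
  then have y'_eq: "y' = y + x ^ e * \<eta>" using x_nz by simp
  obtain c1 where c1: "c1 \<in> S"
    "eval3 \<kappa> x (z + x ^ ?n * \<beta>) y' Q = eval3 \<kappa> x z y' Q + (x ^ ?n * \<beta>) * c1"
    using eval3_shift_z[of z y' "x ^ ?n * \<beta>" Q] mem \<eta> y'_eq by auto
  obtain c2 where c2: "c2 \<in> S"
    "eval3 \<kappa> x z y' Q = eval3 \<kappa> x z y Q + (x ^ e * \<eta>) * ?Q' + (x ^ e * \<eta>) ^ 2 * c2"
    using eval3_taylor[of z y "x ^ e * \<eta>" Q] mem \<eta> unfolding y'_eq by auto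
  \<comment> \<open>The direct effect of the shift of z on Q carries x^(d+e) and the quadratic term
    in \<eta> carries x^(2e); as d and e are positive, each keeps at least one x beyond x^e.\<close>
  define \<zeta> where "\<zeta> = \<xi> * ?Q' + x ^ e' * \<eta> ^ 2 * c2 + x ^ d' * \<beta> * c1"
  have "x * \<zeta> = x * \<xi> * ?Q' + x ^ e * \<eta> ^ 2 * c2 + x ^ d * \<beta> * c1"
    by (simp add: \<zeta>_def de' algebra_simps)
  then have "\<beta> * ?P' * ?Q' + x * \<zeta> = \<eta> * ?Q' + x ^ e * \<eta> ^ 2 * c2 + x ^ d * \<beta> * c1"
    by (simp add: \<eta>_def algebra_simps)
  then have "x ^ e * (\<beta> * ?P' * ?Q' + x * \<zeta>)
      = x ^ e * \<eta> * ?Q' + (x ^ e * \<eta>) ^ 2 * c2 + x ^ ?n * \<beta> * c1"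
    by (simp add: algebra_simps power2_eq_square power_add)
  then have "eval3 \<kappa> x (z + x ^ ?n * \<beta>) y' Q = eval3 \<kappa> x z y Q + x ^ e * (\<beta> * ?P' * ?Q' + x * \<zeta>)"
    unfolding c1(2) c2(2) by simp
  moreover have "\<zeta> \<in> S" using mem \<eta> c1(1) c2(1) by (simp add: \<zeta>_def)
  ultimately show ?thesis using that \<eta> y'_eq by blast
qed

end

text \<open>The inverse of \<open>P' Q'\<close> modulo \<open>x\<close> is one polynomial \<open>u\<close> for all rings, which makes it
  comparable after a change of \<open>z\<close> and \<open>y\<close>.\<close>

lemma inverse_mod_x:
  fixes P :: "'k::field poly poly"
  assumes 1: "ideal_of {P_at_0 P, P_at_0 (pderiv P)} = UNIV"
    and 2: "ideal_of {[:P_at_0 P:], Q_at_0 Q, Q_at_0 (pderiv Q)} = UNIV"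
  obtains u where "\<And>(S :: 'a::idom set) \<kappa> x z y t d e. evaluation S \<kappa> x \<Longrightarrow> z \<in> S \<Longrightarrow> y \<in> S \<Longrightarrow> t \<in> S \<Longrightarrow>
      d > 0 \<Longrightarrow> e > 0 \<Longrightarrow> x ^ d * y = eval2 \<kappa> x z P \<Longrightarrow> x ^ e * t = eval3 \<kappa> x z y Q \<Longrightarrow>
      \<exists>\<xi>\<in>S. eval3 \<kappa> x z y u * (eval2 \<kappa> x z (pderiv P) * eval3 \<kappa> x z y (pderiv Q)) = 1 + x * \<xi>"
proof -
  note s = surj_at_0(1,2)[where ?'a = 'k]
  note m = ring_morphism_simps[OF ring_morphism_at_0(1)] ring_morphism_simps[OF ring_morphism_at_0(2)]
  have "1 \<in> ideal_of {P_at_0 P, P_at_0 (pderiv P)}" unfolding 1 by simp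
  then obtain a0 b0 where "1 = a0 * P_at_0 P + b0 * P_at_0 (pderiv P)" unfolding ideal_of_pair by blast
  moreover obtain a b where "P_at_0 a = a0" "P_at_0 b = b0" using s(1) by (metis surjD)
  ultimately have "P_at_0 (a * P + b * pderiv P - 1) = 0" by (simp add: m)
  then obtain g where g: "a * P + b * pderiv P - 1 = [:[:0, 1:]:] * g"
    using at_0_eq_0(1) by (blast elim: dvdE)
  have "1 \<in> ideal_of {[:P_at_0 P:], Q_at_0 Q, Q_at_0 (pderiv Q)}" unfolding 2 by simp
  then obtain f0 h0 c0 where "1 = f0 * [:P_at_0 P:] + h0 * Q_at_0 Q + c0 * Q_at_0 (pderiv Q)"
    unfolding ideal_of_triple by blast
  moreover obtain f h c where "Q_at_0 f = f0" "Q_at_0 h = h0" "Q_at_0 c = c0" using s(2) by (metis surjD)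
  moreover have "Q_at_0 [:P:] = [:P_at_0 P:]" by (simp add: Q_at_0_def map_poly_pCons m)
  ultimately have "Q_at_0 (f * [:P:] + h * Q + c * pderiv Q - 1) = 0"
    by (simp add: m del: mult_pCons_right mult_pCons_left)
  then obtain k where k: "f * [:P:] + h * Q + c * pderiv Q - 1 = [:[:[:0, 1:]:]:] * k"
    using at_0_eq_0(2) by (blast elim: dvdE)
  show ?thesis
  proof (rule that[of "[:b:] * c"])
    fix S :: "'a set" and \<kappa> x z y t and d e :: nat
    assume "evaluation S \<kappa> x" and mem: "z \<in> S" "y \<in> S" "t \<in> S" and de: "d > 0" "e > 0"
      and y: "x ^ d * y = eval2 \<kappa> x z P" and t: "x ^ e * t = eval3 \<kappa> x z y Q"
    then interpret evaluation S \<kappa> x by simp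
    note e2 = ring_morphism_simps[OF eval_morphism(2)[OF \<kappa>]]
    note e3 = ring_morphism_simps[OF eval_morphism(3)[OF \<kappa>]]
    note ev = eval_pCons[OF \<kappa>] eval_0[OF \<kappa>] ring_morphism_0[OF \<kappa>] ring_morphism_1[OF \<kappa>] eval_1[OF \<kappa>]
    obtain d' e' where de': "d = Suc d'" "e = Suc e'" using de by (metis gr0_implies_Suc)
    have "eval2 \<kappa> x z (a * P + b * pderiv P - 1) = eval2 \<kappa> x z ([:[:0, 1:]:] * g)" unfolding g ..
    \<comment> \<open>The identity holds at X = 0, and P evaluates to x^d y, again a multiple of x.
      The same happens below for Q = x^e t; multiplying the inverses b of P' and c of Q' gives
      u.\<close>
    then have 1: "eval2 \<kappa> x z b * eval2 \<kappa> x z (pderiv P) = 1 + x * (eval2 \<kappa> x z g - eval2 \<kappa> x z a * x ^ d' * y)"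
      by (simp add: e2 ev y[symmetric] de' algebra_simps del: mult_pCons_right mult_pCons_left)
    have "eval3 \<kappa> x z y (f * [:P:] + h * Q + c * pderiv Q - 1) = eval3 \<kappa> x z y ([:[:[:0, 1:]:]:] * k)" unfolding k ..
    then have 2: "eval3 \<kappa> x z y c * eval3 \<kappa> x z y (pderiv Q) = 1 + x * (eval3 \<kappa> x z y k -
        eval3 \<kappa> x z y f * x ^ d' * y - eval3 \<kappa> x z y h * x ^ e' * t)"
      by (simp add: e3 ev y[symmetric] t[symmetric] de' algebra_simps del: mult_pCons_right mult_pCons_left)
    define \<xi>1 where "\<xi>1 = eval2 \<kappa> x z g - eval2 \<kappa> x z a * x ^ d' * y"
    define \<xi>2 where "\<xi>2 = eval3 \<kappa> x z y k - eval3 \<kappa> x z y f * x ^ d' * y - eval3 \<kappa> x z y h * x ^ e' * t"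
    have "eval3 \<kappa> x z y ([:b:] * c) = eval2 \<kappa> x z b * eval3 \<kappa> x z y c"
      by (simp add: e3 ev del: mult_pCons_right mult_pCons_left)
    then have "eval3 \<kappa> x z y ([:b:] * c) * (eval2 \<kappa> x z (pderiv P) * eval3 \<kappa> x z y (pderiv Q))
      = (eval2 \<kappa> x z b * eval2 \<kappa> x z (pderiv P)) * (eval3 \<kappa> x z y c * eval3 \<kappa> x z y (pderiv Q))"
      by (simp add: mult_ac)
    also have "\<dots> = 1 + x * (\<xi>1 + \<xi>2 + x * \<xi>1 * \<xi>2)"
      unfolding 1 2 \<xi>1_def[symmetric] \<xi>2_def[symmetric] by (simp add: algebra_simps)
    finally show "\<exists>\<xi>\<in>S. eval3 \<kappa> x z y ([:b:] * c) * (eval2 \<kappa> x z (pderiv P) * eval3 \<kappa> x z y (pderiv Q)) = 1 + x * \<xi>"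
      by (rule bexI) (use mem in \<open>simp add: \<xi>1_def \<xi>2_def\<close>)
  qed
qed

section \<open>The algebras as subrings of k((x))[z]\<close>

definition kc :: "'k::field \<Rightarrow> 'k fls poly" where "kc c = [:fls_const c:]"
definition xx :: "'k::field fls poly" where "xx = [:fls_X:]"
definition zz :: "'k::field fls poly" where "zz = [:0, 1:]"
definition yy :: "'k::field poly poly \<Rightarrow> nat \<Rightarrow> 'k fls poly" where
  "yy P d = [:fls_X_inv ^ d:] * eval2 kc xx zz P"
definition tt :: "'k::field poly poly \<Rightarrow> 'k poly poly poly \<Rightarrow> nat \<Rightarrow> nat \<Rightarrow> 'k fls poly" where
  "tt P Q d e = [:fls_X_inv ^ e:] * eval3 kc xx zz (yy P d) Q"
definition ev where "ev P Q d e = eval4 kc xx zz (yy P d) (tt P Q d e)"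
definition SS :: "'k::field poly poly \<Rightarrow> 'k poly poly poly \<Rightarrow> nat \<Rightarrow> nat \<Rightarrow> 'k fls poly set" where
  "SS P Q d e = range (ev P Q d e)"

lemma ring_morphism_kc: "ring_morphism kc"
  by (intro ring_morphismI) (simp_all add: kc_def one_pCons fls_plus_const mult.commute)

lemma const_power: "[:c:] ^ n = [:c ^ n :: 'a::comm_ring_1:]"
  by (induction n) (simp_all add: one_pCons)

lemma fls_X_power_inv: "fls_X ^ n * fls_X_inv ^ n = (1 :: 'k::field fls)"
proof -
  have "fls_X * fls_X_inv = (1 :: 'k fls)" by (simp add: fls_X_times_conv_shift)
  then show ?thesis by (metis power_mult_distrib power_one)
qed

lemma xx_power_inv: "xx ^ n * [:fls_X_inv ^ n:] = 1"
  by (simp add: xx_def const_power fls_X_power_inv one_pCons mult.commute)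

lemma xx_nz [simp]: "xx \<noteq> 0" by (simp add: xx_def)

lemma xx_yy: "xx ^ d * yy P d = eval2 kc xx zz P"
  unfolding yy_def mult.assoc[symmetric] xx_power_inv by simp

lemma xx_tt: "xx ^ e * tt P Q d e = eval3 kc xx zz (yy P d) Q"
  unfolding tt_def mult.assoc[symmetric] xx_power_inv by simp

lemma eval1_xx: "eval1 kc xx p = [:fps_to_fls (fps_of_poly p):]"
proof (induction p)
  case (pCons c p)
  then show ?case
    by (simp only: eval_pCons[OF ring_morphism_kc] pCons)
      (simp add: fps_of_poly_pCons kc_def xx_def fls_times_fps_to_fls mult.commute)
qed (simp add: eval_0[OF ring_morphism_kc])

lemma eval2_zz: "eval2 kc xx zz p = map_poly (\<lambda>q. fps_to_fls (fps_of_poly q)) p"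
  by (induction p) (simp_all add: eval_0 eval_pCons ring_morphism_kc map_poly_pCons zz_def eval1_xx)

lemma eval2_zz_inj: "eval2 kc xx zz p = 0 \<Longrightarrow> p = 0"
proof (rule poly_eqI)
  fix n assume "eval2 kc xx zz p = 0"
  then have "coeff (map_poly (\<lambda>q. fps_to_fls (fps_of_poly q)) p) n = 0" by (simp add: eval2_zz)
  then show "coeff p n = coeff 0 n" by (simp add: coeff_map_poly)
qed

lemma ring_morphism_ev: "ring_morphism (ev P Q d e)"
  unfolding ev_def by (rule eval_morphism[OF ring_morphism_kc])

lemma ev_const: "ev P Q d e [:[:[:[:c:]:]:]:] = kc c"
  by (simp add: ev_def eval_pCons eval_0 ring_morphism_kc)

lemma evaluation_SS: "evaluation (SS P Q d e) kc xx"
proof -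
  interpret unital_subring "SS P Q d e" unfolding SS_def by (rule unital_subring_range[OF ring_morphism_ev])
  show ?thesis
  proof
    show "kc c \<in> SS P Q d e" for c unfolding SS_def by (metis rangeI ev_const)
    show "xx \<in> SS P Q d e"
      unfolding SS_def by (metis rangeI ev_def eval_X4_Y4_T4(1)[OF ring_morphism_kc])
  qed (simp_all add: ring_morphism_kc)
qed

lemma gens_SS: "xx \<in> SS P Q d e" "zz \<in> SS P Q d e" "yy P d \<in> SS P Q d e" "tt P Q d e \<in> SS P Q d e" "kc c \<in> SS P Q d e"
  unfolding SS_def by (metis rangeI ev_def ev_const eval_X4_Y4_T4[OF ring_morphism_kc])+

text \<open>To see that a morphism maps \<open>SS\<close> into a subring it is enough to look at the
  constants and the four generators.\<close>

lemma eval4_const_poly: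
  assumes "unital_subring S'" "ring_morphism f" "\<And>c. f (kc c) \<in> S'" "f xx \<in> S'" "f zz \<in> S'"
    "f (yy P d) \<in> S'" "f (tt P Q d e) \<in> S'" "s \<in> SS P Q d e"
  shows "f s \<in> S'"
proof -
  obtain H where "s = ev P Q d e H" using assms(8) by (auto simp: SS_def)
  then have "f s = eval4 (\<lambda>c. f (kc c)) (f xx) (f zz) (f (yy P d)) (f (tt P Q d e)) H"
    unfolding ev_def by (simp add: eval_compose[OF ring_morphism_kc assms(2)])
  also have "\<dots> \<in> S'"
    by (rule eval_mem[OF ring_morphism_comp[OF ring_morphism_kc assms(2)]]) (use assms in auto)
  finally show ?thesis .
qed

lemma unital_subring_polys_over: "unital_subring S \<Longrightarrow> unital_subring (polys_over S)"
proof -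
  assume "unital_subring S"
  then interpret unital_subring S .
  show ?thesis
    by standard (auto simp: polys_over_def coeff_mult coeff_1 intro!: sum_mem)
qed

lemma B_alg_iso_SS:
  assumes "lead_coeff P = 1" "lead_coeff Q = 1" "d > 0" "e > 0"
  shows "B_alg P Q d e \<cong>\<^sub>k subalg kc (SS P Q d e)"
proof -
  have "P_at_0 P \<noteq> 0" using P_at_0_monic(1)[OF assms(1)] by auto
  then have "ev P Q d e p = 0 \<longleftrightarrow> p \<in> B_ideal P Q d e" for p
    unfolding ev_def
    by (intro kernel_eval4) (use assms Q_at_0_monic(1) in
        \<open>auto simp: ring_morphism_kc xx_yy xx_tt eval2_zz_inj\<close>)
  from B_alg_iso_range[OF ring_morphism_ev this] show ?thesis by (simp add: SS_def ev_const)
qed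

lemma poly_alg_B_alg_iso:
  assumes "lead_coeff P = 1" "lead_coeff Q = 1" "d > 0" "e > 0"
  shows "(B_alg P Q d e)\<^sup>[\<^sup>1\<^sup>] \<cong>\<^sub>k subalg (\<lambda>c. [:kc c:]) (polys_over (SS P Q d e))"
proof -
  interpret evaluation "SS P Q d e" kc xx by (rule evaluation_SS)
  show ?thesis
    by (rule poly_alg_iso_polys_over[OF cring_B_alg B_alg_scal_mem unital_subring_axioms B_alg_iso_SS[OF assms]])
qed

section \<open>Substitutions in k((x))[z][w]\<close>

abbreviation (input) lift2 :: "'a::comm_ring_1 \<Rightarrow> 'a poly poly" where "lift2 c \<equiv> [:[:c:]:]"

lemma ring_morphism_lift2: "ring_morphism lift2"
  by (intro ring_morphismI) (simp_all add: one_pCons)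

text \<open>The outer variable of the type \<open>poly poly\<close> is w, the inner one z.
  \<open>subst1 Z\<close> sends z to Z and fixes k((x)); \<open>subst2 Z W\<close> in addition sends
  w to W.\<close>

definition subst1 :: "'a::comm_ring_1 poly poly \<Rightarrow> 'a poly \<Rightarrow> 'a poly poly" where
  "subst1 Z q = peval lift2 q Z"

definition subst2 :: "'a::comm_ring_1 poly poly \<Rightarrow> 'a poly poly \<Rightarrow> 'a poly poly \<Rightarrow> 'a poly poly" where
  "subst2 Z W p = peval (subst1 Z) p W"

lemma subst_morphism: "ring_morphism (subst1 Z)" "ring_morphism (subst2 Z W)"
proof -
  show 1: "ring_morphism (subst1 Z)" unfolding subst1_def[abs_def] by (rule ring_morphism_peval[OF ring_morphism_lift2])
  show "ring_morphism (subst2 Z W)" unfolding subst2_def[abs_def] by (rule ring_morphism_peval[OF 1])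
qed

lemma subst1_simps: "subst1 Z [:c:] = lift2 c" "subst1 Z [:0, 1:] = Z"
  by (simp_all only: subst1_def peval_const[OF ring_morphism_lift2] peval_X[OF ring_morphism_lift2])

lemma subst2_simps: "subst2 Z W [:q:] = subst1 Z q" "subst2 Z W [:0, 1:] = W"
  by (simp_all only: subst2_def peval_const[OF subst_morphism(1)] peval_X[OF subst_morphism(1)])

lemma morphism_eq_on_const:
  assumes f: "ring_morphism f" and 1: "\<And>c. f (lift2 c) = lift2 c" and 2: "f [:[:0, 1:]:] = [:[:0, 1:]:]"
  shows "f [:q:] = [:q:]"
proof (induction q)
  case 0
  then show ?case using ring_morphism_0[OF f] by simp
next
  case (pCons c q)
  have eq: "[:pCons c q:] = lift2 c + [:[:0, 1:]:] * [:q:]" by simp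
  show ?case by (simp only: eq ring_morphism_add[OF f] ring_morphism_mult[OF f] 1 2 pCons(2))
qed

lemma morphism_eq_id:
  assumes f: "ring_morphism f" and 1: "\<And>c. f (lift2 c) = lift2 c" and 2: "f [:[:0, 1:]:] = [:[:0, 1:]:]"
    and 3: "f [:0, 1:] = [:0, 1:]"
  shows "f p = p"
proof (induction p)
  case 0
  then show ?case using ring_morphism_0[OF f] by simp
next
  case (pCons q p)
  have eq: "pCons q p = [:q:] + [:0, 1:] * p" by simp
  show ?case
    by (simp only: eq ring_morphism_add[OF f] ring_morphism_mult[OF f] 3 morphism_eq_on_const[OF f 1 2] pCons(2))
qed

lemma subst2_mem:
  assumes "unital_subring S'" "\<And>s. s \<in> S \<Longrightarrow> subst1 Z s \<in> S'" "W \<in> S'" "p \<in> polys_over S"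
  shows "subst2 Z W p \<in> S'"
proof -
  interpret unital_subring S' by fact
  show ?thesis using assms(4)
  proof (induction p)
    case 0
    then show ?case by (simp add: subst2_def)
  next
    case (pCons q p)
    have "q \<in> S" "p \<in> polys_over S"
      using pCons(3) by (auto simp: polys_over_def coeff_pCons split: nat.splits)
    then show ?case using pCons(2) assms(2,3)
      by (simp add: subst2_def peval_pCons[OF subst_morphism(1)])
  qed
qed

theorem stably_isomorphic:
  fixes P :: "'k::field poly poly"
  assumes hyp: "ideal_of {P_at_0 P, P_at_0 (pderiv P)} = UNIV"
    "ideal_of {[:P_at_0 P:], Q_at_0 Q, Q_at_0 (pderiv Q)} = UNIV" and de: "d > 0" "e > 0"
  shows "subalg (\<lambda>c. [:kc c:]) (polys_over (SS P Q d e))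
    \<cong>\<^sub>k subalg (\<lambda>c. [:kc c:]) (polys_over (SS P Q d (e + 1)))"
proof -
  obtain u where u: "\<And>(S :: 'k fls poly poly set) \<kappa> x z y t d e. evaluation S \<kappa> x \<Longrightarrow> z \<in> S \<Longrightarrow> y \<in> S \<Longrightarrow> t \<in> S \<Longrightarrow>
      d > 0 \<Longrightarrow> e > 0 \<Longrightarrow> x ^ d * y = eval2 \<kappa> x z P \<Longrightarrow> x ^ e * t = eval3 \<kappa> x z y Q \<Longrightarrow>
      \<exists>\<xi>\<in>S. eval3 \<kappa> x z y u * (eval2 \<kappa> x z (pderiv P) * eval3 \<kappa> x z y (pderiv Q)) = 1 + x * \<xi>"
    using inverse_mod_x[OF hyp] by blast
  define e1 where "e1 = e + 1"
  define n where "n = d + e"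
  define t0 where "t0 = tt P Q d e"
  define t1 where "t1 = tt P Q d e1"
  define y0 where "y0 = yy P d"
  define T0 where "T0 = [:t0:]"
  define T1 where "T1 = [:t1:]"
  \<comment> \<open>The polynomial u evaluates to an inverse of P' Q' modulo x, so t + \<alpha> P'
    Q' is congruent to t - t = 0.\<close>
  define \<alpha> where "\<alpha> = - t0 * eval3 kc xx zz y0 u"
  define a where "a = zz + xx ^ n * \<alpha>"
  define \<kappa> where "\<kappa> = (\<lambda>c :: 'k. [:kc c:])"
  define Xc where "Xc = [:xx :: 'k fls poly:]"
  define Z where "Z = [:zz :: 'k fls poly:]"
  define W where "W = [:0, 1 :: 'k fls poly:]"
  define Y where "Y = [:y0:]"
  define U where "U = eval3 \<kappa> Xc Z Y u"
  define P' where "P' = eval2 \<kappa> Xc Z (pderiv P)"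
  define Q' where "Q' = eval3 \<kappa> Xc Z Y (pderiv Q)"
  note c = ring_morphism_const[where ?'a = "'k fls poly"]
  note c_simps = ring_morphism_simps[OF c]
  note c_eval = eval_compose[OF ring_morphism_kc c, folded \<kappa>_def]
  have Xnz: "Xc \<noteq> 0" by (simp add: Xc_def)
  have cancel: "p = q" if "Xc ^ m * p = Xc ^ m * q" for p q m using that Xnz by simp
  have XY: "Xc ^ d * Y = eval2 \<kappa> Xc Z P"
    using arg_cong[OF xx_yy[of d P], of "\<lambda>c. [:c:]"] unfolding c_eval by (simp only: Xc_def Y_def Z_def y0_def c_simps)
  have XT: "Xc ^ e' * [:tt P Q d e':] = eval3 \<kappa> Xc Z Y Q" for e'
    using arg_cong[OF xx_tt[of e' P Q d], of "\<lambda>c. [:c:]"] unfolding c_eval by (simp only: Xc_def Y_def Z_def y0_def c_simps)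
  have cA: "[:a:] = Z + Xc ^ n * [:\<alpha>:]" by (simp only: a_def c_simps Z_def Xc_def)
  have c\<alpha>: "[:\<alpha>:] = - T0 * U" by (simp only: \<alpha>_def c_simps c_eval U_def Y_def Xc_def Z_def T0_def)
  define S where "S = (\<lambda>e'. polys_over (SS P Q d e'))"
  have const_S: "[:s:] \<in> S e'" if "s \<in> SS P Q d e'" for s e'
  proof -
    interpret evaluation "SS P Q d e'" kc xx by (rule evaluation_SS)
    show ?thesis using that by (auto simp: S_def polys_over_def coeff_pCons split: nat.splits)
  qed
  have ev_S: "evaluation (S e') \<kappa> Xc" for e'
  proof -
    interpret evaluation "SS P Q d e'" kc xx by (rule evaluation_SS)
    interpret S: unital_subring "S e'" unfolding S_def
      by (rule unital_subring_polys_over) (rule unital_subring_axioms)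
    show ?thesis
      by standard (auto simp: \<kappa>_def Xc_def intro!: const_S ring_morphism_comp[OF ring_morphism_kc c])
  qed
  have memS: "Z \<in> S e'" "Y \<in> S e'" "W \<in> S e'" "[:tt P Q d e':] \<in> S e'" for e'
  proof -
    interpret evaluation "SS P Q d e'" kc xx by (rule evaluation_SS)
    show "W \<in> S e'" by (auto simp: W_def S_def polys_over_def coeff_pCons split: nat.splits)
  qed (auto simp: Z_def Y_def y0_def intro!: const_S gens_SS)
  have invX: "\<exists>\<xi>\<in>S e'. U * (P' * Q') = 1 + Xc * \<xi>" if "e' > 0" for e'
    unfolding U_def P'_def Q'_def by (rule u[OF ev_S _ _ _ de(1) that XY XT]) (simp_all add: memS)
  have subst1_eval: "subst1 V (kc c) = \<kappa> c" "subst1 V xx = Xc" "subst1 V zz = V" for V c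
    by (simp_all add: kc_def xx_def zz_def subst1_simps \<kappa>_def Xc_def)
  have subst1_y: "Xc ^ d * subst1 V y0 = eval2 \<kappa> Xc V P" for V
    using arg_cong[OF xx_yy[of d P], of "subst1 V"]
    by (simp add: y0_def eval_compose[OF ring_morphism_kc subst_morphism(1)] subst1_eval
        ring_morphism_simps[OF subst_morphism(1)])
  have subst1_t: "Xc ^ e' * subst1 V (tt P Q d e') = eval3 \<kappa> Xc V (subst1 V y0) Q" for V e'
    using arg_cong[OF xx_tt[of e' P Q d], of "subst1 V"]
    by (simp add: y0_def eval_compose[OF ring_morphism_kc subst_morphism(1)] subst1_eval
        ring_morphism_simps[OF subst_morphism(1)])
  have subst1_u: "subst1 V (eval3 kc xx zz y0 u) = eval3 \<kappa> Xc V (subst1 V y0) u" for V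
    by (simp add: eval_compose[OF ring_morphism_kc subst_morphism(1)] subst1_eval)

  define Z1 where "Z1 = Z + Xc ^ n * W"
  \<comment> \<open>Forced by the inverse: since z is to be the image of a + x^(n+1) w under \<Phi>,
    the image of w has to be (z - \<Phi>(a)) / x^(n+1). What remains is that this quotient lies in
    the ring and not only in k((x))[z,w].\<close>
  define W1 where "W1 = [:[:fls_X_inv ^ (n + 1):]:] * (Z - subst1 Z1 a)"
  define \<Phi> where "\<Phi> = subst2 Z1 W1"
  have Xinv: "Xc ^ m * [:[:fls_X_inv ^ m:]:] = 1" for m
    using arg_cong[OF xx_power_inv[of m], of "\<lambda>c. [:c :: 'k fls poly:]"] by (simp only: c_simps Xc_def)
  have XW1: "Xc ^ (n + 1) * W1 = Z - subst1 Z1 a"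
    unfolding W1_def mult.assoc[symmetric] Xinv by simp
  have \<Phi>_mem: "\<Phi> p \<in> S e1" if p: "p \<in> S e" for p
  proof -
    interpret evaluation "S e1" \<kappa> Xc by (rule ev_S)
    note mem = memS[of e1, folded t1_def, folded T1_def]
    obtain \<eta> \<zeta> where \<eta>: "\<eta> \<in> S e1" "\<zeta> \<in> S e1" "subst1 Z1 y0 = Y + Xc ^ e * \<eta>"
      "eval3 \<kappa> Xc Z1 (subst1 Z1 y0) Q = eval3 \<kappa> Xc Z Y Q + Xc ^ e * (W * P' * Q' + Xc * \<zeta>)"
      using danielewski_shift[OF mem(1,2,3) de XY, of "subst1 Z1 y0" Q] subst1_y[of Z1]
      unfolding Z1_def n_def P'_def Q'_def by metis
    \<comment> \<open>In the target Q equals x^(e+1) t1, so after division by x^e the old term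
      contributes only x t1, and \<Phi>(t0) is congruent to w P' Q' modulo x.\<close>
    have "Xc ^ e * subst1 Z1 t0 = Xc ^ e * (Xc * T1 + (W * P' * Q' + Xc * \<zeta>))"
      unfolding t0_def subst1_t \<eta>(4) XT[of e1, symmetric] T1_def t1_def
      by (simp only: algebra_simps power_add power_one_right e1_def)
    from cancel[OF this] have t: "subst1 Z1 t0 = Xc * (T1 + \<zeta>) + W * P' * Q'"
      by (simp only: algebra_simps)
    obtain e' where e': "e = Suc e'" using de(2) by (metis gr0_implies_Suc)
    have eqs: "Z1 = Z + Xc * (Xc ^ (d + e') * W)" "subst1 Z1 y0 = Y + Xc * (Xc ^ e' * \<eta>)"
      unfolding \<eta>(3) by (simp_all only: Z1_def n_def e' power_Suc add_Suc_right mult.assoc)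
    obtain v where v: "v \<in> S e1" "eval3 \<kappa> Xc Z1 (subst1 Z1 y0) u = U + Xc * v"
      using eval3_shift[OF mem(1,2), of "Xc ^ (d + e') * W" "Xc ^ e' * \<eta>" u, folded eqs U_def] mem \<eta>(1)
      by auto
    obtain \<xi> where \<xi>: "\<xi> \<in> S e1" "U * (P' * Q') = 1 + Xc * \<xi>" using invX[of e1] e1_def by auto
    \<comment> \<open>Modulo x, \<Phi>(\<alpha>) = - \<Phi>(t0) \<Phi>(u) is - w P' Q' U = - w. So w
      + \<Phi>(\<alpha>) is divisible by x, which supplies the last of the n + 1 factors needed for
      W1.\<close>
    define \<omega> where "\<omega> = - W * \<xi> - W * P' * Q' * v - (T1 + \<zeta>) * (U + Xc * v)"
    have "W + subst1 Z1 \<alpha> = W - subst1 Z1 t0 * (U + Xc * v)"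
      unfolding \<alpha>_def by (simp add: ring_morphism_simps[OF subst_morphism(1)] subst1_u v(2))
    also have "\<dots> = W - W * (U * (P' * Q')) - Xc * (W * P' * Q' * v + (T1 + \<zeta>) * (U + Xc * v))"
      unfolding t by (simp add: algebra_simps)
    also have "\<dots> = Xc * \<omega>" unfolding \<xi>(2) \<omega>_def by (simp add: algebra_simps)
    finally have \<omega>: "W + subst1 Z1 \<alpha> = Xc * \<omega>" .
    have "Xc ^ (n + 1) * W1 = Z - (Z1 + Xc ^ n * subst1 Z1 \<alpha>)"
      unfolding XW1 a_def by (simp add: ring_morphism_simps[OF subst_morphism(1)] subst1_eval)
    also have "\<dots> = - (Xc ^ n * (W + subst1 Z1 \<alpha>))" by (simp add: Z1_def algebra_simps)
    also have "\<dots> = Xc ^ (n + 1) * (- \<omega>)" unfolding \<omega> by (simp add: algebra_simps)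
    finally have W1: "W1 = - \<omega>" by (rule cancel)
    have memUPQ: "U \<in> S e1" "P' \<in> S e1" "Q' \<in> S e1"
      using mem by (simp_all add: U_def P'_def Q'_def)
    have "W1 \<in> S e1" unfolding W1 \<omega>_def using mem memUPQ \<eta>(1,2) v(1) \<xi>(1) by simp
    moreover have "subst1 Z1 s \<in> S e1" if "s \<in> SS P Q d e" for s
    proof (rule eval4_const_poly[OF unital_subring_axioms subst_morphism(1) _ _ _ _ _ that])
      show "subst1 Z1 (yy P d) \<in> S e1"
        unfolding y0_def[symmetric] \<eta>(3) using mem \<eta>(1) by simp
      show "subst1 Z1 (tt P Q d e) \<in> S e1"
        unfolding t0_def[symmetric] t using mem memUPQ \<eta>(2) by simp
      show "subst1 Z1 zz \<in> S e1" unfolding subst1_eval Z1_def using mem by simp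
    qed (simp_all add: subst1_eval)
    ultimately show ?thesis unfolding \<Phi>_def using p
      by (intro subst2_mem[OF unital_subring_axioms]) (auto simp: S_def)
  qed

  \<comment> \<open>Chosen so that z + x^n \<beta> = a + x^(n+1) w. Sending w to - \<beta> then
    takes z + x^n w back to z.\<close>
  define \<beta> where "\<beta> = [:\<alpha>:] + Xc * W"
  define Z2 where "Z2 = Z + Xc ^ n * \<beta>"
  define \<Psi> where "\<Psi> = subst2 Z2 (- \<beta>)"
  have \<Psi>_mem: "\<Psi> p \<in> S e" if p: "p \<in> S e1" for p
  proof -
    interpret evaluation "S e" \<kappa> Xc by (rule ev_S)
    note mem = memS[of e, folded t0_def, folded T0_def]
    have memUPQ: "U \<in> S e" "P' \<in> S e" "Q' \<in> S e"
      using mem by (simp_all add: U_def P'_def Q'_def)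
    have \<beta>: "\<beta> \<in> S e" unfolding \<beta>_def c\<alpha> using mem memUPQ by simp
    obtain \<eta> \<zeta> where \<eta>: "\<eta> \<in> S e" "\<zeta> \<in> S e" "subst1 Z2 y0 = Y + Xc ^ e * \<eta>"
      "eval3 \<kappa> Xc Z2 (subst1 Z2 y0) Q = eval3 \<kappa> Xc Z Y Q + Xc ^ e * (\<beta> * P' * Q' + Xc * \<zeta>)"
      using danielewski_shift[OF mem(1,2) \<beta> de XY, of "subst1 Z2 y0" Q] subst1_y[of Z2]
      unfolding Z2_def n_def P'_def Q'_def by metis
    obtain \<xi> where \<xi>: "\<xi> \<in> S e" "U * (P' * Q') = 1 + Xc * \<xi>" using invX[of e] de by auto
    \<comment> \<open>Modulo x, \<beta> is \<alpha> = - T0 U, so T0 + \<beta> P' Q' is T0 (1 - U P'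
      Q') = 0; this extra factor x is what raises the exponent from e to e + 1.\<close>
    define \<omega> where "\<omega> = W * P' * Q' + \<zeta> - T0 * \<xi>"
    have "T0 + (\<beta> * P' * Q' + Xc * \<zeta>) = T0 - T0 * (U * (P' * Q')) + Xc * (W * P' * Q' + \<zeta>)"
      unfolding \<beta>_def c\<alpha> by (simp add: algebra_simps)
    also have "\<dots> = Xc * \<omega>" unfolding \<xi>(2) \<omega>_def by (simp add: algebra_simps)
    finally have \<omega>: "T0 + (\<beta> * P' * Q' + Xc * \<zeta>) = Xc * \<omega>" .
    have "Xc ^ e1 * subst1 Z2 t1 = Xc ^ e * (T0 + (\<beta> * P' * Q' + Xc * \<zeta>))"
      unfolding t1_def subst1_t \<eta>(4) XT[of e, symmetric] T0_def t0_def by (simp only: algebra_simps)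
    then have "Xc ^ e1 * subst1 Z2 t1 = Xc ^ e1 * \<omega>" unfolding \<omega> e1_def by (simp add: mult_ac)
    then have t: "subst1 Z2 t1 = \<omega>" by (rule cancel)
    have "subst1 Z2 s \<in> S e" if "s \<in> SS P Q d e1" for s
    proof (rule eval4_const_poly[OF unital_subring_axioms subst_morphism(1) _ _ _ _ _ that])
      show "subst1 Z2 (yy P d) \<in> S e"
        unfolding y0_def[symmetric] \<eta>(3) using mem \<eta>(1) by simp
      show "subst1 Z2 (tt P Q d e1) \<in> S e"
        unfolding t1_def[symmetric] t \<omega>_def using mem memUPQ \<eta>(2) \<xi>(1) by simp
      show "subst1 Z2 zz \<in> S e" unfolding subst1_eval Z2_def using mem \<beta> by simp
    qed (simp_all add: subst1_eval)
    moreover have "- \<beta> \<in> S e" using \<beta> by simp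
    ultimately show ?thesis unfolding \<Psi>_def using p
      by (intro subst2_mem[OF unital_subring_axioms]) (auto simp: S_def)
  qed

  have m\<Phi>: "ring_morphism \<Phi>" and m\<Psi>: "ring_morphism \<Psi>" by (simp_all add: \<Phi>_def \<Psi>_def subst_morphism)
  note s\<Phi> = ring_morphism_simps[OF m\<Phi>] and s\<Psi> = ring_morphism_simps[OF m\<Psi>]
  have X2: "Xc = [:[:fls_X:]:]" by (simp add: Xc_def xx_def)
  have Z2': "Z = [:[:0, 1:]:]" by (simp add: Z_def zz_def)
  have \<Phi>g: "\<Phi> [:[:c:]:] = [:[:c:]:]" "\<Phi> Z = Z1" "\<Phi> W = W1" "\<Phi> Xc = Xc" "\<Phi> [:q:] = subst1 Z1 q" for c q
    unfolding \<Phi>_def Z2' W_def X2 subst2_simps by (rule subst1_simps refl)+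
  have \<Psi>g: "\<Psi> [:[:c:]:] = [:[:c:]:]" "\<Psi> Z = Z2" "\<Psi> W = - \<beta>" "\<Psi> Xc = Xc" for c
    unfolding \<Psi>_def Z2' W_def X2 subst2_simps by (rule subst1_simps refl)+
  have Z2a: "Z2 = [:a:] + Xc ^ (n + 1) * W" unfolding cA Z2_def \<beta>_def by (simp only: algebra_simps power_add power_one_right)
  have \<Phi>Z2: "\<Phi> Z2 = Z"
    unfolding Z2a s\<Phi> \<Phi>g XW1 by simp
  have "Xc ^ n * \<beta> = Z2 - Z" by (simp add: Z2_def)
  then have "\<Phi> (Xc ^ n * \<beta>) = \<Phi> (Z2 - Z)" by simp
  then have "Xc ^ n * \<Phi> (- \<beta>) = Xc ^ n * W" unfolding s\<Phi> \<Phi>g \<Phi>Z2 by (simp add: Z1_def algebra_simps)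
  then have \<Phi>\<beta>: "\<Phi> (- \<beta>) = W" by (rule cancel)
  have \<Phi>\<Psi>: "\<Phi> (\<Psi> p) = p" for p
    by (rule morphism_eq_id[OF ring_morphism_comp[OF m\<Psi> m\<Phi>]])
      (simp_all only: \<Psi>g \<Phi>g(1-4) Z2'[symmetric] W_def[symmetric] \<Phi>Z2 \<Phi>\<beta>)
  have \<Psi>Z1: "\<Psi> Z1 = Z" unfolding Z1_def s\<Psi> \<Psi>g by (simp add: Z2_def)
  have \<Psi>\<Phi>c: "\<Psi> (\<Phi> [:q:]) = [:q:]" for q
    by (rule morphism_eq_on_const[OF ring_morphism_comp[OF m\<Phi> m\<Psi>]])
      (simp_all only: \<Psi>g \<Phi>g(1-4) Z2'[symmetric] \<Psi>Z1)
  have "Xc ^ (n + 1) * \<Psi> W1 = \<Psi> (Z - \<Phi> [:a:])" unfolding \<Phi>g XW1[symmetric] s\<Psi> \<Psi>g ..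
  also have "\<dots> = Xc ^ (n + 1) * W" unfolding s\<Psi> \<Psi>\<Phi>c \<Psi>g Z2a by simp
  finally have \<Psi>W1: "\<Psi> W1 = W" by (rule cancel)
  have \<Psi>\<Phi>: "\<Psi> (\<Phi> p) = p" for p
    by (rule morphism_eq_id[OF ring_morphism_comp[OF m\<Phi> m\<Psi>]])
      (simp_all only: \<Psi>g \<Phi>g(1-4) Z2'[symmetric] W_def[symmetric] \<Psi>Z1 \<Psi>W1)

  have "\<Phi> \<in> ring_iso (subalg (\<lambda>c. [:kc c:]) (S e)) (subalg (\<lambda>c. [:kc c:]) (S e1))"
  proof (rule ring_iso_memI)
    show "bij_betw \<Phi> (carrier (subalg (\<lambda>c. [:kc c:]) (S e))) (carrier (subalg (\<lambda>c. [:kc c:]) (S e1)))"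
      by (rule bij_betw_byWitness[where f' = \<Psi>]) (auto simp: \<Phi>\<Psi> \<Psi>\<Phi> \<Phi>_mem \<Psi>_mem)
  qed (simp_all add: \<Phi>_mem s\<Phi>)
  moreover have "\<Phi> [:kc c:] = [:kc c:]" for c by (simp only: kc_def \<Phi>g(1))
  ultimately show ?thesis unfolding alg_iso_def S_def e1_def[symmetric] by auto
qed

section \<open>Weights and leading forms\<close>

unbundle fps_syntax

section \<open>The order in x, its leading coefficient in k[z] and the lexicographic weight\<close>

definition fls_lift :: "'k::field fls \<Rightarrow> 'k poly fls" where
  "fls_lift c = Abs_fls (\<lambda>n. [:c $$ n:])"

lemma fls_lift_nth [simp]: "fls_lift c $$ n = [:c $$ n:]"
  unfolding fls_lift_def by (rule nth_Abs_fls_lower_bound[of "fls_subdegree c"]) simp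

lemma fls_lift_subdegree: "fls_subdegree (fls_lift c) = fls_subdegree c"
proof (cases "c = 0")
  case True
  then have "fls_lift c = 0" by (intro fls_eqI) simp
  then show ?thesis using True by simp
next
  case False
  then show ?thesis by (intro fls_subdegree_eqI) auto
qed

lemma ring_morphism_fls_lift: "ring_morphism fls_lift"
proof (rule ring_morphismI)
  note c = ring_morphism_const[where ?'a = 'a]
  show "fls_lift (1 :: 'a fls) = 1" by (intro fls_eqI) (simp add: one_pCons)
  show "fls_lift (a + b) = fls_lift a + fls_lift b" for a b :: "'a fls" by (intro fls_eqI) simp
  show "fls_lift (a * b) = fls_lift a * fls_lift b" for a b :: "'a fls"
  proof (rule fls_eqI)
    fix n
    have "fls_lift (a * b) $$ n = [:\<Sum>i=fls_subdegree a..n - fls_subdegree b. a $$ i * b $$ (n - i):]"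
      by (simp add: fls_times_nth(2))
    also have "\<dots> = (\<Sum>i=fls_subdegree a..n - fls_subdegree b. [:a $$ i * b $$ (n - i):])"
      by (rule ring_morphism_sum[OF c])
    also have "\<dots> = (fls_lift a * fls_lift b) $$ n"
      by (simp add: fls_times_nth(2) fls_lift_subdegree mult.commute)
    finally show "fls_lift (a * b) $$ n = (fls_lift a * fls_lift b) $$ n" .
  qed
qed

text \<open>The embedding \<open>k((x))[z] \<rightarrow> k[z]((x))\<close>.\<close>

definition as_series :: "'k::field fls poly \<Rightarrow> 'k poly fls" where
  "as_series h = peval fls_lift h (fls_const [:0, 1:])"

lemma ring_morphism_as_series: "ring_morphism as_series"
  unfolding as_series_def[abs_def] by (rule ring_morphism_peval[OF ring_morphism_fls_lift])

lemmas as_series_simps = ring_morphism_simps[OF ring_morphism_as_series]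

lemma fls_const_times_nth: "(fls_const a * f) $$ n = a * (f $$ n :: 'a::comm_ring_1)"
  by simp

lemma as_series_nth: "as_series h $$ n = map_poly (\<lambda>c. c $$ n) h"
proof (induction h)
  case 0
  then show ?case by (simp add: as_series_def)
next
  case (pCons c h)
  have "as_series (pCons c h) = fls_lift c + fls_const [:0, 1:] * as_series h"
    by (simp add: as_series_def peval_pCons ring_morphism_fls_lift)
  then show ?case by (simp only: fls_plus_nth fls_const_times_nth pCons.IH) (simp add: map_poly_pCons)
qed

lemma as_series_eq_0_iff [simp]: "as_series h = 0 \<longleftrightarrow> h = 0"
proof
  assume "as_series h = 0"
  then have "map_poly (\<lambda>c. c $$ n) h = 0" for n by (simp flip: as_series_nth)
  then have "coeff (map_poly (\<lambda>c. c $$ n) h) i = 0" for n i by simp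
  then have "coeff h i $$ n = 0" for n i by (simp add: coeff_map_poly)
  then show "h = 0" by (intro poly_eqI fls_eqI) simp
qed (simp add: as_series_simps)

definition xord :: "'k::field fls poly \<Rightarrow> int" where "xord h = fls_subdegree (as_series h)"
definition xlead :: "'k::field fls poly \<Rightarrow> 'k poly" where "xlead h = as_series h $$ xord h"
definition weight :: "'k::field fls poly \<Rightarrow> rat poly" where
  "weight h = [:of_nat (degree (xlead h)), of_int (- xord h):]"

lemma xlead_nz: "h \<noteq> 0 \<Longrightarrow> xlead h \<noteq> 0"
  by (simp add: xlead_def xord_def nth_fls_subdegree_zero_iff)

lemma below_xord: "n < xord h \<Longrightarrow> as_series h $$ n = 0"
  by (simp add: xord_def)

lemma xord_eqI: "as_series h $$ n \<noteq> 0 \<Longrightarrow> (\<And>k. k < n \<Longrightarrow> as_series h $$ k = 0) \<Longrightarrow> xord h = n"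
  unfolding xord_def by (rule fls_subdegree_eqI)

lemma xord_mult: "g \<noteq> 0 \<Longrightarrow> h \<noteq> 0 \<Longrightarrow> xord (g * h) = xord g + xord h"
  by (simp add: xord_def as_series_simps)

lemma xlead_mult: "g \<noteq> 0 \<Longrightarrow> h \<noteq> 0 \<Longrightarrow> xlead (g * h) = xlead g * xlead h"
  by (simp add: xlead_def xord_def as_series_simps)

lemma xord_power: "g \<noteq> 0 \<Longrightarrow> xord (g ^ n) = int n * xord g"
proof (induction n)
  case 0
  show ?case by (auto intro!: xord_eqI simp: as_series_simps)
qed (simp add: xord_mult algebra_simps)

lemma xlead_power: "g \<noteq> 0 \<Longrightarrow> xlead (g ^ n) = xlead g ^ n"
proof (induction n)
  case 0
  show ?case using xord_power[OF 0, of 0] by (simp add: xlead_def as_series_simps)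
qed (simp add: xlead_mult)

lemma lex_le: "[:a, b:] \<le> [:a', b' :: rat:] \<longleftrightarrow> b < b' \<or> b = b' \<and> a \<le> a'"
  by (auto simp: less_eq_poly_def pos_poly_pCons)

lemma lex_less: "[:a, b:] < [:a', b' :: rat:] \<longleftrightarrow> b < b' \<or> b = b' \<and> a < a'"
  by (auto simp: less_poly_def pos_poly_pCons)

text \<open>Order at least n, phrased through coefficients so that 0 is included and sums cause no
  case distinction.\<close>

definition vanishes_below :: "int \<Rightarrow> 'k::field fls poly \<Rightarrow> bool" where
  "vanishes_below n h \<longleftrightarrow> (\<forall>k<n. as_series h $$ k = 0)"

text \<open>Turns a bound on the weight into conditions on coefficients that are visibly additive;
  the ultrametric inequality is read off from them.\<close>

lemma weight_le_iff:
  assumes "h \<noteq> 0"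
  shows "weight h \<le> [:of_nat j, of_int N:] \<longleftrightarrow> vanishes_below (- N) h \<and> degree (as_series h $$ (- N)) \<le> j"
proof -
  have "xlead h \<noteq> 0" using assms by (rule xlead_nz)
  then have *: "vanishes_below (- N) h \<longleftrightarrow> - N \<le> xord h"
    using below_xord[of _ h] unfolding vanishes_below_def xlead_def by (meson less_le_trans linorder_not_less)
  show ?thesis
  proof (cases "xord h = - N")
    case True
    then show ?thesis by (simp add: * weight_def lex_le xlead_def)
  next
    case False
    then have "as_series h $$ (- N) = 0" if "- N \<le> xord h" using that by (intro below_xord) simp
    then show ?thesis using False by (auto simp: * weight_def lex_le)
  qed
qed

lemma weight_lessI:
  assumes "h \<noteq> 0" "vanishes_below (- N) h" "as_series h $$ (- N) = 0 \<or> degree (as_series h $$ (- N)) < j"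
  shows "weight h < [:of_nat j, of_int N:]"
proof (cases "xord h = - N")
  case True
  then show ?thesis using assms(3) xlead_nz[OF assms(1)] by (simp add: weight_def lex_less xlead_def)
next
  case False
  have "- N \<le> xord h" using assms(2) xlead_nz[OF assms(1)]
    unfolding vanishes_below_def xlead_def by (meson linorder_not_less)
  then show ?thesis using False by (simp add: weight_def lex_less)
qed

lemma vanishes_below_add: "vanishes_below n g \<Longrightarrow> vanishes_below n h \<Longrightarrow> vanishes_below n (g + h)"
  by (simp add: vanishes_below_def as_series_simps)

lemma weight_mult: "g \<noteq> 0 \<Longrightarrow> h \<noteq> 0 \<Longrightarrow> weight (g * h) = weight g + weight h"
  by (simp add: weight_def xord_mult xlead_mult xlead_nz degree_mult_eq)

lemma weight_add:
  assumes "g \<noteq> 0" "h \<noteq> 0" "g + h \<noteq> 0"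
  shows "weight (g + h) \<le> max (weight g) (weight h)"
proof -
  obtain j N where m: "max (weight g) (weight h) = [:of_nat j, of_int N:]"
    unfolding weight_def max_def by (metis (full_types))
  then have "weight g \<le> [:of_nat j, of_int N:]" "weight h \<le> [:of_nat j, of_int N:]" by (metis max.cobounded1 max.cobounded2)+
  then show ?thesis unfolding m weight_le_iff[OF assms(1)] weight_le_iff[OF assms(2)] weight_le_iff[OF assms(3)]
    by (auto simp: vanishes_below_add as_series_simps intro: degree_add_le)
qed

lemma xx_lead: "xord (xx :: 'k::field fls poly) = 1" "xlead (xx :: 'k fls poly) = 1" "(xx :: 'k fls poly) \<noteq> 0"
proof -
  have s: "as_series (xx :: 'k fls poly) $$ n = (if n = 1 then 1 else 0)" for n
    by (simp add: as_series_nth xx_def map_poly_pCons one_pCons)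
  show "xord (xx :: 'k fls poly) = 1" by (rule xord_eqI) (auto simp: s)
  then show "xlead (xx :: 'k fls poly) = 1" by (simp add: xlead_def s)
qed simp

definition zpoly :: "'k::field poly \<Rightarrow> 'k fls poly" where "zpoly p = peval kc p zz"

lemma ring_morphism_zpoly: "ring_morphism zpoly"
  unfolding zpoly_def[abs_def] by (rule ring_morphism_peval[OF ring_morphism_kc])

lemma zpoly_simps: "zpoly [:c:] = kc c" "zpoly [:0, 1:] = zz"
  by (simp_all only: zpoly_def peval_const[OF ring_morphism_kc] peval_X[OF ring_morphism_kc])

lemma as_series_zpoly: "as_series (zpoly p) = fls_const p"
proof (induction p)
  case 0
  then show ?case by (simp add: zpoly_def as_series_simps)
next
  case (pCons c p)
  have k: "as_series (kc c) = fls_const [:c:]"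
    by (rule fls_eqI) (simp add: as_series_nth kc_def map_poly_pCons)
  have z: "as_series (zz :: 'a fls poly) = fls_const [:0, 1:]"
    by (rule fls_eqI) (simp add: as_series_nth zz_def map_poly_pCons)
  have "as_series (zpoly (pCons c p)) = fls_const [:c:] + fls_const [:0, 1:] * fls_const p"
    using pCons by (simp add: zpoly_def peval_pCons ring_morphism_kc as_series_simps k z)
  also have "\<dots> = fls_const (pCons c p)" by (simp add: fls_plus_const)
  finally show ?case .
qed

lemma zpoly_lead: "p \<noteq> 0 \<Longrightarrow> xord (zpoly p) = 0" "p \<noteq> 0 \<Longrightarrow> xlead (zpoly p) = p" "p \<noteq> 0 \<Longrightarrow> zpoly p \<noteq> 0"
proof -
  show 1: "xord (zpoly p) = 0" if "p \<noteq> 0" using that by (simp add: xord_def as_series_zpoly)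
  show "xlead (zpoly p) = p" if "p \<noteq> 0" using 1[OF that] by (simp add: xlead_def as_series_zpoly)
  show "zpoly p \<noteq> 0" if "p \<noteq> 0" using that as_series_zpoly[of p] by (auto simp: as_series_simps)
qed

lemma peval_sum: "ring_morphism f \<Longrightarrow> peval f p a = (\<Sum>i\<le>degree p. f (coeff p i) * a ^ i)"
proof -
  assume f: "ring_morphism f"
  have "degree (map_poly f p) \<le> degree p"
    by (rule degree_le) (simp add: coeff_map_poly ring_morphism_0[OF f] coeff_eq_0)
  then have "poly (map_poly f p) a = (\<Sum>i\<le>degree p. coeff (map_poly f p) i * a ^ i)"
    unfolding poly_altdef by (intro sum.mono_neutral_left) (auto simp: coeff_eq_0)
  then show ?thesis by (simp add: peval_def coeff_map_poly ring_morphism_0[OF f])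
qed

lemma eval2_mod_x:
  fixes p :: "'k::field poly poly"
  obtains g where "eval2 kc xx zz p = zpoly (P_at_0 p) + xx * eval2 kc xx zz g"
proof -
  let ?c = "map_poly (\<lambda>c. [:c:]) (P_at_0 p)"
  note P = ring_morphism_simps[OF ring_morphism_at_0(1)]
  have "P_at_0 ?c = P_at_0 p" by (rule poly_eqI) (simp add: P_at_0_def coeff_map_poly)
  then have "P_at_0 (p - ?c) = 0" by (simp add: P)
  then obtain g where g: "p - ?c = [:[:0, 1:]:] * g" using at_0_eq_0(1) by (blast elim: dvdE)
  note e = ring_morphism_simps[OF eval_morphism(2)[OF ring_morphism_kc]]
  have x: "eval2 kc xx zz [:[:0, 1:]:] = (xx :: 'k fls poly)"
    by (simp add: eval_pCons ring_morphism_kc eval_0 ring_morphism_0[OF ring_morphism_kc] eval_1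
        ring_morphism_1[OF ring_morphism_kc])
  have c: "eval2 kc xx zz (map_poly (\<lambda>c. [:c:]) q) = zpoly q" for q :: "'k poly"
    by (induction q) (simp_all add: map_poly_pCons eval_pCons ring_morphism_kc eval_0 zpoly_def peval_pCons)
  have "eval2 kc xx zz (p - ?c) = xx * eval2 kc xx zz g" unfolding g e x ..
  then show ?thesis using that[of g] by (simp add: e c algebra_simps)
qed

section \<open>The filtration by pole order and its graded pieces\<close>

locale danielewski =
  fixes P :: "'k::field poly poly" and Q :: "'k poly poly poly" and d e r s :: nat
  assumes P_monic: "lead_coeff P = 1" "degree P = r" and Q_monic: "lead_coeff Q = 1" "degree Q = s"
    and pos: "d > 0" "e > 0" "r \<ge> 2" "s \<ge> 2"
begin

abbreviation C where "C \<equiv> SS P Q d e"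
abbreviation y where "y \<equiv> yy P d"
abbreviation t where "t \<equiv> tt P Q d e"
abbreviation mon :: "nat \<Rightarrow> nat \<Rightarrow> nat \<Rightarrow> nat \<Rightarrow> 'k fls poly" where
  "mon a b k m \<equiv> xx ^ a * zz ^ b * y ^ k * t ^ m"

definition P0 where "P0 = P_at_0 P"

lemma P0: "lead_coeff P0 = 1" "degree P0 = r" "P0 \<noteq> 0"
  using P_at_0_monic[OF P_monic(1)] P_monic(2) by (auto simp: P0_def)

sublocale evaluation C kc xx by (rule evaluation_SS)

lemmas gens = gens_SS[where P = P and Q = Q and d = d and e = e]

text \<open>Spanned by monomials, \<open>V N\<close> turns out to consist of all elements with a pole of order at
  most \<open>N\<close> at \<open>x = 0\<close>.\<close>

inductive_set V :: "int \<Rightarrow> 'k fls poly set" for N :: int where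
  V_zero: "0 \<in> V N"
| V_step: "h \<in> V N \<Longrightarrow> int (d * k + (d * s + e) * m) \<le> N + int a \<Longrightarrow> kc c * mon a b k m + h \<in> V N"

lemma V_mon: "int (d * k + (d * s + e) * m) \<le> N + int a \<Longrightarrow> kc c * mon a b k m \<in> V N"
  using V_step[OF V_zero, of k m N a c b] by simp

lemma V_add: "g \<in> V N \<Longrightarrow> h \<in> V N \<Longrightarrow> g + h \<in> V N"
  by (induction rule: V.induct) (simp_all add: add.assoc V_step)

lemma V_mono: "h \<in> V N \<Longrightarrow> N \<le> M \<Longrightarrow> h \<in> V M"
  by (induction rule: V.induct) (auto intro: V.intros)

lemma kc_1: "kc 1 = (1 :: 'k fls poly)" and kc_0: "kc 0 = (0 :: 'k fls poly)"
  using ring_morphism_kc by (auto intro: ring_morphism_1 ring_morphism_0)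

lemma V_mon_mult: "h \<in> V M \<Longrightarrow> int (d * k + (d * s + e) * m) \<le> N + int a \<Longrightarrow> kc c * mon a b k m * h \<in> V (N + M)"
proof (induction rule: V.induct)
  case V_zero
  then show ?case by (simp add: V.V_zero)
next
  case (V_step h k' m' a' c' b')
  have "kc c * mon a b k m * (kc c' * mon a' b' k' m' + h)
      = kc (c * c') * mon (a + a') (b + b') (k + k') (m + m') + kc c * mon a b k m * h"
    by (simp add: ring_morphism_mult[OF ring_morphism_kc] power_add algebra_simps)
  moreover have "int (d * (k + k') + (d * s + e) * (m + m')) \<le> (N + M) + int (a + a')"
    using V_step(2,4) by (simp add: algebra_simps)
  ultimately show ?case using V_step by (simp only: V.V_step)
qed

lemma V_mult: "g \<in> V N \<Longrightarrow> h \<in> V M \<Longrightarrow> g * h \<in> V (N + M)"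
proof (induction rule: V.induct)
  case V_zero
  then show ?case by (simp add: V.V_zero)
next
  case (V_step g k m a c b)
  then show ?case by (simp add: distrib_right V_add V_mon_mult)
qed

lemma V_const: "kc c \<in> V 0"
  using V_mon[of 0 0 0 0 c 0] by simp

lemma V_1: "1 \<in> V 0"
  using V_const[of 1] by (simp add: kc_1)

lemma V_uminus: "h \<in> V N \<Longrightarrow> - h \<in> V N"
proof -
  assume "h \<in> V N"
  from V_mult[OF V_const[of "-1"] this] show ?thesis
    by (simp add: ring_morphism_uminus[OF ring_morphism_kc] kc_1)
qed

lemma V_gens: "xx \<in> V (- 1)" "zz \<in> V 0" "y \<in> V d" "t \<in> V (d * s + e)"
  using V_mon[of 0 0 "-1" 1 1 0] V_mon[of 0 0 0 0 1 1] V_mon[of 1 0 d 0 1 0] V_mon[of 0 1 "d * s + e" 0 1 0]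
  by (simp_all add: kc_1)

lemma V_power: "h \<in> V N \<Longrightarrow> h ^ n \<in> V (int n * N)"
proof (induction n)
  case (Suc n)
  then show ?case using V_mult[of h N "h ^ n" "int n * N"] by (simp add: algebra_simps)
qed (simp add: V_1)

lemma V_sum: "(\<And>i. i \<in> I \<Longrightarrow> f i \<in> V N) \<Longrightarrow> sum f I \<in> V N"
  by (induction I rule: infinite_finite_induct) (simp_all add: V_zero V_add)

lemma V_0_subring: "unital_subring (V 0)"
  by standard (use V_1 V_add V_uminus V_mult[of _ 0 _ 0] in auto)

lemma V_eval2: "eval2 kc xx zz p \<in> V 0"
  using eval_mem(2)[OF ring_morphism_kc V_0_subring V_const _ V_gens(2)] V_mono[OF V_gens(1), of 0] by simp

lemma V_zpoly: "zpoly p \<in> V 0"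
  unfolding zpoly_def by (rule peval_mem[OF V_0_subring ring_morphism_kc V_const V_gens(2)])

lemma V_exhaust:
  assumes "h \<in> C"
  obtains N where "h \<in> V N"
proof -
  define U where "U = (\<Union>N. V N)"
  have "unital_subring U"
  proof
    show "1 \<in> U" using V_1 by (auto simp: U_def)
    show "- a \<in> U" if "a \<in> U" for a using that V_uminus by (auto simp: U_def)
    fix a b assume "a \<in> U" "b \<in> U"
    then obtain N M where ab: "a \<in> V N" "b \<in> V M" by (auto simp: U_def)
    then have "a + b \<in> V (max N M)" by (intro V_add) (auto intro: V_mono)
    then show "a + b \<in> U" by (auto simp: U_def)
    show "a * b \<in> U" using V_mult[OF ab] by (auto simp: U_def)
  qed
  moreover have "kc c \<in> U" "xx \<in> U" "zz \<in> U" "y \<in> U" "t \<in> U" for c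
    using V_const V_gens unfolding U_def by blast+
  ultimately have "ev P Q d e H \<in> U" for H
    unfolding ev_def by (intro eval_mem(4)[OF ring_morphism_kc])
  then show ?thesis using assms that by (auto simp: SS_def U_def)
qed

lemma rel_y_mod: "xx ^ d * y - zpoly P0 \<in> V (- 1)"
proof -
  obtain g where "eval2 kc xx zz P = zpoly P0 + xx * eval2 kc xx zz g"
    unfolding P0_def using eval2_mod_x .
  moreover have "xx * eval2 kc xx zz g \<in> V (- 1 + 0)" by (intro V_mult V_gens V_eval2)
  ultimately show ?thesis by (simp add: xx_yy)
qed

text \<open>The coefficients of Q are polynomials in x and z without pole, so its terms below y^s
  have pole order at most d (s - 1).\<close>

lemma rel_t_mod: "xx ^ e * t - y ^ s \<in> V (int d * (int s - 1))"
proof -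
  have "eval3 kc xx zz y Q = (\<Sum>i\<le>s. eval2 kc xx zz (coeff Q i) * y ^ i)"
    unfolding eval3_def peval_sum[OF eval_morphism(2)[OF ring_morphism_kc]] Q_monic ..
  also have "\<dots> = (\<Sum>i<s. eval2 kc xx zz (coeff Q i) * y ^ i) + y ^ s"
    using Q_monic by (simp add: lessThan_Suc_atMost[symmetric] eval_1 ring_morphism_kc)
  finally have eq: "xx ^ e * t - y ^ s = (\<Sum>i<s. eval2 kc xx zz (coeff Q i) * y ^ i)"
    by (simp add: xx_tt)
  have "eval2 kc xx zz (coeff Q i) * y ^ i \<in> V (int d * (int s - 1))" if "i < s" for i
  proof -
    have "eval2 kc xx zz (coeff Q i) * y ^ i \<in> V (0 + int i * int d)"
      by (intro V_mult V_eval2 V_power V_gens)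
    moreover have "int i * int d \<le> int d * (int s - 1)"
      using that mult_left_mono[of "int i" "int s - 1" "int d"] by (simp add: mult.commute)
    ultimately show ?thesis by (auto intro: V_mono)
  qed
  then show ?thesis unfolding eq by (intro V_sum) auto
qed

text \<open>A basis of the associated graded ring over \<open>k[x, z]\<close>: \<open>Y \<kappa>\<close> has leading
  coefficient \<open>P0\<^sup>\<kappa>\<close> and a pole of order \<open>B \<kappa>\<close>.\<close>

definition B where "B \<kappa> = d * (\<kappa> mod s) + (d * s + e) * (\<kappa> div s)"
definition Y where "Y \<kappa> = y ^ (\<kappa> mod s) * t ^ (\<kappa> div s)"
text \<open>The first \<open>Y \<kappa>\<close> whose pole has order at least N; a power of x brings
  it down to exactly N. It carries the smallest power of P0 possible at that order.\<close>

definition level where "level N = (LEAST \<kappa>. N \<le> int (B \<kappa>))"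

lemma Suc_mod_div:
  "Suc \<kappa> mod s \<noteq> 0 \<Longrightarrow> Suc \<kappa> mod s = Suc (\<kappa> mod s) \<and> Suc \<kappa> div s = \<kappa> div s"
  "Suc \<kappa> mod s = 0 \<Longrightarrow> Suc \<kappa> div s = Suc (\<kappa> div s) \<and> Suc (\<kappa> mod s) = s"
  using pos by (auto simp: mod_Suc div_Suc split: if_splits)

lemma B_Suc: "B \<kappa> < B (Suc \<kappa>)"
proof (cases "Suc \<kappa> mod s = 0")
  case True
  then have "Suc \<kappa> div s = Suc (\<kappa> div s)" "s = Suc (\<kappa> mod s)" using Suc_mod_div(2) by auto
  then have "B (Suc \<kappa>) = B \<kappa> + d + e" using True by (simp add: B_def) (metis add_mult_distrib2 mult_Suc_right add.commute)
  then show ?thesis using pos by simp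
next
  case False
  then show ?thesis using Suc_mod_div(1)[of \<kappa>] pos unfolding B_def by simp
qed

lemma B_ge: "\<kappa> \<le> B \<kappa>"
proof (induction \<kappa>)
  case (Suc \<kappa>)
  then show ?case using B_Suc[of \<kappa>] by simp
qed simp

lemma level_le: "N \<le> int (B (level N))"
  unfolding level_def by (rule LeastI[of _ "nat N"]) (use B_ge[of "nat N"] in linarith)

lemma level_least: "N \<le> int (B \<kappa>) \<Longrightarrow> level N \<le> \<kappa>"
  unfolding level_def by (rule Least_le)

lemma B_0: "B 0 = 0" by (simp add: B_def)

lemma level_nonpos: "N \<le> 0 \<Longrightarrow> level N = 0"
  using level_least[of N 0] by (simp add: B_0)

lemma level_pos: "N > 0 \<Longrightarrow> level N > 0"
  using level_le[of N] B_0 by (cases "level N") auto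

lemma B_mono: "\<kappa> \<le> \<kappa>' \<Longrightarrow> B \<kappa> \<le> B \<kappa>'"
  by (rule lift_Suc_mono_le[of B]) (use B_Suc less_imp_le in auto)

lemma V_Y: "Y \<kappa> \<in> V (B \<kappa>)"
proof -
  have "Y \<kappa> \<in> V (int (\<kappa> mod s) * int d + int (\<kappa> div s) * int (d * s + e))"
    unfolding Y_def by (intro V_mult V_power V_gens)
  then show ?thesis by (simp add: B_def mult.commute)
qed

lemma V_x_power: "h \<in> V N \<Longrightarrow> xx ^ n * h \<in> V (N - int n)"
  using V_mult[OF V_power[OF V_gens(1), of n], of h N] by simp

text \<open>Raising the index costs one factor P0. Without a carry this is x^d y = P0 modulo lower
  order; at a carry t replaces y^s, and x^(d+e) t is congruent to x^d y^s, that is to P0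
  y^(s-1).\<close>

lemma Y_Suc: "xx ^ (B (Suc \<kappa>) - B \<kappa>) * Y (Suc \<kappa>) - zpoly P0 * Y \<kappa> \<in> V (int (B \<kappa>) - 1)"
proof (cases "Suc \<kappa> mod s = 0")
  case False
  then have sm: "Suc \<kappa> mod s = Suc (\<kappa> mod s)" "Suc \<kappa> div s = \<kappa> div s" using Suc_mod_div by auto
  then have "B (Suc \<kappa>) - B \<kappa> = d" by (simp add: B_def)
  moreover have "Y (Suc \<kappa>) = y * Y \<kappa>" using sm by (simp add: Y_def)
  ultimately have "xx ^ (B (Suc \<kappa>) - B \<kappa>) * Y (Suc \<kappa>) - zpoly P0 * Y \<kappa> = (xx ^ d * y - zpoly P0) * Y \<kappa>"
    by (simp add: algebra_simps)
  then show ?thesis using V_mult[OF rel_y_mod V_Y[of \<kappa>]] by simp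
next
  case True
  define m where "m = \<kappa> div s"
  have sm: "Suc \<kappa> div s = Suc m" "\<kappa> mod s = s - 1" using Suc_mod_div(2)[OF True] by (auto simp: m_def)
  obtain s' where s': "s = Suc s'" using pos by (cases s) auto
  have ss: "s - 1 = s'" using s' by simp
  have BB: "B (Suc \<kappa>) = (d * s + e) * Suc m" "B \<kappa> = d * s' + (d * s + e) * m"
    unfolding B_def True sm ss m_def by simp_all
  then have "B (Suc \<kappa>) - B \<kappa> = d + e" by (simp add: s')
  moreover have "Y (Suc \<kappa>) = t ^ Suc m" "Y \<kappa> = y ^ s' * t ^ m"
    unfolding Y_def True sm ss m_def by simp_all
  ultimately have eq: "xx ^ (B (Suc \<kappa>) - B \<kappa>) * Y (Suc \<kappa>) - zpoly P0 * Y \<kappa>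
    = xx ^ d * (t ^ m * (xx ^ e * t - y ^ s)) + (xx ^ d * y - zpoly P0) * Y \<kappa>"
    by (simp add: algebra_simps power_add s')
  have "xx ^ d * (t ^ m * (xx ^ e * t - y ^ s)) \<in> V (int m * int (d * s + e) + int d * (int s - 1) - int d)"
    by (intro V_x_power V_mult V_power V_gens rel_t_mod)
  moreover have "int m * int (d * s + e) + int d * (int s - 1) - int d \<le> int (B \<kappa>) - 1"
    using pos unfolding BB(2) by (simp add: s' algebra_simps)
  ultimately have "xx ^ d * (t ^ m * (xx ^ e * t - y ^ s)) \<in> V (int (B \<kappa>) - 1)" by (rule V_mono)
  moreover have "(xx ^ d * y - zpoly P0) * Y \<kappa> \<in> V (int (B \<kappa>) - 1)"
    using V_mult[OF rel_y_mod V_Y[of \<kappa>]] by simp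
  ultimately show ?thesis unfolding eq by (rule V_add)
qed

text \<open>Representatives of \<open>V N\<close> modulo \<open>V (N - 1)\<close>, parametrised by
  k[z]: the coefficient of x^(-N) is P0^(level N) p.\<close>

definition top_form :: "int \<Rightarrow> 'k poly \<Rightarrow> 'k fls poly" where
  "top_form N p = xx ^ nat (int (B (level N)) - N) * Y (level N) * zpoly p"

lemma top_form_add: "top_form N (p + q) = top_form N p + top_form N q"
  by (simp add: top_form_def ring_morphism_add[OF ring_morphism_zpoly] algebra_simps)

lemma V_shift_int:
  assumes "h \<in> V M" "N \<le> M'" "M' = M + 1"
  shows "xx ^ nat (M' - N) * h \<in> V (N - 1)"
  using V_x_power[OF assms(1), of "nat (M' - N)"] assms(2,3) by simp

text \<open>Descent from \<kappa> to \<open>level N\<close>: each step trades Y (\<kappa> + 1) for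
  P0 times Y \<kappa>, the factor P0 being moved into q.\<close>

lemma top_reduce:
  "level N \<le> \<kappa> \<Longrightarrow> \<exists>p. xx ^ nat (int (B \<kappa>) - N) * Y \<kappa> * zpoly q - top_form N p \<in> V (N - 1)"
proof (induction \<kappa> arbitrary: q rule: dec_induct)
  case base
  show ?case by (rule exI[of _ q]) (simp add: top_form_def V_zero)
next
  case (step \<kappa>)
  have N: "N \<le> int (B \<kappa>)" using level_le[of N] B_mono[OF step(1)] by linarith
  obtain p where p: "xx ^ nat (int (B \<kappa>) - N) * Y \<kappa> * zpoly (P0 * q) - top_form N p \<in> V (N - 1)"
    using step.IH by blast
  have "nat (int (B (Suc \<kappa>)) - N) = nat (int (B \<kappa>) - N) + (B (Suc \<kappa>) - B \<kappa>)"
    using B_Suc[of \<kappa>] N by linarith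
  then have "xx ^ nat (int (B (Suc \<kappa>)) - N) * Y (Suc \<kappa>) * zpoly q
      - xx ^ nat (int (B \<kappa>) - N) * Y \<kappa> * zpoly (P0 * q)
    = xx ^ nat (int (B \<kappa>) - N) * (xx ^ (B (Suc \<kappa>) - B \<kappa>) * Y (Suc \<kappa>) - zpoly P0 * Y \<kappa>) * zpoly q"
    by (simp add: power_add algebra_simps ring_morphism_mult[OF ring_morphism_zpoly])
  moreover have "\<dots> \<in> V (N - 1 + 0)"
    by (intro V_mult V_zpoly V_shift_int[OF Y_Suc N]) simp
  ultimately have "xx ^ nat (int (B (Suc \<kappa>)) - N) * Y (Suc \<kappa>) * zpoly q
      - xx ^ nat (int (B \<kappa>) - N) * Y \<kappa> * zpoly (P0 * q) \<in> V (N - 1)" by simp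
  from V_add[OF this p] show ?case by (auto intro: exI[of _ p])
qed

text \<open>As long as the exponent of y is at least s, y^s is replaced by x^e t, at the price of
  terms with a smaller pole.\<close>

lemma reduce_y:
  "int (d * k + (d * s + e) * m) \<le> N + int a \<Longrightarrow>
    xx ^ a * y ^ k * t ^ m - xx ^ (a + e * (k div s)) * y ^ (k mod s) * t ^ (m + k div s) \<in> V (N - 1)"
proof (induction k arbitrary: a m rule: less_induct)
  case (less k)
  show ?case
  proof (cases "k < s")
    case True
    then show ?thesis by (simp add: V_zero)
  next
    case False
    define l where "l = k - s"
    have k: "k = l + s" and lk: "l < k" using False pos by (auto simp: l_def)
    have kd: "k div s = Suc (l div s)" "k mod s = l mod s" using pos by (simp_all add: k)
    have le: "int (d * l + (d * s + e) * Suc m) \<le> N + int (a + e)"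
      using less.prems by (simp add: k algebra_simps)
    have 1: "xx ^ (a + e) * y ^ l * t ^ Suc m - xx ^ (a + e * (k div s)) * y ^ (k mod s) * t ^ (m + k div s) \<in> V (N - 1)"
      using less.IH[OF lk le] by (simp add: kd add.assoc)
    have eq: "xx ^ a * y ^ k * t ^ m - xx ^ (a + e) * y ^ l * t ^ Suc m
        = - (xx ^ a * (y ^ l * t ^ m * (xx ^ e * t - y ^ s)))"
      by (simp add: k power_add algebra_simps)
    have "xx ^ a * (y ^ l * t ^ m * (xx ^ e * t - y ^ s))
      \<in> V (int l * int d + int m * int (d * s + e) + int d * (int s - 1) - int a)"
      by (intro V_x_power V_mult V_power V_gens rel_t_mod)
    moreover have "int l * int d + int m * int (d * s + e) + int d * (int s - 1) - int a \<le> N - 1"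
      using less.prems pos by (simp add: k algebra_simps)
    ultimately have "xx ^ a * (y ^ l * t ^ m * (xx ^ e * t - y ^ s)) \<in> V (N - 1)" by (rule V_mono)
    then have "xx ^ a * y ^ k * t ^ m - xx ^ (a + e) * y ^ l * t ^ Suc m \<in> V (N - 1)"
      unfolding eq by (rule V_uminus)
    from V_add[OF this 1] show ?thesis by simp
  qed
qed

lemma V_top: "h \<in> V N \<Longrightarrow> \<exists>p. h - top_form N p \<in> V (N - 1)"
proof (induction rule: V.induct)
  case V_zero
  have "top_form N 0 = 0" by (simp add: top_form_def ring_morphism_0[OF ring_morphism_zpoly])
  then show ?case by (intro exI[of _ 0]) (simp add: V.V_zero)
next
  case (V_step h k m a c b)
  obtain p where p: "h - top_form N p \<in> V (N - 1)" using V_step by blast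
  have "\<exists>q. kc c * mon a b k m - top_form N q \<in> V (N - 1)"
  proof (cases "int (d * k + (d * s + e) * m) \<le> N - 1 + int a")
    case True
    have "top_form N 0 = 0" by (simp add: top_form_def ring_morphism_0[OF ring_morphism_zpoly])
    then show ?thesis using V_mon[OF True] by (intro exI[of _ 0]) simp
  next
    case False
    \<comment> \<open>The index in the enumeration \<open>Y\<close>: after reduction the exponent of
      y, now below s, is the remainder of \<kappa> modulo s and the exponent of t the
      quotient.\<close>
    define \<kappa> where "\<kappa> = k mod s + s * (m + k div s)"
    have \<kappa>: "\<kappa> mod s = k mod s" "\<kappa> div s = m + k div s" using pos by (simp_all add: \<kappa>_def)
    have "d * (k mod s) + d * s * (k div s) = d * k"
      by (metis add_mult_distrib2 mult.assoc mult_div_mod_eq add.commute)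
    then have "B \<kappa> = d * k + (d * s + e) * m + e * (k div s)" by (simp add: B_def \<kappa> algebra_simps)
    moreover have N: "N = int (d * k + (d * s + e) * m) - int a" using False V_step(2) by linarith
    ultimately have BN: "int (B \<kappa>) - N = int (a + e * (k div s))" by simp
    then have "level N \<le> \<kappa>" by (intro level_least) linarith
    define w where "w = kc c * zz ^ b"
    have w: "w = zpoly ([:c:] * [:0, 1:] ^ b)"
      by (simp only: w_def ring_morphism_simps[OF ring_morphism_zpoly] zpoly_simps)
    then have wV: "w \<in> V 0" using V_zpoly by metis
    obtain q where q: "xx ^ nat (int (B \<kappa>) - N) * Y \<kappa> * w - top_form N q \<in> V (N - 1)"
      using top_reduce[OF \<open>level N \<le> \<kappa>\<close>] unfolding w by blast
    have eq1: "xx ^ nat (int (B \<kappa>) - N) * Y \<kappa> = xx ^ (a + e * (k div s)) * y ^ (k mod s) * t ^ (m + k div s)"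
      unfolding BN Y_def \<kappa> nat_int by (simp add: mult.assoc)
    have "(xx ^ a * y ^ k * t ^ m - xx ^ nat (int (B \<kappa>) - N) * Y \<kappa>) * w \<in> V (N - 1 + 0)"
      unfolding eq1 by (intro V_mult reduce_y V_step wV)
    then have "kc c * mon a b k m - xx ^ nat (int (B \<kappa>) - N) * Y \<kappa> * w \<in> V (N - 1)"
      by (simp add: w_def algebra_simps)
    from V_add[OF this q] show ?thesis by auto
  qed
  then obtain q where q: "kc c * mon a b k m - top_form N q \<in> V (N - 1)" by blast
  from V_add[OF p q] have "kc c * mon a b k m + h - top_form N (p + q) \<in> V (N - 1)"
    by (simp add: top_form_add algebra_simps)
  then show ?case by blast
qed

end

lemma disj_if_not: "(\<not> A \<Longrightarrow> B) \<Longrightarrow> A \<or> B"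
  by blast

section \<open>Weights of monomials, normal forms and presentations without cancellation\<close>

context danielewski
begin

lemma xord_eval2: "P_at_0 p \<noteq> 0 \<Longrightarrow> xord (eval2 kc xx zz p) = 0"
  and xlead_eval2: "P_at_0 p \<noteq> 0 \<Longrightarrow> xlead (eval2 kc xx zz p) = P_at_0 p"
  and eval2_nz: "P_at_0 p \<noteq> 0 \<Longrightarrow> eval2 kc xx zz p \<noteq> 0"
proof -
  assume p: "P_at_0 p \<noteq> 0"
  have c: "coeff (eval2 kc xx zz p) i = fps_to_fls (fps_of_poly (coeff p i))" for i
    by (simp add: eval2_zz coeff_map_poly)
  have neg: "as_series (eval2 kc xx zz p) $$ n = 0" if "n < 0" for n
    using that by (intro poly_eqI) (simp add: as_series_nth coeff_map_poly c)
  have zero: "as_series (eval2 kc xx zz p) $$ 0 = P_at_0 p"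
    by (intro poly_eqI) (simp add: as_series_nth coeff_map_poly c P_at_0_def poly_0_coeff_0)
  show 1: "xord (eval2 kc xx zz p) = 0" by (rule xord_eqI) (use neg zero p in auto)
  then show "xlead (eval2 kc xx zz p) = P_at_0 p" by (simp add: xlead_def zero)
  show "eval2 kc xx zz p \<noteq> 0" using zero p by (auto simp: as_series_simps)
qed

lemma nz: "xx \<noteq> (0 :: 'k fls poly)" "zz \<noteq> (0 :: 'k fls poly)" "y \<noteq> 0"
  and y_lead: "xord y = - int d" "xlead y = P0"
proof -
  show "xx \<noteq> (0 :: 'k fls poly)" "zz \<noteq> (0 :: 'k fls poly)" by (simp_all add: zz_def)
  have P: "P_at_0 P \<noteq> 0" using P0(3) by (simp add: P0_def)
  have "xx ^ d * y \<noteq> 0" using eval2_nz[OF P] by (simp add: xx_yy)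
  then show y: "y \<noteq> 0" by auto
  have "xord (xx ^ d * y) = 0" "xlead (xx ^ d * y) = P0"
    using xord_eval2[OF P] xlead_eval2[OF P] by (simp_all add: xx_yy P0_def)
  then show "xord y = - int d" "xlead y = P0"
    using y by (simp_all add: xord_mult xlead_mult xord_power xlead_power xx_lead)
qed

lemma vanishes_below_sum: "(\<And>i. i \<in> I \<Longrightarrow> vanishes_below n (f i)) \<Longrightarrow> vanishes_below n (sum f I)"
  by (induction I rule: infinite_finite_induct)
    (simp_all add: vanishes_below_add, simp_all add: vanishes_below_def as_series_simps)

lemma vanishes_below_xord: "h \<noteq> 0 \<Longrightarrow> n \<le> xord h \<Longrightarrow> vanishes_below n h"
  using below_xord[of _ h] by (auto simp: vanishes_below_def)

lemma vanishes_below_mult: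
  "vanishes_below n g \<Longrightarrow> vanishes_below m h \<Longrightarrow> vanishes_below (n + m) (g * h)"
proof (cases "g = 0 \<or> h = 0")
  case True
  then show ?thesis by (auto simp: vanishes_below_def as_series_simps)
next
  case False
  assume "vanishes_below n g" "vanishes_below m h"
  then have "n \<le> xord g" "m \<le> xord h"
    using False xlead_nz[of g] xlead_nz[of h] unfolding vanishes_below_def xlead_def
    by (meson linorder_not_less)+
  then show ?thesis using False by (intro vanishes_below_xord) (auto simp: xord_mult)
qed

lemma xord_leading:
  assumes "g \<noteq> 0" "vanishes_below (xord g + 1) h"
  shows "g + h \<noteq> 0" "xord (g + h) = xord g" "xlead (g + h) = xlead g"
proof -
  have h: "as_series h $$ k = 0" if "k \<le> xord g" for k using assms(2) that by (simp add: vanishes_below_def)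
  have top: "as_series (g + h) $$ xord g = xlead g" using h by (simp add: as_series_simps xlead_def)
  show "g + h \<noteq> 0"
  proof
    assume "g + h = 0"
    then have "as_series (g + h) $$ xord g = 0" by (simp only: as_series_simps(1) fls_zero_nth)
    then show False using top xlead_nz[OF assms(1)] by simp
  qed
  show "xord (g + h) = xord g"
    by (rule xord_eqI) (use top xlead_nz[OF assms(1)] h below_xord[of _ g] in \<open>auto simp: as_series_simps\<close>)
  then show "xlead (g + h) = xlead g" using top by (simp add: xlead_def)
qed

lemma y_power_vanishes: "vanishes_below (- int (d * i)) (y ^ i)"
  by (rule vanishes_below_xord) (simp_all add: nz xord_power y_lead)

lemma t_nz: "t \<noteq> 0" and t_lead: "xord t = - int (d * s + e)" "xlead t = P0 ^ s"
proof -
  have "eval3 kc xx zz y Q = (\<Sum>i\<le>s. eval2 kc xx zz (coeff Q i) * y ^ i)"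
    unfolding eval3_def peval_sum[OF eval_morphism(2)[OF ring_morphism_kc]] Q_monic ..
  also have "\<dots> = y ^ s + (\<Sum>i<s. eval2 kc xx zz (coeff Q i) * y ^ i)"
    using Q_monic by (simp add: lessThan_Suc_atMost[symmetric] eval_1 ring_morphism_kc)
  finally have eq: "xx ^ e * t = y ^ s + (\<Sum>i<s. eval2 kc xx zz (coeff Q i) * y ^ i)" by (simp add: xx_tt)
  have ys: "y ^ s \<noteq> 0" "xord (y ^ s) = - int (d * s)" "xlead (y ^ s) = P0 ^ s"
    by (simp_all add: nz xord_power xlead_power y_lead)
  have "vanishes_below (xord (y ^ s) + 1) (\<Sum>i\<in>{..<s}. eval2 kc xx zz (coeff Q i) * y ^ i)"
  proof (rule vanishes_below_sum)
    fix i assume i: "i \<in> {..<s}"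
    have c: "vanishes_below 0 (eval2 kc xx zz (coeff Q i))"
      by (auto simp: vanishes_below_def as_series_nth coeff_map_poly eval2_zz intro!: poly_eqI)
    have "d * i + 1 \<le> d * s" using i pos mult_le_mono2[of "Suc i" s d] by simp
    then have "int (d * i) + 1 \<le> int (d * s)" by linarith
    then have "xord (y ^ s) + 1 \<le> 0 + - int (d * i)" unfolding ys by linarith
    then show "vanishes_below (xord (y ^ s) + 1) (eval2 kc xx zz (coeff Q i) * y ^ i)"
      using vanishes_below_mult[OF c y_power_vanishes] by (auto simp: vanishes_below_def)
  qed
  note l = xord_leading[OF ys(1) this, folded eq]
  then show t: "t \<noteq> 0" by auto
  show "xord t = - int (d * s + e)" "xlead t = P0 ^ s"
    using l t by (simp_all add: ys xord_mult xlead_mult xord_power xlead_power xx_lead)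
qed

lemma z_lead: "xord (zz :: 'k fls poly) = 0" "xlead (zz :: 'k fls poly) = [:0, 1:]"
  using zpoly_lead(1,2)[of "[:0, 1:] :: 'k poly"] by (simp_all add: zpoly_simps)

lemma kc_lead: "c \<noteq> 0 \<Longrightarrow> xord (kc c :: 'k fls poly) = 0" "c \<noteq> 0 \<Longrightarrow> xlead (kc c) = [:c:]" "c \<noteq> 0 \<Longrightarrow> kc c \<noteq> 0"
  using zpoly_lead[of "[:c:]"] by (simp_all add: zpoly_simps)

lemma mon_nz: "mon a b k m \<noteq> 0"
  by (simp add: nz t_nz)

lemma mon_xord: "xord (mon a b k m) = int a - int (d * k + (d * s + e) * m)"
  by (simp add: xord_mult xord_power nz t_nz xx_lead z_lead y_lead t_lead algebra_simps)

lemma mon_xlead: "xlead (mon a b k m) = [:0, 1:] ^ b * P0 ^ (k + s * m)"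
  by (simp add: xlead_mult xlead_power nz t_nz xx_lead z_lead y_lead t_lead power_add power_mult)

lemma mon_weight: "weight (mon a b k m) = [:of_nat (b + r * (k + s * m)), of_int (int (d * k + (d * s + e) * m) - int a):]"
  by (simp add: weight_def mon_xord mon_xlead degree_mult_eq degree_power_eq P0)

lemma V_vanishes: "h \<in> V N \<Longrightarrow> vanishes_below (- N) h"
proof (induction rule: V.induct)
  case V_zero
  then show ?case by (simp add: vanishes_below_def as_series_simps)
next
  case (V_step h k m a c b)
  have "vanishes_below (- N) (kc c * mon a b k m)"
  proof (cases "c = 0")
    case True
    then show ?thesis by (simp add: kc_0 vanishes_below_def as_series_simps)
  next
    case False
    note c = kc_lead(1,3)[OF this]
    have "kc c * mon a b k m \<noteq> 0" using c mon_nz[of a b k m] by (simp only: mult_eq_0_iff) simp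
    moreover have "- N \<le> xord (kc c * mon a b k m)"
      using V_step(2) unfolding xord_mult[OF c(2) mon_nz] mon_xord c(1) by simp
    ultimately show ?thesis by (rule vanishes_below_xord)
  qed
  then show ?case using V_step by (intro vanishes_below_add)
qed

lemma top_form_mon:
  "top_form N p = (\<Sum>i\<le>degree p. kc (coeff p i) * mon (nat (int (B (level N)) - N)) i (level N mod s) (level N div s))"
  unfolding top_form_def zpoly_def peval_sum[OF ring_morphism_kc] Y_def
  by (simp add: sum_distrib_left sum_distrib_right mult_ac)

lemma top_form_lead:
  assumes "p \<noteq> 0"
  shows "top_form N p \<noteq> 0" "xord (top_form N p) = - N" "xlead (top_form N p) = P0 ^ level N * p"
proof -
  let ?m = "mon (nat (int (B (level N)) - N)) 0 (level N mod s) (level N div s)"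
  have eq: "top_form N p = ?m * zpoly p" by (simp add: top_form_def Y_def mult_ac)
  have N: "N \<le> int (B (level N))" by (rule level_le)
  show "top_form N p \<noteq> 0" unfolding eq using mon_nz zpoly_lead(3)[OF assms] by (simp only: mult_eq_0_iff) simp
  show "xord (top_form N p) = - N"
    unfolding eq using N xord_mult[OF mon_nz zpoly_lead(3)[OF assms]]
    by (simp only: mon_xord zpoly_lead(1)[OF assms]) (simp add: B_def)
  have "level N mod s + s * (level N div s) = level N" by simp
  then show "xlead (top_form N p) = P0 ^ level N * p"
    unfolding eq xlead_mult[OF mon_nz zpoly_lead(3)[OF assms]] mon_xlead zpoly_lead(2)[OF assms] by simp
qed

text \<open>Some \<open>V N\<close> contains h. If the representative at level N is 0, then h lies
  in \<open>V (N - 1)\<close>; this descent cannot pass the actual pole order of h, because elements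
  of \<open>V N\<close> have pole order at most N.\<close>

lemma normal_form:
  assumes "h \<in> C" "h \<noteq> 0"
  obtains N p where "p \<noteq> 0" "h - top_form N p \<in> V (N - 1)" "weight h = [:of_nat (r * level N + degree p), of_int N:]"
    "xord h = - N"
proof -
  obtain N0 where N0: "h \<in> V N0" using V_exhaust[OF assms(1)] .
  have "\<exists>N p. p \<noteq> 0 \<and> h - top_form N p \<in> V (N - 1)" if "h \<in> V (int n - xord h - 1)" for n
    using that
  proof (induction n)
    case 0
    have "vanishes_below (- (int 0 - xord h - 1)) h" using 0 by (rule V_vanishes)
    then have "vanishes_below (xord h + 1) h" by (simp add: add.commute)
    then have "xlead h = 0" by (simp add: vanishes_below_def xlead_def)
    then show ?case using xlead_nz[OF assms(2)] by simp
  next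
    case (Suc n)
    define N where "N = int (Suc n) - xord h - 1"
    obtain p where p: "h - top_form N p \<in> V (N - 1)" using V_top[OF Suc(2)] by (auto simp: N_def)
    show ?case
    proof (cases "p = 0")
      case True
      then have "h \<in> V (N - 1)" using p by (simp add: top_form_def ring_morphism_0[OF ring_morphism_zpoly])
      then show ?thesis using Suc.IH by (simp add: N_def algebra_simps)
    qed (use p in blast)
  qed
  moreover have "h \<in> V (int (nat (N0 + xord h + 1)) - xord h - 1)" using V_mono[OF N0] by simp
  ultimately obtain N p where p: "p \<noteq> 0" "h - top_form N p \<in> V (N - 1)" by blast
  note t = top_form_lead[OF p(1), of N]
  have "vanishes_below (xord (top_form N p) + 1) (h - top_form N p)"
    using V_vanishes[OF p(2)] by (simp add: t)
  note l = xord_leading[OF t(1) this]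
  then have "xord h = - N" "xlead h = P0 ^ level N * p" using t by simp_all
  then have "weight h = [:of_nat (r * level N + degree p), of_int N:]"
    using p(1) by (simp add: weight_def degree_mult_eq degree_power_eq P0 mult.commute)
  then show ?thesis using that p \<open>xord h = - N\<close> by blast
qed

text \<open>The analogue of \<open>V\<close> for the full weight. Membership asks for a presentation
  whose monomials all have weight at most v, which is more than a bound on the weight of the
  sum.\<close>

inductive_set W :: "rat poly \<Rightarrow> 'k fls poly set" for v :: "rat poly" where
  W_zero: "0 \<in> W v"
| W_step: "h \<in> W v \<Longrightarrow> weight (mon a b k m) \<le> v \<Longrightarrow> kc c * mon a b k m + h \<in> W v"

lemma W_add: "g \<in> W v \<Longrightarrow> h \<in> W v \<Longrightarrow> g + h \<in> W v"
  by (induction rule: W.induct) (simp_all add: add.assoc W_step)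

lemma W_mon: "weight (mon a b k m) \<le> v \<Longrightarrow> kc c * mon a b k m \<in> W v"
  using W_step[OF W_zero, of a b k m v c] by simp

lemma W_sum: "(\<And>i. i \<in> I \<Longrightarrow> f i \<in> W v) \<Longrightarrow> sum f I \<in> W v"
  by (induction I rule: infinite_finite_induct) (simp_all add: W_zero W_add)

text \<open>The pole order is compared first, so a strictly smaller one leaves j arbitrary.\<close>

lemma V_W: "h \<in> V (N - 1) \<Longrightarrow> h \<in> W [:of_nat j, of_int N:]"
proof (induction rule: V.induct)
  case (V_step h k m a c b)
  have "weight (mon a b k m) \<le> [:of_nat j, of_int N:]"
    unfolding mon_weight lex_le of_int_less_iff using V_step(2) by simp
  then show ?case using V_step by (intro W_step)
qed (rule W_zero)

lemma level_weight: "weight (mon (nat (int (B (level N)) - N)) i (level N mod s) (level N div s))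
  = [:of_nat (r * level N + i), of_int N:]"
proof -
  have "level N mod s + s * (level N div s) = level N" by simp
  moreover have "int (d * (level N mod s) + (d * s + e) * (level N div s)) - int (nat (int (B (level N)) - N)) = N"
    using level_le[of N] by (simp add: B_def)
  ultimately show ?thesis unfolding mon_weight by (simp only: add.commute)
qed

lemma weight_W: "h \<in> C \<Longrightarrow> h \<noteq> 0 \<Longrightarrow> h \<in> W (weight h)"
proof -
  assume "h \<in> C" "h \<noteq> 0"
  then obtain N p where p: "p \<noteq> 0" "h - top_form N p \<in> V (N - 1)"
    "weight h = [:of_nat (r * level N + degree p), of_int N:]"
    using normal_form by metis
  have "top_form N p \<in> W (weight h)"
    unfolding top_form_mon by (intro W_sum W_mon) (simp only: level_weight p(3) lex_le, simp)
  then show ?thesis using W_add[OF _ V_W[OF p(2), of "r * level N + degree p"]] p(3) by force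
qed

lemma W_sum_form:
  "h \<in> W v \<Longrightarrow> \<exists>(n :: nat) c \<mu>. h = (\<Sum>i<n. c i * \<mu> i) \<and>
     (\<forall>i<n. c i \<in> range kc \<and> (\<exists>a b k m. \<mu> i = mon a b k m) \<and> weight (\<mu> i) \<le> v)"
proof (induction rule: W.induct)
  case W_zero
  show ?case by (intro exI[of _ 0]) simp
next
  case (W_step h a b k m c)
  then obtain n :: nat and c' \<mu> where h: "h = (\<Sum>i<n. c' i * \<mu> i)"
     "\<forall>i<n. c' i \<in> range kc \<and> (\<exists>a b k m. \<mu> i = mon a b k m) \<and> weight (\<mu> i) \<le> v" by blast
  let ?c = "c'(n := kc c)" and ?\<mu> = "\<mu>(n := mon a b k m)"
  have "kc c * mon a b k m + h = (\<Sum>i<Suc n. ?c i * ?\<mu> i)" unfolding h(1) by simp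
  moreover have "\<forall>i<Suc n. ?c i \<in> range kc \<and> (\<exists>a b k m. ?\<mu> i = mon a b k m) \<and> weight (?\<mu> i) \<le> v"
    using h(2) W_step(2) by (auto simp: less_Suc_eq)
  ultimately show ?case by blast
qed

text \<open>Such an element has negative pole order, or is without pole and has a constant value c
  at x = 0. In both cases h, or h - c, lies in \<open>V (- 1)\<close>, where every monomial contains
  an x, so that x can be divided out inside the ring.\<close>

lemma weight_nonpos:
  assumes "h \<in> C" "h \<noteq> 0" "weight h \<le> 0"
  shows "\<exists>c h'. h' \<in> C \<and> h = kc c + xx * h'"
proof -
  have neg: "\<exists>h'\<in>C. h = xx * h'" if "h \<in> V (- 1)" for h
    using that
  proof (induction rule: V.induct)
    case V_zero
    then show ?case by (intro bexI[of _ 0]) simp_all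
  next
    case (V_step h k m a c b)
    then obtain h' where h': "h' \<in> C" "h = xx * h'" by blast
    have "int a \<ge> 1" using V_step(2) of_nat_0_le_iff[of "d * k + (d * s + e) * m"] by linarith
    then obtain a' where "a = Suc a'" by (cases a) auto
    then have "kc c * mon a b k m + h = xx * (kc c * mon a' b k m + h')" by (simp add: h' algebra_simps)
    moreover have "kc c * mon a' b k m + h' \<in> C" using h' gens by simp
    ultimately show ?case by blast
  qed
  obtain N p where p: "p \<noteq> 0" "h - top_form N p \<in> V (N - 1)"
    "weight h = [:of_nat (r * level N + degree p), of_int N:]"
    using normal_form[OF assms(1,2)] by metis
  have "[:of_nat (r * level N + degree p), of_int N:] \<le> [:0, 0 :: rat:]" using assms(3) p(3) by simp
  then have N: "N < 0 \<or> N = 0 \<and> degree p = 0" unfolding lex_le by (auto simp del: of_nat_add of_nat_mult)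
  show ?thesis
  proof (cases "N < 0")
    case True
    have "top_form N p \<in> V N"
      unfolding top_form_mon using level_nonpos[of N] True
      by (intro V_sum V_mon) (simp add: B_0)
    then have "h \<in> V N" using V_add[OF _ V_mono[OF p(2), of N]] by force
    then have "h \<in> V (- 1)" by (rule V_mono) (use True in simp)
    from neg[OF this] show ?thesis by (metis kc_0 add_0)
  next
    case False
    then have N0: "N = 0" "degree p = 0" using N by auto
    then obtain c where c: "p = [:c:]" by (metis degree_eq_zeroE)
    have "top_form N p = kc c" using N0 c by (simp add: top_form_def level_nonpos B_0 Y_def zpoly_simps)
    then have "h - kc c \<in> V (- 1)" using p(2) N0 by simp
    from neg[OF this] show ?thesis by (metis add.commute diff_add_cancel)
  qed
qed

sublocale weighted_ring C "range kc" xx zz y t weight d e r s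
proof
  show "c \<in> C" if "c \<in> range kc" for c using that gens by auto
  show "xx \<in> C" "zz \<in> C" "y \<in> C" "t \<in> C" by (rule gens)+
  show "xx \<noteq> (0 :: 'k fls poly)" "zz \<noteq> (0 :: 'k fls poly)" "y \<noteq> 0" "t \<noteq> 0" by (rule nz t_nz)+
  show "weight (a * b) = weight a + weight b" if "a \<noteq> 0" "b \<noteq> 0" for a b :: "'k fls poly"
    using that by (rule weight_mult)
  show "weight (a + b) \<le> max (weight a) (weight b)" if "a \<noteq> 0" "b \<noteq> 0" "a + b \<noteq> 0" for a b :: "'k fls poly"
    using that by (rule weight_add)
  show "weight c = 0" if c: "c \<in> range kc" "c \<noteq> 0" for c :: "'k fls poly"
  proof -
    obtain c' where c': "c = kc c'" using c(1) by blast
    then have "c' \<noteq> 0" using c(2) kc_0 by auto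
    then show ?thesis by (simp add: weight_def c' kc_lead)
  qed
  show "of_nat n \<in> range (kc :: 'k \<Rightarrow> _)" for n
  proof -
    have "of_nat n = kc (of_nat n :: 'k)"
      by (induction n) (simp_all add: ring_morphism_simps[OF ring_morphism_kc])
    then show ?thesis by blast
  qed
  show "weight (xx :: 'k fls poly) = [:0, - 1:]" "weight (zz :: 'k fls poly) = 1"
    by (simp_all add: weight_def xx_lead z_lead one_pCons)
  show wy: "weight y = [:of_nat r, of_nat d:]" using mon_weight[of 0 0 1 0] by simp
  show wt: "weight t = [:of_nat (r * s), of_nat (d * s + e):]" using mon_weight[of 0 0 0 1] by simp
  show "d > 0" "e > 0" "r \<ge> 2" "s \<ge> 2" by (rule pos)+
  show "\<exists>u. xx ^ d * y = zz ^ r + u \<and> u \<in> C \<and> (u = 0 \<or> weight u < weight (zz ^ r :: 'k fls poly))"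
  proof (intro exI[of _ "xx ^ d * y - zz ^ r"] conjI)
    show "xx ^ d * y - zz ^ r = 0 \<or> weight (xx ^ d * y - zz ^ r) < weight (zz ^ r :: 'k fls poly)"
    proof (rule disj_if_not)
      assume nz': "xx ^ d * y - zz ^ r \<noteq> 0"
      have w: "weight (zz ^ r :: 'k fls poly) = [:of_nat r, of_int 0:]" using mon_weight[of 0 r 0 0] by simp
      \<comment> \<open>Passing from P0 to z^r does not change the pole order 0; only the degree in
        z drops, since P0 is monic of degree r.\<close>
      obtain p where p: "P0 = [:0, 1:] ^ r + p" "p = 0 \<or> degree p < r"
      proof
        show "P0 = [:0, 1:] ^ r + (P0 - [:0, 1:] ^ r)" by simp
        have m: "[:0, 1:] ^ r = (monom 1 r :: 'k poly)" by (simp add: monom_altdef)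
        have "P0 - [:0, 1:] ^ r = 0" if "\<not> degree (P0 - [:0, 1:] ^ r) < r"
        proof -
          have "degree (P0 - [:0, 1:] ^ r) \<le> r" unfolding m by (intro degree_diff_le) (simp_all add: P0 degree_monom_eq)
          then have "degree (P0 - [:0, 1:] ^ r) = r" using that by simp
          moreover have "coeff (P0 - [:0, 1:] ^ r) r = 0" unfolding m using P0 by simp
          ultimately show ?thesis by (metis leading_coeff_0_iff)
        qed
        then show "P0 - [:0, 1:] ^ r = 0 \<or> degree (P0 - [:0, 1:] ^ r) < r" by blast
      qed
      have z: "zpoly P0 = zz ^ r + zpoly p"
        unfolding p(1) by (simp only: ring_morphism_simps[OF ring_morphism_zpoly] zpoly_simps)
      define v where "v = xx ^ d * y - zpoly P0"
      have eq: "xx ^ d * y - zz ^ r = zpoly p + v" by (simp add: v_def z)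
      have v: "vanishes_below 1 v" using V_vanishes[OF rel_y_mod] by (simp add: v_def)
      have zp: "vanishes_below 0 (zpoly p)" "as_series (zpoly p) $$ 0 = p"
        by (auto simp: vanishes_below_def as_series_zpoly)
      have "weight (xx ^ d * y - zz ^ r) < [:of_nat r, of_int 0:]"
      proof (rule weight_lessI[OF nz'])
        show "vanishes_below (- 0) (xx ^ d * y - zz ^ r)"
          unfolding eq using v zp by (simp add: vanishes_below_def as_series_simps)
        show "as_series (xx ^ d * y - zz ^ r) $$ (- 0) = 0 \<or> degree (as_series (xx ^ d * y - zz ^ r) $$ (- 0)) < r"
          unfolding eq using v zp p(2) by (simp add: vanishes_below_def as_series_simps)
      qed
      then show "weight (xx ^ d * y - zz ^ r) < weight (zz ^ r :: 'k fls poly)" by (simp only: w)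
    qed
  qed (simp_all add: gens)
  show "\<exists>u. xx ^ e * t = y ^ s + u \<and> u \<in> C \<and> (u = 0 \<or> weight u < weight (y ^ s))"
  proof (intro exI[of _ "xx ^ e * t - y ^ s"] conjI)
    show "xx ^ e * t - y ^ s = 0 \<or> weight (xx ^ e * t - y ^ s) < weight (y ^ s)"
    proof (rule disj_if_not)
      assume nz': "xx ^ e * t - y ^ s \<noteq> 0"
      have w: "weight (y ^ s) = [:of_nat (r * s), of_int (int (d * s)):]" using mon_weight[of 0 0 s 0] by simp
      have v: "vanishes_below (- (int d * (int s - 1))) (xx ^ e * t - y ^ s)" by (rule V_vanishes[OF rel_t_mod])
      \<comment> \<open>Here already the pole order drops, from d s to d (s - 1).\<close>
      have lt: "- int (d * s) < - (int d * (int s - 1))" using pos by (simp add: algebra_simps)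
      show "weight (xx ^ e * t - y ^ s) < weight (y ^ s)"
        unfolding w by (rule weight_lessI[OF nz']) (use v lt in \<open>auto simp: vanishes_below_def\<close>)
    qed
  qed (simp_all add: gens)
  show "\<exists>c a b k m. c \<in> range kc \<and> c \<noteq> 0 \<and> weight (mon a b k m) = weight h \<and>
      (h = c * mon a b k m \<or> weight (h - c * mon a b k m) < weight h)" if h: "h \<in> C" "h \<noteq> 0" for h
  proof -
    obtain N p where p: "p \<noteq> 0" "h - top_form N p \<in> V (N - 1)"
      "weight h = [:of_nat (r * level N + degree p), of_int N:]"
      using normal_form[OF h] by metis
    \<comment> \<open>Only the top term of p matters: top forms of p - q either vanish or have the
      same pole order and smaller degree in z.\<close>
    define q where "q = monom (lead_coeff p) (degree p)"
    define M where "M = mon (nat (int (B (level N)) - N)) (degree p) (level N mod s) (level N div s)"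
    have "q = [:lead_coeff p:] * [:0, 1:] ^ degree p" by (simp add: q_def monom_altdef)
    then have zq: "zpoly q = kc (lead_coeff p) * zz ^ degree p"
      by (simp only: ring_morphism_simps[OF ring_morphism_zpoly] zpoly_simps)
    have tq: "top_form N q = kc (lead_coeff p) * M"
      unfolding top_form_def zq M_def Y_def by (simp add: mult_ac)
    have w: "weight M = weight h" unfolding M_def level_weight p(3) ..
    have "h = kc (lead_coeff p) * M \<or> weight (h - kc (lead_coeff p) * M) < weight h"
    proof (rule disj_if_not)
      assume "h \<noteq> kc (lead_coeff p) * M"
      then have nz': "h - kc (lead_coeff p) * M \<noteq> 0" by simp
      have "top_form N p = top_form N (p - q) + top_form N q" by (simp flip: top_form_add)
      then have eq: "h - kc (lead_coeff p) * M = (h - top_form N p) + top_form N (p - q)"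
        by (simp add: tq)
      have 1: "vanishes_below (- N + 1) (h - top_form N p)" using V_vanishes[OF p(2)] by simp
      have 2: "vanishes_below (- N) (top_form N (p - q)) \<and>
        (as_series (top_form N (p - q)) $$ (- N) = 0 \<or> degree (as_series (top_form N (p - q)) $$ (- N)) < r * level N + degree p)"
      proof (cases "p - q = 0")
        case True
        then show ?thesis
          by (simp add: top_form_def ring_morphism_0[OF ring_morphism_zpoly] vanishes_below_def as_series_simps)
      next
        case False
        note t = top_form_lead[OF False, of N]
        have "degree (p - q) \<le> degree p" unfolding q_def by (intro degree_diff_le) (simp_all add: degree_monom_le)
        moreover have "degree (p - q) \<noteq> degree p"
        proof
          assume eq: "degree (p - q) = degree p"
          have "coeff (p - q) (degree p) = 0" by (simp add: q_def)
          then show False using False eq by (metis leading_coeff_0_iff)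
        qed
        ultimately have "degree (p - q) < degree p" by simp
        then have "degree (xlead (top_form N (p - q))) < r * level N + degree p"
          using False by (simp add: t degree_mult_eq degree_power_eq P0 mult.commute)
        then show ?thesis using vanishes_below_xord[OF t(1)] t(2) by (simp add: xlead_def)
      qed
      show "weight (h - kc (lead_coeff p) * M) < weight h"
        unfolding p(3)
      proof (rule weight_lessI[OF nz'])
        show "vanishes_below (- N) (h - kc (lead_coeff p) * M)"
          unfolding eq using 1 2 by (intro vanishes_below_add) (auto simp: vanishes_below_def)
        have "as_series (h - kc (lead_coeff p) * M) $$ (- N) = as_series (top_form N (p - q)) $$ (- N)"
          unfolding eq using 1 by (simp add: vanishes_below_def as_series_simps)
        then show "as_series (h - kc (lead_coeff p) * M) $$ (- N) = 0 \<or>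
          degree (as_series (h - kc (lead_coeff p) * M) $$ (- N)) < r * level N + degree p" using 2 by simp
      qed
    qed
    moreover have "kc (lead_coeff p) \<noteq> 0" using p(1) by (intro kc_lead) simp
    ultimately show ?thesis using w unfolding M_def by blast
  qed
  show "\<exists>I c \<mu>. finite (I :: nat set) \<and> h = (\<Sum>i\<in>I. c i * \<mu> i) \<and>
      (\<forall>i\<in>I. c i \<in> range kc \<and> (\<exists>a b k m. \<mu> i = mon a b k m) \<and> weight (\<mu> i) \<le> weight h)"
    if h: "h \<in> C" "h \<noteq> 0" for h
  proof -
    obtain n :: nat and c \<mu> where "h = (\<Sum>i<n. c i * \<mu> i)"
       "\<forall>i<n. c i \<in> range kc \<and> (\<exists>a b k m. \<mu> i = mon a b k m) \<and> weight (\<mu> i) \<le> weight h"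
      using W_sum_form[OF weight_W[OF h]] by blast
    then show ?thesis by (intro exI[of _ "{..<n}"] exI[of _ c] exI[of _ \<mu>]) auto
  qed
  show "\<exists>c h'. c \<in> range kc \<and> h' \<in> C \<and> h = c + xx * h'" if "h \<in> C" "h \<noteq> 0" "weight h \<le> 0" for h
    using weight_nonpos[OF that] by blast
qed

end

section \<open>Exponents are invariants\<close>

text \<open>The Hasse derivative, i.e. the coefficient of U^i in p(z + U); it replaces the i-th
  derivative divided by i! and makes sense in every characteristic.\<close>

definition hasse :: "nat \<Rightarrow> 'a::comm_ring_1 poly \<Rightarrow> 'a poly" where
  "hasse i p = coeff (subst1 [:[:0, 1:], 1:] p) i"

lemma hasse_add: "hasse i (p + q) = hasse i p + hasse i q"
  by (simp add: hasse_def ring_morphism_add[OF subst_morphism(1)])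

lemma hasse_mult: "hasse i (p * q) = (\<Sum>j\<le>i. hasse j p * hasse (i - j) q)"
  by (simp add: hasse_def ring_morphism_mult[OF subst_morphism(1)] coeff_mult)

lemma hasse_zero [simp]: "hasse i 0 = 0"
  by (simp add: hasse_def ring_morphism_0[OF subst_morphism(1)])

lemma subst1_pCons: "subst1 Z (pCons c p) = [:[:c:]:] + Z * subst1 Z p"
  by (simp only: subst1_def peval_pCons[OF ring_morphism_lift2])

lemma hasse_pCons:
  "hasse 0 (pCons c p) = pCons c (hasse 0 p)"
  "hasse (Suc i) (pCons c p) = pCons 0 (hasse (Suc i) p) + hasse i p"
  unfolding hasse_def subst1_pCons by simp_all

lemma coeff_hasse: "coeff (hasse i p) m = of_nat ((m + i) choose i) * coeff p (m + i)"
proof (induction p arbitrary: i m)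
  case (pCons c p)
  show ?case
  proof (cases i)
    case 0
    then show ?thesis by (simp add: hasse_pCons pCons coeff_pCons split: nat.splits)
  next
    case (Suc j)
    show ?thesis
      by (cases m) (simp_all add: Suc hasse_pCons pCons coeff_pCons algebra_simps)
  qed
qed simp

lemma hasse_0: "hasse 0 p = p"
  by (intro poly_eqI) (simp add: coeff_hasse)

lemma hasse_const: "i > 0 \<Longrightarrow> hasse i [:c:] = 0"
  by (intro poly_eqI) (simp add: coeff_hasse coeff_pCons split: nat.splits)

lemma hasse_cmult: "hasse i ([:c:] * p) = [:c:] * hasse i p"
  by (intro poly_eqI) (simp add: coeff_hasse)

lemma hasse_hasse: "hasse i (hasse j p) = of_nat ((i + j) choose i) * hasse (i + j) p"
proof (rule poly_eqI)
  fix m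
  have "((m + i + j) choose (i + j)) * ((i + j) choose j) = ((m + i + j) choose j) * ((m + i + j - j) choose (i + j - j))"
    by (rule choose_mult) auto
  moreover have "(i + j) choose j = (i + j) choose i" using binomial_symmetric[of j "i + j"] by simp
  ultimately have "((m + i) choose i) * ((m + i + j) choose j) = ((i + j) choose i) * ((m + (i + j)) choose (i + j))"
    by (simp add: mult.commute add.assoc)
  then have "of_nat ((m + i) choose i) * of_nat ((m + i + j) choose j) =
      (of_nat ((i + j) choose i) * of_nat ((m + (i + j)) choose (i + j)) :: 'a)"
    by (metis of_nat_mult)
  then show "coeff (hasse i (hasse j p)) m = coeff (of_nat ((i + j) choose i) * hasse (i + j) p) m"
    by (simp add: coeff_hasse of_nat_poly mult.assoc[symmetric]) (simp add: add.assoc)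
qed

lemma hasse_high: "i > degree p \<Longrightarrow> hasse i p = 0"
  by (intro poly_eqI) (simp add: coeff_hasse coeff_eq_0)

lemma degree_0_if_hasse_0: "(\<And>i. i > 0 \<Longrightarrow> hasse i p = 0) \<Longrightarrow> degree p = 0"
proof (rule ccontr)
  assume h: "\<And>i. i > 0 \<Longrightarrow> hasse i p = 0" and "degree p \<noteq> 0"
  then have "coeff (hasse (degree p) p) 0 = 0" by simp
  then show False using \<open>degree p \<noteq> 0\<close> by (simp add: coeff_hasse leading_coeff_0_iff)
qed

lemma hasse_linear: "hasse i [:0, 1:] = (if i = 0 then [:0, 1:] else if i = 1 then 1 else 0)"
  by (auto intro!: poly_eqI simp: coeff_hasse coeff_pCons split: nat.splits)

context danielewski
begin

text \<open>The coefficient of U^i in the translate of a under z \<mapsto> z + x^(d+e) U.\<close>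

definition std :: "nat \<Rightarrow> 'k fls poly \<Rightarrow> 'k fls poly" where
  "std i a = xx ^ ((d + e) * i) * hasse i a"

lemma xx_power_const: "xx ^ n = [:fls_X ^ n:]"
  by (simp add: xx_def const_power)

lemma hasse_xx_mult: "hasse i (xx ^ n * p) = xx ^ n * hasse i p"
  unfolding xx_power_const by (rule hasse_cmult)

lemma std_add: "std i (a + b) = std i a + std i b"
  by (simp add: std_def hasse_add algebra_simps)

lemma std_0: "std 0 a = a"
  by (simp add: std_def hasse_0)

lemma std_mult: "std i (a * b) = (\<Sum>j\<le>i. std j a * std (i - j) b)"
proof -
  have "xx ^ ((d + e) * i) * (hasse j a * hasse (i - j) b) = std j a * std (i - j) b" if "j \<le> i" for j
  proof -
    have "(d + e) * i = (d + e) * j + (d + e) * (i - j)" using that by (simp flip: add_mult_distrib2)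
    then show ?thesis by (simp only: std_def power_add) (simp add: mult_ac)
  qed
  then show ?thesis by (simp add: std_def[of i] hasse_mult sum_distrib_left)
qed

lemma std_comp: "std i (std j a) = of_nat ((i + j) choose i) * std (i + j) a"
  by (simp only: std_def hasse_xx_mult) (simp add: hasse_hasse power_add add_mult_distrib2 mult_ac)

lemma std_const: "i > 0 \<Longrightarrow> std i (kc c) = 0" "i > 0 \<Longrightarrow> std i xx = 0"
  by (simp_all add: std_def kc_def xx_def hasse_const)

lemma std_xx_mult: "std i (xx ^ n * a) = xx ^ n * std i a"
  by (simp only: std_def hasse_xx_mult mult.left_commute)

lemma std_1: "i > 0 \<Longrightarrow> std i 1 = 0"
  using std_const(1)[of i 1] by (simp add: kc_1)

lemma std_uminus: "std i (- a) = - std i a"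
proof -
  have "std i 0 = 0" by (simp add: std_def)
  then show ?thesis using std_add[of i a "- a"] by (simp add: add_eq_0_iff)
qed

text \<open>By the Leibniz rule the elements whose Hasse derivatives all stay in k[x,z] form a
  subring, and it contains the generators.\<close>

lemma hasse_eval2: "hasse i (eval2 kc xx zz p) \<in> range (eval2 kc xx zz :: 'k poly poly \<Rightarrow> 'k fls poly)"
proof -
  let ?E = "range (eval2 kc xx zz) :: 'k fls poly set"
  interpret E: unital_subring ?E by (rule unital_subring_range[OF eval_morphism(2)[OF ring_morphism_kc]])
  define U where "U = {a \<in> ?E. \<forall>i. hasse i a \<in> ?E}"
  have 1: "hasse i (1 :: 'k fls poly) = (if i = 0 then 1 else 0)" for i
    using hasse_0[of 1] hasse_const[of i "1 :: 'k fls"] by (auto simp: one_pCons)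
  have um: "hasse i (- a) = - hasse i a" for i and a :: "'k fls poly"
    using hasse_add[of i a "- a"] by (simp add: add_eq_0_iff)
  have "unital_subring U"
    by standard (auto simp: U_def hasse_add hasse_mult um 1 intro!: E.sum_mem E.mult_mem)
  moreover have e: "kc c \<in> ?E" "xx \<in> ?E" "zz \<in> ?E" for c
  proof -
    note ev = eval_pCons[OF ring_morphism_kc] eval_0[OF ring_morphism_kc] eval_1[OF ring_morphism_kc]
      ring_morphism_0[OF ring_morphism_kc] ring_morphism_1[OF ring_morphism_kc]
    have "eval2 kc xx zz [:[:c:]:] = kc c" "eval2 kc xx zz [:[:0, 1:]:] = (xx :: 'k fls poly)"
      "eval2 kc xx zz [:0, 1:] = (zz :: 'k fls poly)"
      by (simp_all add: ev)
    then show "kc c \<in> ?E" "xx \<in> ?E" "zz \<in> ?E" by (metis rangeI)+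
  qed
  have h: "hasse i (kc c) = (if i = 0 then kc c else 0)" "hasse i xx = (if i = 0 then xx else (0 :: 'k fls poly))"
    "hasse i zz = (if i = 0 then zz else if i = 1 then 1 else (0 :: 'k fls poly))" for i c
    by (simp_all add: hasse_0 hasse_const kc_def xx_def zz_def hasse_linear)
  have "kc c \<in> U" "xx \<in> U" "zz \<in> U" for c
    unfolding U_def mem_Collect_eq h using e by simp_all
  ultimately have "eval2 kc xx zz p \<in> U"
    by (intro eval_mem(2)[OF ring_morphism_kc])
  then show ?thesis by (simp add: U_def)
qed

text \<open>The exponent \<open>d + e\<close> is just large enough for \<open>std\<close> to preserve the ring.\<close>

lemma std_mem: "a \<in> C \<Longrightarrow> std i a \<in> C"
proof -
  assume a: "a \<in> C"
  \<comment> \<open>For k, x, z and y more is true than for t: the positive terms are divisible by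
    x^e. This carries over to Q = x^e t by the ring operations, and dividing by x^e leaves the claim
    for t.\<close>
  define U where "U = {a \<in> C. \<forall>i>0. \<exists>b\<in>C. std i a = xx ^ e * b}"
  have mem: "std i c \<in> C" if c: "c \<in> U" for i c
  proof (cases "i = 0")
    case True
    with c show ?thesis by (simp add: U_def std_0)
  next
    case False
    then obtain b where "b \<in> C" "std i c = xx ^ e * b" using c unfolding U_def by blast
    then show ?thesis by simp
  qed
  have "unital_subring U"
  proof
    show "1 \<in> U" by (auto simp: U_def std_1 intro!: bexI[of _ 0])
    show "- a \<in> U" if "a \<in> U" for a
    proof -
      have "\<exists>b\<in>C. std i (- a) = xx ^ e * b" if i: "i > 0" for i
      proof -
        obtain b where "b \<in> C" "std i a = xx ^ e * b" using \<open>a \<in> U\<close> i unfolding U_def by blast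
        then show ?thesis by (intro bexI[of _ "- b"]) (simp_all add: std_uminus)
      qed
      then show ?thesis using that by (simp add: U_def)
    qed
    fix a b assume ab: "a \<in> U" "b \<in> U"
    show "a + b \<in> U"
    proof -
      have "\<exists>c\<in>C. std i (a + b) = xx ^ e * c" if i: "i > 0" for i
      proof -
        obtain a' b' where "a' \<in> C" "std i a = xx ^ e * a'" "b' \<in> C" "std i b = xx ^ e * b'"
          using ab i unfolding U_def by blast
        then show ?thesis by (intro bexI[of _ "a' + b'"]) (simp_all add: std_add algebra_simps)
      qed
      then show ?thesis using ab by (simp add: U_def)
    qed
    show "a * b \<in> U"
    proof -
      have "\<exists>c\<in>C. std i (a * b) = xx ^ e * c" if i: "i > 0" for i
      proof -
        have "\<exists>c\<in>C. std j a * std (i - j) b = xx ^ e * c" if "j \<le> i" for j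
        proof (cases "j = 0")
          case True
          obtain b' where "b' \<in> C" "std i b = xx ^ e * b'" using ab i unfolding U_def by blast
          then show ?thesis using True mem[OF ab(1)] by (intro bexI[of _ "std j a * b'"]) (simp_all add: mult_ac)
        next
          case False
          then obtain a' where "a' \<in> C" "std j a = xx ^ e * a'" using ab unfolding U_def by blast
          then show ?thesis using mem[OF ab(2)] by (intro bexI[of _ "a' * std (i - j) b"]) (simp_all add: mult_ac)
        qed
        then obtain c where c: "\<And>j. j \<le> i \<Longrightarrow> c j \<in> C \<and> std j a * std (i - j) b = xx ^ e * c j" by metis
        have "std i (a * b) = xx ^ e * (\<Sum>j\<le>i. c j)" unfolding std_mult sum_distrib_left
          by (intro sum.cong refl) (use c in auto)
        moreover have "(\<Sum>j\<le>i. c j) \<in> C" by (rule sum_mem) (use c in auto)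
        ultimately show ?thesis by blast
      qed
      then show ?thesis using ab by (simp add: U_def)
    qed
  qed
  moreover have "kc c \<in> U" for c using gens by (auto simp: U_def std_const intro!: bexI[of _ 0])
  moreover have "xx \<in> U" using gens by (auto simp: U_def std_const intro!: bexI[of _ 0])
  moreover have "zz \<in> U"
  proof -
    have "std i zz = xx ^ e * (if i = 1 then xx ^ d else 0)" if "i > 0" for i
      using that by (simp add: std_def zz_def hasse_linear power_add)
    moreover have "(if i = 1 then xx ^ d else 0) \<in> C" for i :: nat by simp
    ultimately show ?thesis using gens unfolding U_def by blast
  qed
  moreover have "y \<in> U"
  proof -
    have "\<exists>b\<in>C. std i y = xx ^ e * b" if i: "i > 0" for i
    proof -
      obtain j where j: "i = Suc j" using i by (cases i) auto
      have "xx ^ d * hasse i y = hasse i (eval2 kc xx zz P)" by (simp flip: hasse_xx_mult add: xx_yy)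
      then obtain p where p: "xx ^ d * hasse i y = eval2 kc xx zz p" using hasse_eval2[of i P] by auto
      \<comment> \<open>One of the i factors x^(d+e) is split: x^d clears the denominator of y and
        x^e is what membership in U asks for.\<close>
      have "std i y = xx ^ e * (xx ^ ((d + e) * j) * (xx ^ d * hasse i y))"
        by (simp add: std_def j power_add mult_ac)
      moreover have "xx ^ ((d + e) * j) * eval2 kc xx zz p \<in> C"
        by (intro mult_mem power_mem gens eval2_mem)
      ultimately show ?thesis unfolding p by blast
    qed
    then show ?thesis using gens by (simp add: U_def)
  qed
  ultimately have "eval3 kc xx zz y Q \<in> U" by (intro eval_mem(3)[OF ring_morphism_kc])
  then have t: "std i t \<in> C" if i: "i > 0" for i
  proof -
    obtain b where b: "b \<in> C" "std i (xx ^ e * t) = xx ^ e * b"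
      using \<open>eval3 kc xx zz y Q \<in> U\<close> i unfolding U_def xx_tt by blast
    then have "std i t = b" by (simp add: std_xx_mult)
    then show ?thesis using b by simp
  qed
  define T where "T = {a \<in> C. \<forall>i. std i a \<in> C}"
  have UT: "U \<subseteq> T"
  proof
    fix a assume a: "a \<in> U"
    then show "a \<in> T" using mem[OF a] by (simp add: T_def U_def)
  qed
  have "unital_subring T"
  proof
    show "1 \<in> T" using UT \<open>unital_subring U\<close> unital_subring.one_mem by blast
  qed (auto simp: T_def std_add std_mult std_uminus intro!: sum_mem)
  moreover have "std i t \<in> C" for i
    by (cases "i = 0") (simp_all add: t std_0 gens)
  then have "t \<in> T" by (simp add: T_def gens)
  ultimately have "ev P Q d e H \<in> T" for H
    unfolding ev_def using UT \<open>\<And>c. kc c \<in> U\<close> \<open>xx \<in> U\<close> \<open>zz \<in> U\<close> \<open>y \<in> U\<close>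
    by (intro eval_mem(4)[OF ring_morphism_kc]) auto
  then show ?thesis using a by (auto simp: SS_def T_def)
qed

text \<open>The ring lies in k[x, 1/x, z]; derivations and isomorphisms of it are therefore computed
  from their values on x and z after clearing a power of x.\<close>

lemma laurent:
  assumes "a \<in> C"
  shows "\<exists>M p. xx ^ M * a = eval2 kc xx zz p"
proof -
  note ev = eval_pCons[OF ring_morphism_kc] eval_0[OF ring_morphism_kc] eval_1[OF ring_morphism_kc]
    ring_morphism_0[OF ring_morphism_kc] ring_morphism_1[OF ring_morphism_kc]
  note m = ring_morphism_simps[OF eval_morphism(2)[OF ring_morphism_kc]]
  have x: "eval2 kc xx zz ([:[:0, 1:]:] ^ n) = (xx ^ n :: 'k fls poly)" for n by (simp add: m ev)
  define U where "U = {a :: 'k fls poly. \<exists>M p. xx ^ M * a = eval2 kc xx zz p}"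
  have UI: "a \<in> U" if "xx ^ M * a = eval2 kc xx zz p" for a :: "'k fls poly" and M p
    using that by (auto simp: U_def)
  have U: "unital_subring U"
  proof
    show "1 \<in> U" by (rule UI[of 0 _ 1]) (simp add: ev)
    fix a b :: "'k fls poly" assume "a \<in> U" "b \<in> U"
    then obtain M p N q where pq: "xx ^ M * a = eval2 kc xx zz p" "xx ^ N * b = eval2 kc xx zz q"
      by (auto simp: U_def)
    show "a * b \<in> U" by (rule UI[of "M + N" _ "p * q"]) (simp add: m power_add mult_ac flip: pq)
    show "a + b \<in> U"
    proof (rule UI)
      have "xx ^ (M + N) * (a + b) = xx ^ N * (xx ^ M * a) + xx ^ M * (xx ^ N * b)"
        by (simp add: power_add algebra_simps)
      then show "xx ^ (M + N) * (a + b) = eval2 kc xx zz ([:[:0, 1:]:] ^ N * p + [:[:0, 1:]:] ^ M * q)"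
        by (simp only: pq m(3,4) x)
    qed
  next
    fix a :: "'k fls poly" assume "a \<in> U"
    then obtain M p where "xx ^ M * a = eval2 kc xx zz p" by (auto simp: U_def)
    then show "- a \<in> U" by (intro UI[of M _ "- p"]) (simp add: m)
  qed
  have "kc c \<in> U" for c by (rule UI[of 0 _ "[:[:c:]:]"]) (simp add: ev)
  moreover have "xx \<in> U" by (rule UI[of 0 _ "[:[:0, 1:]:]"]) (simp add: ev)
  moreover have "zz \<in> U" by (rule UI[of 0 _ "[:0, 1:]"]) (simp add: ev)
  moreover have y: "y \<in> U" by (rule UI[of d _ P]) (rule xx_yy)
  moreover have "t \<in> U"
  proof -
    have "xx ^ e * t \<in> U" unfolding xx_tt by (intro eval_mem(3)[OF ring_morphism_kc U]) fact+
    then obtain M p where "xx ^ M * (xx ^ e * t) = eval2 kc xx zz p" by (auto simp: U_def)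
    then show ?thesis by (intro UI[of "M + e" _ p]) (simp add: power_add mult_ac)
  qed
  ultimately have "ev P Q d e H \<in> U" for H
    unfolding ev_def by (intro eval_mem(4)[OF ring_morphism_kc U])
  then show ?thesis using assms by (auto simp: SS_def U_def)
qed

lemma as_series_degree: "degree (as_series h $$ n) \<le> degree h"
  unfolding as_series_nth by (rule degree_le) (simp add: coeff_map_poly coeff_eq_0)

text \<open>A pole forces a positive level, so the leading coefficient is divisible by P0 and has
  degree at least r in z.\<close>

lemma low_degree_integral:
  assumes "h \<in> C" "h \<noteq> 0" "degree h < r"
  shows "xord h \<ge> 0"
proof -
  obtain N and p :: "'k poly" where p: "p \<noteq> 0" "weight h = [:of_nat (r * level N + degree p), of_int N:]" "xord h = - N"
    using normal_form[OF assms(1,2)] by blast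
  then have "of_nat (degree (xlead h)) = (of_nat (r * level N + degree p) :: rat)" unfolding weight_def by simp
  then have "degree (xlead h) = r * level N + degree p" by (simp only: of_nat_eq_iff)
  then have "r * level N < r * 1" using as_series_degree[of h "xord h"] assms(3) unfolding xlead_def by linarith
  then have "level N = 0" by (simp only: mult_less_cancel1) simp
  then show ?thesis using level_pos[of N] p(3) by fastforce
qed

lemma constant_mod_x:
  assumes "h \<in> C" "h \<noteq> 0" "degree h = 0"
  shows "\<exists>c h'. h' \<in> C \<and> h = kc c + xx * h'"
proof (rule weight_nonpos[OF assms(1,2)])
  have "xord h \<ge> 0" using low_degree_integral[OF assms(1,2)] assms(3) pos by simp
  moreover have "degree (xlead h) = 0" using as_series_degree[of h "xord h"] assms(3) by (simp add: xlead_def)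
  ultimately have "weight h \<le> [:0, 0:]" unfolding weight_def lex_le by auto
  then show "weight h \<le> 0" by simp
qed

end

section \<open>Transport of the standard higher derivation along an isomorphism\<close>

definition iso_on :: "'k::field fls poly set \<Rightarrow> 'k fls poly set \<Rightarrow> ('k fls poly \<Rightarrow> 'k fls poly) \<Rightarrow> ('k fls poly \<Rightarrow> 'k fls poly) \<Rightarrow> bool" where
  "iso_on S S' f g \<longleftrightarrow> (\<forall>a\<in>S. f a \<in> S' \<and> g (f a) = a) \<and> (\<forall>b\<in>S'. g b \<in> S \<and> f (g b) = b) \<and>
     (\<forall>a\<in>S. \<forall>b\<in>S. f (a + b) = f a + f b \<and> f (a * b) = f a * f b) \<and> (\<forall>c. f (kc c) = kc c)"

lemma iso_onD:
  assumes "iso_on S S' f g"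
  shows "a \<in> S \<Longrightarrow> f a \<in> S'" "a \<in> S \<Longrightarrow> g (f a) = a" "b \<in> S' \<Longrightarrow> g b \<in> S" "b \<in> S' \<Longrightarrow> f (g b) = b"
    "a \<in> S \<Longrightarrow> a' \<in> S \<Longrightarrow> f (a + a') = f a + f a'" "a \<in> S \<Longrightarrow> a' \<in> S \<Longrightarrow> f (a * a') = f a * f a'" "f (kc c) = kc c"
  using assms by (auto simp: iso_on_def)

lemma iso_on_sym:
  assumes f: "iso_on S S' f g" and S: "unital_subring S" and k: "\<And>c. kc c \<in> S"
  shows "iso_on S' S g f"
proof -
  interpret unital_subring S by fact
  note D = iso_onD[OF f]
  have "g (b + b') = g b + g b'" "g (b * b') = g b * g b'" if "b \<in> S'" "b' \<in> S'" for b b'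
  proof -
    have "f (g b + g b') = b + b'" "f (g b * g b') = b * b'" using that by (simp_all add: D)
    then show "g (b + b') = g b + g b'" "g (b * b') = g b * g b'"
      using that D(2)[of "g b + g b'"] D(2)[of "g b * g b'"] by (simp_all add: D(3))
  qed
  moreover have "g (kc c) = kc c" for c using D(2)[OF k[of c]] by (simp add: D(7))
  ultimately show ?thesis unfolding iso_on_def using D by simp
qed

text \<open>The exponents e and e' are independent, so that an isomorphism and its inverse are both
  instances.\<close>

locale danielewski_iso = A: danielewski P Q d e r s + C: danielewski P Q d e' r s
  for P :: "'k::field poly poly" and Q d e e' r s +
  fixes \<theta> \<psi> :: "'k fls poly \<Rightarrow> 'k fls poly"
  assumes iso: "iso_on (SS P Q d e) (SS P Q d e') \<theta> \<psi>"
begin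

lemmas isoD = iso_onD[OF iso]

lemma iso': "iso_on (SS P Q d e') (SS P Q d e) \<psi> \<theta>"
  by (rule iso_on_sym[OF iso A.unital_subring_axioms A.gens(5)])

lemmas isoD' = iso_onD[OF iso']

lemma theta_0: "\<theta> 0 = 0" and psi_0: "\<psi> 0 = 0" and theta_1: "\<theta> 1 = 1" and psi_1: "\<psi> 1 = 1"
  using isoD(7)[of 0] isoD'(7)[of 0] isoD(7)[of 1] isoD'(7)[of 1] by (simp_all add: A.kc_0 A.kc_1)

definition D where "D i c = \<theta> (A.std i (\<psi> c))"

lemma theta_sum: "(\<And>i. i \<in> I \<Longrightarrow> f i \<in> SS P Q d e) \<Longrightarrow> \<theta> (sum f I) = (\<Sum>i\<in>I. \<theta> (f i))"
  by (induction I rule: infinite_finite_induct) (simp_all add: theta_0 isoD(5) A.sum_mem)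

lemma theta_power: "a \<in> SS P Q d e \<Longrightarrow> \<theta> (a ^ n) = \<theta> a ^ n"
  by (induction n) (simp_all add: theta_1 isoD(6))

lemma theta_of_nat: "\<theta> (of_nat n) = of_nat n"
  by (induction n) (simp_all add: theta_0 theta_1 isoD(5))

sublocale higher_derivation "SS P Q d e'" "range kc" xx zz C.y C.t weight d e' r s D
proof
  note mem = isoD(1) isoD(3) A.std_mem
  show "D i a \<in> SS P Q d e'" if "a \<in> SS P Q d e'" for a i using that by (simp add: D_def mem)
  show "D i (a + b) = D i a + D i b" if "a \<in> SS P Q d e'" "b \<in> SS P Q d e'" for a b i
    using that by (simp add: D_def isoD'(5) A.std_add isoD(5) mem)
  show "D 0 a = a" if "a \<in> SS P Q d e'" for a using that by (simp add: D_def A.std_0 isoD(4))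
  show "D i (a * b) = (\<Sum>j\<le>i. D j a * D (i - j) b)" if "a \<in> SS P Q d e'" "b \<in> SS P Q d e'" for a b i
    using that by (simp add: D_def isoD'(6) A.std_mult theta_sum isoD(6) mem)
  show "D i (D j a) = of_nat ((i + j) choose i) * D (i + j) a" if "a \<in> SS P Q d e'" for a i j
    using that by (simp add: D_def isoD(2) mem A.std_comp isoD(6) theta_of_nat)
  show "\<exists>m. \<forall>i>m. D i a = 0" if "a \<in> SS P Q d e'" for a
    by (rule exI[of _ "degree (\<psi> a)"]) (simp add: D_def A.std_def hasse_high theta_0)
  show "D i c = 0" if "c \<in> range kc" "i > 0" for c i
    using that by (auto simp: D_def isoD'(7) A.std_const theta_0)
qed

lemma theta_xx_nonconst: "\<theta> xx \<notin> range kc"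
proof
  assume "\<theta> xx \<in> range kc"
  then obtain c where "\<theta> xx = kc c" by blast
  then have "\<psi> (\<theta> xx) = kc c" by (simp add: isoD'(7))
  then have "xx = kc c" using isoD(2) A.gens by simp
  then have "fls_X $$ 1 = (fls_const c $$ 1 :: 'k)" by (simp add: xx_def kc_def)
  then show False by simp
qed

text \<open>The image of x under \<theta> is a nonconstant invariant of the transported higher
  derivation, as the standard one kills x.\<close>

lemma D_xx: "i > 0 \<Longrightarrow> D i xx = 0"
proof (rule constants_force_x[of "\<theta> xx"])
  show "\<theta> xx \<in> SS P Q d e'" by (rule isoD(1)[OF A.gens(1)])
  show "\<theta> xx \<notin> range kc" by (rule theta_xx_nonconst)
  show "D j (\<theta> xx) = 0" if "j > 0" for j
    using that by (simp add: D_def isoD(2) A.gens A.std_const theta_0)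
qed

text \<open>Pulled back by \<psi>, the vanishing of D on x says that all positive Hasse derivatives
  of \<psi>(x) vanish, i.e. that z does not occur in it.\<close>

lemma degree_psi_xx: "degree (\<psi> xx) = 0"
proof (rule degree_0_if_hasse_0)
  fix i :: nat assume "i > 0"
  then have "\<theta> (A.std i (\<psi> xx)) = 0" using D_xx by (simp add: D_def)
  then have "A.std i (\<psi> xx) = 0"
    using isoD(2)[of "A.std i (\<psi> xx)"] A.std_mem isoD(3) C.gens psi_0 by simp
  then show "hasse i (\<psi> xx) = 0" by (simp add: A.std_def)
qed

end

text \<open>The chain rule for a derivation over k[x]. In the second part v stands for the
  derivative of q with respect to Z, of which only membership in S matters.\<close>

lemma derivation_chain:
  assumes E: "\<And>a b. a \<in> S \<Longrightarrow> b \<in> S \<Longrightarrow> E (a + b) = E a + E b"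
    "\<And>a b. a \<in> S \<Longrightarrow> b \<in> S \<Longrightarrow> E (a * b) = E a * b + a * E b" "\<And>c. E (\<kappa> c) = 0" "E x = 0"
    and S: "evaluation S \<kappa> x" and mem: "z \<in> S" "y \<in> S" and E_mem: "\<And>a. a \<in> S \<Longrightarrow> E a \<in> S"
  shows "E (eval2 \<kappa> x z p) = eval2 \<kappa> x z (pderiv p) * E z"
    "\<exists>v\<in>S. E (eval3 \<kappa> x z y q) = eval3 \<kappa> x z y (pderiv q) * E y + E z * v"
proof -
  interpret evaluation S \<kappa> x by (rule S)
  note ev = eval_pCons[OF \<kappa>] eval_0[OF \<kappa>]
  have E0: "E 0 = 0" using E(3)[of 0] ring_morphism_0[OF \<kappa>] by simp
  have 1: "E (eval1 \<kappa> x c) = 0" for c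
    by (induction c) (simp_all add: ev E E0)
  show 2: "E (eval2 \<kappa> x z p) = eval2 \<kappa> x z (pderiv p) * E z" for p
    by (induction p)
      (simp_all add: ev E E0 1 mem pderiv_pCons ring_morphism_add[OF eval_morphism(2)[OF \<kappa>]] algebra_simps)
  show "\<exists>v\<in>S. E (eval3 \<kappa> x z y q) = eval3 \<kappa> x z y (pderiv q) * E y + E z * v"
  proof (induction q)
    case 0
    show ?case by (intro bexI[of _ 0]) (simp_all add: ev E0)
  next
    case (pCons p q)
    then obtain v where v: "v \<in> S" "E (eval3 \<kappa> x z y q) = eval3 \<kappa> x z y (pderiv q) * E y + E z * v" by blast
    have "E (eval3 \<kappa> x z y (pCons p q)) = eval3 \<kappa> x z y (pderiv (pCons p q)) * E y
        + E z * (eval2 \<kappa> x z (pderiv p) + y * v)"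
      by (simp add: ev E 2 v(2) mem pderiv_pCons ring_morphism_add[OF eval_morphism(3)[OF \<kappa>]]
          ring_morphism_0[OF eval_morphism(2)[OF \<kappa>]] algebra_simps)
    moreover have "eval2 \<kappa> x z (pderiv p) + y * v \<in> S" using mem v(1) by simp
    ultimately show ?case by blast
  qed
qed

lemma pderiv_eval2: "pderiv (eval2 kc xx zz p) = (eval2 kc xx zz (pderiv p) :: 'k::field fls poly)"
proof -
  have "evaluation UNIV kc (xx :: 'k fls poly)"
    by unfold_locales (simp_all add: ring_morphism_kc)
  from derivation_chain(1)[of UNIV pderiv, OF _ _ _ _ this]
  show ?thesis by (simp add: pderiv_add pderiv_mult kc_def xx_def zz_def pderiv_pCons mult.commute)
qed

lemma xord_const_le:
  "xord (xx - kc c :: 'k::field fls poly) \<le> 1" "xx \<noteq> (kc c :: 'k fls poly)" "degree (xx - kc c :: 'k fls poly) = 0"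
proof -
  have s: "as_series (xx - kc c :: 'k fls poly) $$ 1 = 1"
    by (simp add: as_series_nth xx_def kc_def map_poly_pCons one_pCons)
  then show "xx \<noteq> (kc c :: 'k fls poly)" by (auto simp: as_series_simps)
  show "xord (xx - kc c :: 'k fls poly) \<le> 1"
    using s below_xord[of 1 "xx - kc c :: 'k fls poly"] by fastforce
  show "degree (xx - kc c :: 'k fls poly) = 0" by (simp add: xx_def kc_def)
qed

context danielewski_iso
begin

lemma theta_xx_nz: "\<theta> xx \<noteq> 0"
  using theta_xx_nonconst A.kc_0 by (metis rangeI)

text \<open>Since \<psi>(x) is free of z it has the form c + x h, and \<theta> turns this into
  \<theta>(x) \<theta>(h) = x - c, of order at most 1. The factor \<theta>(h) has degree 0 in z,
  hence no pole, and so cannot compensate a larger order of \<theta>(x).\<close>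

lemma xord_theta_xx:
  assumes f: "degree (\<theta> xx) = 0"
  shows "xord (\<theta> xx) \<le> 1"
proof -
  have b: "\<psi> xx \<in> SS P Q d e" "\<theta> (\<psi> xx) = xx" using isoD C.gens by auto
  then have "\<psi> xx \<noteq> 0" using theta_0 by (metis A.nz(1))
  then obtain c h where h: "h \<in> SS P Q d e" "\<psi> xx = kc c + xx * h"
    using A.constant_mod_x[OF b(1) _ degree_psi_xx] by blast
  then have "xx = kc c + \<theta> xx * \<theta> h"
    using b(2) A.gens by (simp add: isoD)
  then have eq: "\<theta> xx * \<theta> h = xx - kc c" by (metis add_diff_cancel_left')
  then have hz: "\<theta> h \<noteq> 0" using xord_const_le(2)[of c] by auto
  have "degree (\<theta> xx) + degree (\<theta> h) = 0"
    using degree_mult_eq[OF theta_xx_nz hz] unfolding eq xord_const_le(3) by simp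
  then have "xord (\<theta> h) \<ge> 0" using isoD(1)[OF h(1)] hz A.pos by (intro C.low_degree_integral) auto
  moreover have "xord (\<theta> xx) + xord (\<theta> h) \<le> 1"
    using xord_mult[OF theta_xx_nz hz] xord_const_le(1)[of c] unfolding eq by simp
  ultimately show ?thesis by simp
qed

lemma theta_eval:
  "\<theta> (eval1 kc xx c) = eval1 kc (\<theta> xx) c" "\<theta> (eval2 kc xx zz p) = eval2 kc (\<theta> xx) (\<theta> zz) p"
proof -
  note ev = eval_pCons[OF ring_morphism_kc] eval_0[OF ring_morphism_kc]
  have m: "eval1 kc xx c \<in> SS P Q d e" "eval2 kc xx zz p \<in> SS P Q d e" for c p
    using A.eval1_mem A.eval2_mem A.gens by blast+
  show 1: "\<theta> (eval1 kc xx c) = eval1 kc (\<theta> xx) c" for c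
    by (induction c) (simp_all add: ev theta_0 isoD m A.gens)
  show "\<theta> (eval2 kc xx zz p) = eval2 kc (\<theta> xx) (\<theta> zz) p"
    by (induction p) (simp_all add: ev theta_0 isoD m 1 A.gens)
qed

text \<open>Clearing denominators in \<psi>(z) and applying \<theta> expresses \<theta>(x)^M z as a
  polynomial in \<theta>(z) with coefficients in k((x)). Degrees multiply under composition, and the
  left side has degree 1 in z.\<close>

lemma degree_theta_zz:
  assumes f: "degree (\<theta> xx) = 0"
  shows "degree (\<theta> zz) = 1"
proof -
  have b: "\<psi> zz \<in> SS P Q d e" "\<theta> (\<psi> zz) = zz" using isoD C.gens by auto
  obtain M p where p: "xx ^ M * \<psi> zz = eval2 kc xx zz p" using A.laurent[OF b(1)] by blast
  have "\<theta> xx ^ M * zz = \<theta> (xx ^ M * \<psi> zz)" using b A.gens by (simp add: isoD theta_power)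
  also have "\<dots> = eval2 kc (\<theta> xx) (\<theta> zz) p" unfolding p theta_eval ..
  finally have eq: "\<theta> xx ^ M * zz = eval2 kc (\<theta> xx) (\<theta> zz) p" .
  note ev = eval_pCons[OF ring_morphism_kc] eval_0[OF ring_morphism_kc]
  have "degree (eval1 kc (\<theta> xx) c) = 0" for c
  proof (induction c)
    case (pCons a c)
    have "degree (\<theta> xx * eval1 kc (\<theta> xx) c) \<le> 0"
      using degree_mult_le[of "\<theta> xx" "eval1 kc (\<theta> xx) c"] f pCons by simp
    then have "degree (kc a + \<theta> xx * eval1 kc (\<theta> xx) c) \<le> 0"
      by (intro degree_add_le) (simp_all add: kc_def)
    then show ?case by (simp add: ev)
  qed (simp add: ev)
  then have c: "[:coeff (eval1 kc (\<theta> xx) c) 0:] = eval1 kc (\<theta> xx) c" for c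
    by (metis degree_0_id)
  define p' where "p' = map_poly (\<lambda>c. coeff (eval1 kc (\<theta> xx) c) 0) p"
  have "eval2 kc (\<theta> xx) (\<theta> zz) p = pcompose p' (\<theta> zz)"
    unfolding p'_def
    by (induction p) (simp_all add: ev map_poly_pCons pcompose_pCons c)
  then have "degree (\<theta> xx ^ M * zz) = degree p' * degree (\<theta> zz)"
    unfolding eq by (simp add: degree_pcompose)
  moreover have "degree (\<theta> xx ^ M * zz) = 1"
    using theta_xx_nz f by (simp add: degree_mult_eq degree_power_eq zz_def)
  ultimately show ?thesis by simp
qed

text \<open>With E = \<open>D 1\<close> the equation is \<theta>(x)^n = E(\<theta>(z)) =
  (\<partial>\<theta>(z)/\<partial>z) E(z). The factor E(z) is x^(n+1) times an element a of the
  ring; neither a nor the derivative has a pole, while \<theta>(x) has order at most 1. The orders n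
  and n + 1 clash.\<close>

lemma exponents_not_consecutive:
  assumes hyp: "ideal_of {P_at_0 P, P_at_0 (pderiv P)} = UNIV"
    "ideal_of {[:P_at_0 P:], Q_at_0 Q, Q_at_0 (pderiv Q)} = UNIV"
    and e': "e' = e + 1" and f: "degree (\<theta> xx) = 0"
  shows False
proof -
  let ?C = "SS P Q d e'"
  define n where "n = d + e"
  define E where "E = D 1"
  note Cm = C.gens
  have E_add: "E (a + b) = E a + E b" if "a \<in> ?C" "b \<in> ?C" for a b using that by (simp add: E_def D_add)
  have E_mult: "E (a * b) = E a * b + a * E b" if "a \<in> ?C" "b \<in> ?C" for a b
    using that by (simp add: E_def D_mult)
  have E_kc: "E (kc c) = 0" for c by (simp add: E_def D_const)
  have E_xx: "E xx = 0" by (simp add: E_def D_xx)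
  have E_mem: "E a \<in> ?C" if "a \<in> ?C" for a using that by (simp add: E_def)
  have E_xpow: "E (xx ^ m * a) = xx ^ m * E a" if "a \<in> ?C" for m a
  proof (induction m)
    case (Suc m)
    then show ?case using that Cm E_mult[of xx "xx ^ m * a"] by (simp add: E_xx mult.assoc)
  qed simp
  note chain = derivation_chain[of ?C E, OF E_add E_mult E_kc E_xx evaluation_SS Cm(2,3) E_mem]
  have yr: "xx ^ d * E C.y = eval2 kc xx zz (pderiv P) * E zz"
    using chain(1)[of P] E_xpow[OF Cm(3), of d] by (simp add: xx_yy)
  obtain v where v: "v \<in> ?C" "E (eval3 kc xx zz C.y Q) = eval3 kc xx zz C.y (pderiv Q) * E C.y + E zz * v"
    using chain(2)[of Q] by blast
  have tr: "xx ^ e' * E C.t = eval3 kc xx zz C.y (pderiv Q) * E C.y + E zz * v"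
    using v(2) E_xpow[OF Cm(4), of e'] by (simp add: xx_tt)
  obtain u where u: "\<And>(S :: 'k fls poly set) \<kappa> x z y t d e. evaluation S \<kappa> x \<Longrightarrow> z \<in> S \<Longrightarrow> y \<in> S \<Longrightarrow> t \<in> S \<Longrightarrow>
      d > 0 \<Longrightarrow> e > 0 \<Longrightarrow> x ^ d * y = eval2 \<kappa> x z P \<Longrightarrow> x ^ e * t = eval3 \<kappa> x z y Q \<Longrightarrow>
      \<exists>\<xi>\<in>S. eval3 \<kappa> x z y u * (eval2 \<kappa> x z (pderiv P) * eval3 \<kappa> x z y (pderiv Q)) = 1 + x * \<xi>"
    using inverse_mod_x[OF hyp] by blast
  define U where "U = eval3 kc xx zz C.y u"
  define P' where "P' = eval2 kc xx zz (pderiv P)"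
  define Q' where "Q' = eval3 kc xx zz C.y (pderiv Q)"
  have "\<exists>\<xi>\<in>?C. U * (P' * Q') = 1 + xx * \<xi>"
    unfolding U_def P'_def Q'_def
    by (rule u[OF evaluation_SS Cm(2,3,4) C.pos(1,2) xx_yy xx_tt])
  then obtain \<xi> where \<xi>: "\<xi> \<in> ?C" "U * (P' * Q') = 1 + xx * \<xi>" by blast
  have U: "U \<in> ?C" unfolding U_def by (intro C.eval3_mem Cm)
  obtain d' where d': "d = Suc d'" using C.pos(1) by (cases d) auto
  define w where "w = \<xi> + U * xx ^ d' * v"
  have w: "w \<in> ?C" using U \<xi>(1) v(1) Cm by (simp add: w_def)
  \<comment> \<open>Both defining equations are differentiated, with x^d x^e' = x^(n+1) because e' =
    e + 1, and U inverts P' Q' modulo x.\<close>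
  have "xx ^ (n + 1) * (U * E C.t) = U * (xx ^ d * (xx ^ e' * E C.t))"
    by (simp add: n_def e' power_add mult_ac)
  also have "\<dots> = U * (Q' * (xx ^ d * E C.y) + xx ^ d * E zz * v)"
    unfolding tr Q'_def[symmetric] by (simp add: algebra_simps)
  also have "\<dots> = U * (P' * Q') * E zz + U * xx ^ d * v * E zz"
    unfolding yr P'_def[symmetric] by (simp add: algebra_simps)
  also have "\<dots> = (1 + xx * w) * E zz"
    unfolding \<xi>(2) w_def d' by (simp add: algebra_simps)
  finally have key: "xx ^ (n + 1) * (U * E C.t) = (1 + xx * w) * E zz" .
  \<comment> \<open>The factor 1 + x w need not be a unit of the ring, so divisibility is gained one
    x at a time: a + x w a divisible by x makes a divisible by x.\<close>
  have "\<exists>a\<in>?C. E zz = xx ^ m * a" if "m \<le> n + 1" for m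
    using that
  proof (induction m)
    case 0
    show ?case using E_mem[OF Cm(2)] by simp
  next
    case (Suc m)
    then obtain a where a: "a \<in> ?C" "E zz = xx ^ m * a" by auto
    have "n + 1 = m + Suc (n - m)" using Suc.prems by simp
    then have "xx ^ (n + 1) = xx ^ m * (xx * xx ^ (n - m) :: 'k fls poly)" by (simp only: power_add power_Suc)
    then have "xx ^ m * (xx * xx ^ (n - m) * (U * E C.t)) = xx ^ m * ((1 + xx * w) * a)"
      using key unfolding a(2) by (simp only: mult_ac)
    then have "xx * xx ^ (n - m) * (U * E C.t) = (1 + xx * w) * a" using A.nz(1) by simp
    define b where "b = xx ^ (n - m) * (U * E C.t) - w * a"
    have "a = xx * b" using \<open>xx * xx ^ (n - m) * (U * E C.t) = (1 + xx * w) * a\<close>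
      by (simp add: b_def algebra_simps)
    then have "E zz = xx ^ Suc m * b" unfolding a(2) by (simp add: mult_ac)
    moreover have "b \<in> ?C"
      using U E_mem[OF Cm(4)] w a(1) Cm by (simp add: b_def)
    ultimately show ?case by blast
  qed
  then obtain a where a: "a \<in> ?C" "E zz = xx ^ (n + 1) * a" by blast
  let ?g = "\<theta> zz"
  have g: "?g \<in> ?C" by (rule isoD(1)[OF A.gens(2)])
  obtain M p where p: "xx ^ M * ?g = eval2 kc xx zz p" using C.laurent[OF g] by blast
  have "xx ^ M * E ?g = eval2 kc xx zz (pderiv p) * E zz" using E_xpow[OF g, of M] chain(1)[of p] p by simp
  also have "eval2 kc xx zz (pderiv p) = xx ^ M * pderiv ?g"
    unfolding pderiv_eval2[symmetric] p[symmetric] A.xx_power_const by (simp add: pderiv_smult)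
  finally have Eg: "E ?g = pderiv ?g * E zz" using A.nz(1) by simp
  \<comment> \<open>\<open>D 1\<close> conjugates the standard derivation, whose value at z is x^n
    with n = d + e, the exponent of the source ring.\<close>
  have "E ?g = \<theta> (xx ^ n)"
    by (simp add: E_def D_def isoD(2) A.gens A.std_def n_def hasse_linear zz_def[symmetric] del: One_nat_def)
       (simp add: zz_def hasse_linear)
  then have fn: "\<theta> xx ^ n = pderiv ?g * (xx ^ (n + 1) * a)"
    using Eg A.gens by (simp add: a(2) theta_power)
  have dg: "degree ?g = 1" by (rule degree_theta_zz[OF f])
  then have g0: "?g \<noteq> 0" by auto
  \<comment> \<open>The degree 1 of \<theta>(z) is below r, so \<theta>(z) has no pole; neither has
    its derivative, which is its coefficient at z.\<close>
  have "xord ?g \<ge> 0" using dg C.pos by (intro C.low_degree_integral[OF g g0]) simp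
  then have neg: "coeff ?g i $$ k = 0" if "k < 0" for i k
    using below_xord[of k ?g] that coeff_map_poly[of "\<lambda>c. c $$ k" ?g i] by (simp add: as_series_nth)
  have nz: "pderiv ?g \<noteq> 0" "a \<noteq> 0" using fn theta_xx_nz by auto
  have vb: "as_series (pderiv ?g) $$ k = 0" if "k < 0" for k
  proof -
    have dp: "pderiv ?g = [:coeff ?g 1:]"
      by (rule poly_eqI) (use dg in \<open>auto simp: coeff_pderiv coeff_pCons coeff_eq_0 split: nat.splits\<close>)
    show ?thesis using neg[OF that, of 1] unfolding dp by (simp add: as_series_nth map_poly_pCons)
  qed
  have "xord (pderiv ?g) \<ge> 0" using vb[of "xord (pderiv ?g)"] xlead_nz[OF nz(1)]
    unfolding xlead_def by (meson linorder_not_less)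
  moreover have "degree a = 0"
  proof -
    have "degree (\<theta> xx ^ n) = 0" using f theta_xx_nz by (simp add: degree_power_eq)
    then show ?thesis unfolding fn using nz A.nz(1) by (simp add: degree_mult_eq)
  qed
  then have "xord a \<ge> 0" using C.pos by (intro C.low_degree_integral[OF a(1) nz(2)]) simp
  moreover have "int n * xord (\<theta> xx) = xord (pderiv ?g) + (int (n + 1) + xord a)"
    using arg_cong[OF fn, of xord] nz A.nz(1) theta_xx_nz by (simp add: xord_mult xord_power xx_lead)
  moreover have "int n * xord (\<theta> xx) \<le> int n * 1" using xord_theta_xx[OF f] by (intro mult_left_mono) auto
  ultimately show False by simp
qed

end

theorem not_isomorphic:
  fixes P :: "'k::field poly poly"
  assumes hyp: "ideal_of {P_at_0 P, P_at_0 (pderiv P)} = UNIV"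
    "ideal_of {[:P_at_0 P:], Q_at_0 Q, Q_at_0 (pderiv Q)} = UNIV"
    and A: "danielewski P Q d e r s"
  shows "\<not> subalg kc (SS P Q d e) \<cong>\<^sub>k subalg kc (SS P Q d (e + 1))"
proof
  assume "subalg kc (SS P Q d e) \<cong>\<^sub>k subalg kc (SS P Q d (e + 1))"
  then obtain h where h: "h \<in> ring_iso (subalg kc (SS P Q d e)) (subalg kc (SS P Q d (e + 1)))"
    and hk: "\<And>c. h (kc c) = kc c" unfolding alg_iso_def by auto
  have C: "danielewski P Q d (e + 1) r s" using A unfolding danielewski_def by (blast intro: zero_less_one add_pos_pos)
  have bij: "bij_betw h (SS P Q d e) (SS P Q d (e + 1))" using ring_iso_memE(5)[OF h] by simp
  have "iso_on (SS P Q d e) (SS P Q d (e + 1)) h (inv_into (SS P Q d e) h)"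
    unfolding iso_on_def
    using ring_iso_memE(1-3)[OF h] hk bij_betw_inv_into_left[OF bij] bij_betw_inv_into_right[OF bij]
      bij_betw_apply[OF bij_betw_inv_into[OF bij]] by simp
  then interpret I: danielewski_iso P Q d e "e + 1" r s h "inv_into (SS P Q d e) h"
    using A C by (simp add: danielewski_iso_def danielewski_iso_axioms_def)
  \<comment> \<open>For the inverse isomorphism the roles of e and e + 1 are exchanged, and
    \<open>degree_psi_xx\<close> becomes the missing fact that the image of x under h is free of
    z.\<close>
  interpret J: danielewski_iso P Q d "e + 1" e r s "inv_into (SS P Q d e) h" h
    using A C I.iso' by (simp add: danielewski_iso_def danielewski_iso_axioms_def)
  show False using I.exponents_not_consecutive[OF hyp refl J.degree_psi_xx] .
qed

theorem corollary3p15: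
  fixes P :: "'k::field poly poly" and Q :: "'k poly poly poly" and r s :: nat
  assumes "Polynomial.lead_coeff P = 1" and "Polynomial.degree P = r" and "r \<ge> 2"
    and "Polynomial.lead_coeff Q = 1" and "Polynomial.degree Q = s" and "s \<ge> 2"
    and "ideal_of {P_at_0 P, P_at_0 (pderiv P)} = UNIV"
    and "ideal_of {[:P_at_0 P:], Q_at_0 Q, Q_at_0 (pderiv Q)} = UNIV"
  shows "\<forall>d e. d > 0 \<longrightarrow> e > 0 \<longrightarrow>
           \<not> B_alg P Q d e \<cong>\<^sub>k B_alg P Q d (e + 1) \<and>
           (B_alg P Q d e)\<^sup>[\<^sup>1\<^sup>] \<cong>\<^sub>k (B_alg P Q d (e + 1))\<^sup>[\<^sup>1\<^sup>] \<and>
           cancellation_counterexample (B_alg P Q d e) (B_alg P Q d (e + 1))"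
proof (intro allI impI)
  fix d e :: nat assume de: "d > 0" "e > 0"
  then have D: "danielewski P Q d e r s" using assms unfolding danielewski_def by blast
  have iso: "B_alg P Q d e' \<cong>\<^sub>k subalg kc (SS P Q d e')" if "e' > 0" for e'
    using B_alg_iso_SS[OF assms(1,4) de(1) that] .
  have sym: "subalg kc (SS P Q d e') \<cong>\<^sub>k B_alg P Q d e'" if "e' > 0" for e'
    by (rule alg_iso_sym[OF cring.axioms(1)[OF cring_B_alg] B_alg_scal_mem iso[OF that]])
  have "subalg kc (SS P Q d e) \<cong>\<^sub>k subalg kc (SS P Q d (e + 1))"
    if "B_alg P Q d e \<cong>\<^sub>k B_alg P Q d (e + 1)"
    using alg_iso_trans[OF alg_iso_trans[OF sym[OF de(2)] that] iso] by simp
  then have not_iso: "\<not> B_alg P Q d e \<cong>\<^sub>k B_alg P Q d (e + 1)"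
    using not_isomorphic[OF assms(7,8) D] by blast
  let ?T = "\<lambda>e'. subalg (\<lambda>c. [:kc c:]) (polys_over (SS P Q d e'))"
  have isop: "(B_alg P Q d e')\<^sup>[\<^sup>1\<^sup>] \<cong>\<^sub>k ?T e'" if "e' > 0" for e'
    using poly_alg_B_alg_iso[OF assms(1,4) de(1) that] .
  have symp: "?T e' \<cong>\<^sub>k (B_alg P Q d e')\<^sup>[\<^sup>1\<^sup>]" if "e' > 0" for e'
    by (rule alg_iso_sym[OF cring.axioms(1)[OF cring_poly_alg[OF cring_B_alg]]
          poly_alg_scal[OF cring_B_alg B_alg_scal_mem] isop[OF that]])
  have stable: "(B_alg P Q d e)\<^sup>[\<^sup>1\<^sup>] \<cong>\<^sub>k (B_alg P Q d (e + 1))\<^sup>[\<^sup>1\<^sup>]"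
    using alg_iso_trans[OF alg_iso_trans[OF isop[OF de(2)] stably_isomorphic[OF assms(7,8) de]] symp] by simp
  show "\<not> B_alg P Q d e \<cong>\<^sub>k B_alg P Q d (e + 1) \<and>
      (B_alg P Q d e)\<^sup>[\<^sup>1\<^sup>] \<cong>\<^sub>k (B_alg P Q d (e + 1))\<^sup>[\<^sup>1\<^sup>] \<and>
      cancellation_counterexample (B_alg P Q d e) (B_alg P Q d (e + 1))"
    using not_iso stable fg_algebra_B_alg by (auto simp: cancellation_counterexample_def)
qed

end
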